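(* Let $N\ge2$, $s\in(0,1)$, and let $\Psi\in\bigcap_{r>0}H^1_{\Gamma_r^+}(B_r^+,t^{1-2s}dz)$, $\Psi\not\equiv0$, satisfy $$\int_{\mathbb{R}^{N+1}_+}t^{1-2s}\nabla\Psi\cdot\nabla\Phi\,dz=0\quad\text{for all }\Phi\in C_c^\infty(\overline{\mathbb{R}^{N+1}_+}\setminus\Gamma^+).$$ If, for some $\gamma\ge0$, $\Psi(z)=|z|^\gamma\,\Psi\big(\tfrac{z}{|z|}\big)$, then there exists $j\in\mathbb{N}$ such that $\gamma=j+s$.
   Context: $\mathbb{N}=\{0,1,2,\dots\}$. Points are $z=(y',y_N,t)\in\mathbb{R}^{N-1}\times\mathbb{R}\times\mathbb{R}$; $\mathbb{R}^{N+1}_+=\{t>0\}$; $B_r^+=\{z\in\mathbb{R}^{N+1}_+:|z|<r\}$; $\Gamma^+=\{(y',y_N,0):y_N\ge0\}$; $\Gamma_r^+=\{(y',y_N,0)\in\Gamma^+:|(y',y_N)|<r\}$. $H^1(B_r^+,t^{1-2s}dz)$ is the completion of $C^\infty(\overline{B_r^+})$ with respect to the norm $\big(\int_{B_r^+}t^{1-2s}(|U|^2+|\nabla U|^2)dz\big)^{1/2}$, and $H^1_{\Gamma_r^+}(B_r^+,t^{1-2s}dz)$ is the closure of $C_c^\infty(\overline{B_r^+}\setminus\Gamma_r^+)$ in it. *)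

theory Defs
  imports "HOL-Analysis.Analysis"
begin

text \<open>
  A point \<open>(y', y\<^sub>N, t)\<close> of \<open>\<real>\<^sup>N\<^sup>-\<^sup>1 \<times> \<real> \<times> \<real>\<close>. The dimension is \<open>N = CARD('n) + 1\<close>; since index types
  are nonempty, the types \<open>'n point\<close> cover exactly the cases \<open>N \<ge> 2\<close>. The product norm and inner
  product are the Euclidean ones of \<open>\<real>\<^sup>N\<^sup>+\<^sup>1\<close>.
\<close>
type_synonym 'n point = "(real ^ 'n) \<times> real \<times> real"

abbreviation t_coord :: "'n::finite point \<Rightarrow> real"
  where "t_coord z \<equiv> snd (snd z)"

definition half_space :: "'n::finite point set"
  where "half_space = {z. t_coord z > 0}"

definition half_ball :: "real \<Rightarrow> 'n::finite point set"
  where "half_ball r = {z \<in> half_space. norm z < r}"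

definition Gamma_plus :: "'n::finite point set"
  where "Gamma_plus = {(y', yN, t). t = 0 \<and> yN \<ge> 0}"

definition Gamma_plus_r :: "real \<Rightarrow> 'n::finite point set"
  where "Gamma_plus_r r = {(y', yN, t). (y', yN, t) \<in> Gamma_plus \<and> norm (y', yN) < r}"

primrec C_k :: "nat \<Rightarrow> ('a::euclidean_space \<Rightarrow> real) \<Rightarrow> bool"
  where
    "C_k 0 f \<longleftrightarrow> continuous_on UNIV f"
  | "C_k (Suc k) f \<longleftrightarrow>
       (\<forall>x. f differentiable (at x)) \<and> (\<forall>v. C_k k (\<lambda>x. frechet_derivative f (at x) v))"

text \<open>
  Smooth functions on a closed half-ball or half-space \<open>X\<close> are understood as restrictions to \<open>X\<close> of
  smooth functions on the whole space. We work with the globally defined functions; only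
  their values on \<open>X\<close> matter below.
\<close>
definition C_infinity :: "('a::euclidean_space \<Rightarrow> real) set"
  where "C_infinity = {f. \<forall>k. C_k k f}"

text \<open>
  \<open>C\<^sub>c\<^sup>\<infinity>(X)\<close>. The support is that of the restriction to \<open>X\<close>: nothing is
  required of \<open>f\<close> away from the closure of \<open>X\<close>, and \<open>f\<close> need not vanish on the part of the
  boundary of \<open>X\<close> that belongs to \<open>X\<close>.
\<close>
definition Cc_infinity :: "'a::euclidean_space set \<Rightarrow> ('a \<Rightarrow> real) set"
  where "Cc_infinity X =
    {f \<in> C_infinity. compact (closure {x \<in> X. f x \<noteq> 0}) \<and> closure {x \<in> X. f x \<noteq> 0} \<subseteq> X}"

definition gradient :: "('a::euclidean_space \<Rightarrow> real) \<Rightarrow> 'a \<Rightarrow> 'a"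
  where "gradient f x = (THE D. GDERIV f x :> D)"

text \<open>
  The squared distance \<open>\<integral> t\<^sup>1\<^sup>-\<^sup>2\<^sup>s (|\<phi> - U|\<^sup>2 + |\<nabla>\<phi> - G|\<^sup>2) dz\<close> over the half-ball between a smooth
  function \<open>\<phi>\<close> and an element \<open>(U, G)\<close> of the completion; see \<open>H1\<close>.
\<close>
definition H1_dist2 ::
  "real \<Rightarrow> real \<Rightarrow> ('n::finite point \<Rightarrow> real) \<Rightarrow>
    ('n point \<Rightarrow> real) \<times> ('n point \<Rightarrow> 'n point) \<Rightarrow> ennreal"
  where "H1_dist2 s r \<phi> V =
    (\<integral>\<^sup>+ z \<in> half_ball r.
        ennreal (t_coord z powr (1 - 2 * s) *
          ((\<phi> z - fst V z)\<^sup>2 + (norm (gradient \<phi> z - snd V z))\<^sup>2)) \<partial>lebesgue)"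

text \<open>
  The completion of \<open>C\<^sup>\<infinity>\<close> of the closed half-ball for the weighted norm, realised concretely: the map
  \<open>\<phi> \<mapsto> (\<phi>, \<nabla>\<phi>)\<close> is an isometry into the Hilbert space \<open>L\<^sup>2(t\<^sup>1\<^sup>-\<^sup>2\<^sup>s dz) \<times> L\<^sup>2(t\<^sup>1\<^sup>-\<^sup>2\<^sup>s dz)\<close>, and the
  completion is the closure of its range. The second component of an element \<open>(U, G)\<close> is the
  gradient of \<open>U\<close>; it is determined by \<open>U\<close> up to null sets. Elements are given by representatives,
  whose values outside the half-ball are irrelevant.
\<close>
definition H1 ::
  "real \<Rightarrow> real \<Rightarrow> (('n::finite point \<Rightarrow> real) \<times> ('n point \<Rightarrow> 'n point)) set"
  where "H1 s r =
    {V. fst V \<in> borel_measurable (lebesgue_on (half_ball r)) \<and>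
        snd V \<in> borel_measurable (lebesgue_on (half_ball r)) \<and>
        (\<exists>\<phi>. (\<forall>k::nat. \<phi> k \<in> C_infinity) \<and> (\<lambda>k. H1_dist2 s r (\<phi> k) V) \<longlonglongrightarrow> 0)}"

definition H1_Gamma ::
  "real \<Rightarrow> real \<Rightarrow> (('n::finite point \<Rightarrow> real) \<times> ('n point \<Rightarrow> 'n point)) set"
  where "H1_Gamma s r =
    {V \<in> H1 s r.
        \<exists>\<phi>. (\<forall>k::nat. \<phi> k \<in> Cc_infinity (closure (half_ball r) - Gamma_plus_r r)) \<and>
            (\<lambda>k. H1_dist2 s r (\<phi> k) V) \<longlonglongrightarrow> 0}"

end

(*
  Put a = rho - y_N and b = rho + y_N with rho = |(y_N, t)|. In these coordinates the equation has the
  explicit solutions M_k = a^s Q_k(a, b), Q_k a homogeneous polynomial of degree k, which satisfy the mixed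
  boundary conditions. Testing the equation for Psi with truncations near Gamma^+ of
  M_k (xi . y')^p kappa(|z|^2) and integrating by parts onto the test function gives a linear relation
  between integrals of Psi against such functions. The homogeneity of Psi, differentiated along
  dilations, reduces it to (p + k + s - gamma) times an integral, so if gamma is not in N + s then, by
  induction on p, Psi is orthogonal to all M_k (xi . y')^p kappa(|z|^2). These functions are dense
  (Stone-Weierstrass in (y', |z|^2), then induction on k for the powers of a), hence Psi = 0.
*)
theory Submission
  imports Defs
begin

text \<open>The obstacle is that Psi is only a weighted H1 function. So every derivative is moved
  onto explicit functions, instead of passing to an eigenvalue problem on the half-sphere. The
  exponents come from one formula: in (a, b) the weighted Laplacian maps a^q b^j to (2 / rho) (q (q
  - s) a^(q-1) b^j + j (j - s) a^q b^(j-1)). The possible leading exponents in either variable are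
  thus 0 and s; vanishing on a = 0 selects a^s, the Neumann condition on b = 0 selects integer
  powers of b. The degree of M_k (xi . y')^p is p + k + s, and these degrees are the values of gamma
  at which a scalar factor vanishes. Truncation is needed because a^s is not smooth at Gamma^+; it
  is harmless because the gradient of a^s has size a^(s-1/2) rho^(-1/2), locally square integrable
  for the weight. The radial factor kappa stays arbitrary: moments against kappa' are shown to
  vanish first, then those against kappa by applying this to v kappa (v).\<close>

section \<open>Smooth functions on open sets\<close>

text \<open>A version of \<open>C_k\<close> on a set is needed because \<open>rho\<close> is smooth
  only off the edge \<open>rho z = 0\<close>.\<close>

primrec Ck_on :: "nat \<Rightarrow> 'a::euclidean_space set \<Rightarrow> ('a \<Rightarrow> real) \<Rightarrow> bool"
  where
    "Ck_on 0 S f \<longleftrightarrow> continuous_on S f"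
  | "Ck_on (Suc k) S f \<longleftrightarrow>
       (\<forall>x\<in>S. f differentiable (at x)) \<and> (\<forall>v. Ck_on k S (\<lambda>x. frechet_derivative f (at x) v))"

lemma C_k_eq_Ck_on: "C_k k f \<longleftrightarrow> Ck_on k UNIV f"
  by (induction k arbitrary: f) auto

lemma C_infinity_iff: "f \<in> C_infinity \<longleftrightarrow> (\<forall>k. Ck_on k UNIV f)"
  by (simp add: C_infinity_def C_k_eq_Ck_on)

lemma frechet_derivative_eqI:
  "(f has_derivative f') (at x) \<Longrightarrow> frechet_derivative f (at x) = f'"
  by (rule frechet_derivative_at [symmetric])

lemma Ck_on_cong:
  assumes "open S" "\<And>x. x \<in> S \<Longrightarrow> f x = g x" "Ck_on k S f"
  shows "Ck_on k S g"
  using assms(2,3)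
proof (induction k arbitrary: f g)
  case 0
  then show ?case by (simp cong: continuous_on_cong)
next
  case (Suc k)
  have d: "(g has_derivative frechet_derivative f (at x)) (at x)" if "x \<in> S" for x
  proof (rule has_derivative_transform_within_open[OF _ assms(1) that])
    show "(f has_derivative frechet_derivative f (at x)) (at x)"
      using Suc.prems(2) that by (simp flip: frechet_derivative_works)
  qed (use Suc.prems(1) in simp)
  have "Ck_on k S (\<lambda>x. frechet_derivative g (at x) v)" for v
    by (rule Suc.IH[of "\<lambda>x. frechet_derivative f (at x) v"])
      (use Suc.prems(2) in \<open>auto simp: frechet_derivative_eqI[OF d]\<close>)
  then show ?case using d by (auto simp: differentiable_def)
qed

lemma Ck_on_subset: "Ck_on k S f \<Longrightarrow> T \<subseteq> S \<Longrightarrow> Ck_on k T f"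
  by (induction k arbitrary: f) (auto intro: continuous_on_subset)

lemma Ck_on_Un:
  "open S \<Longrightarrow> open T \<Longrightarrow> Ck_on k S f \<Longrightarrow> Ck_on k T f \<Longrightarrow> Ck_on k (S \<union> T) f"
  by (induction k arbitrary: f) (auto intro: continuous_on_open_Un)

lemma Ck_on_SucI:
  assumes "open S" "\<And>x. x \<in> S \<Longrightarrow> (f has_derivative f' x) (at x)" "\<And>v. Ck_on k S (\<lambda>x. f' x v)"
  shows "Ck_on (Suc k) S f"
proof -
  have "Ck_on k S (\<lambda>x. frechet_derivative f (at x) v)" for v
    by (rule Ck_on_cong[of S "\<lambda>x. f' x v"]) (use assms in \<open>simp_all add: frechet_derivative_eqI[OF assms(2)]\<close>)
  then show ?thesis using assms by (auto simp: differentiable_def)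
qed

lemma Ck_on_Suc_has_derivative:
  "Ck_on (Suc k) S f \<Longrightarrow> x \<in> S \<Longrightarrow> (f has_derivative frechet_derivative f (at x)) (at x)"
  by (simp flip: frechet_derivative_works)

lemma Ck_on_SucD: "Ck_on (Suc k) S f \<Longrightarrow> Ck_on k S f"
proof (induction k arbitrary: f)
  case 0
  then show ?case
    by (auto simp: continuous_at_imp_continuous_on differentiable_imp_continuous_within)
next
  case (Suc k)
  then show ?case by (metis Ck_on.simps(2))
qed

lemma Ck_on_const [intro, simp]: "Ck_on k S (\<lambda>x. c)"
  by (induction k arbitrary: c) auto

lemma Ck_on_add:
  assumes "open S" shows "Ck_on k S f \<Longrightarrow> Ck_on k S g \<Longrightarrow> Ck_on k S (\<lambda>x. f x + g x)"
proof (induction k arbitrary: f g)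
  case (Suc k)
  show ?case
    by (rule Ck_on_SucI[OF assms has_derivative_add[OF Ck_on_Suc_has_derivative[OF Suc.prems(1)]
             Ck_on_Suc_has_derivative[OF Suc.prems(2)]]]) (use Suc in auto)
qed (auto intro!: continuous_intros)

lemma Ck_on_mult:
  assumes "open S" shows "Ck_on k S f \<Longrightarrow> Ck_on k S g \<Longrightarrow> Ck_on k S (\<lambda>x. f x * g x)"
proof (induction k arbitrary: f g)
  case (Suc k)
  have *: "Ck_on k S (\<lambda>x. f x * frechet_derivative g (at x) v + frechet_derivative f (at x) v * g x)" for v
    using Suc Ck_on_SucD[OF Suc.prems(1)] Ck_on_SucD[OF Suc.prems(2)]
    by (intro Ck_on_add[OF assms] Suc.IH) auto
  show ?case
    by (rule Ck_on_SucI[OF assms has_derivative_mult[OF Ck_on_Suc_has_derivative[OF Suc.prems(1)]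
             Ck_on_Suc_has_derivative[OF Suc.prems(2)]]]) (use * in auto)
qed (auto intro!: continuous_intros)

lemma Ck_on_minus: "open S \<Longrightarrow> Ck_on k S f \<Longrightarrow> Ck_on k S (\<lambda>x. - f x)"
  using Ck_on_mult[of S k "\<lambda>_. -1" f] by simp

lemma Ck_on_diff: "open S \<Longrightarrow> Ck_on k S f \<Longrightarrow> Ck_on k S g \<Longrightarrow> Ck_on k S (\<lambda>x. f x - g x)"
  using Ck_on_add[of S k f "\<lambda>x. - g x"] Ck_on_minus[of S k g] by simp

lemma Ck_on_power: "open S \<Longrightarrow> Ck_on k S f \<Longrightarrow> Ck_on k S (\<lambda>x. f x ^ m)"
  by (induction m) (auto intro: Ck_on_mult)

lemma Ck_on_sum: "open S \<Longrightarrow> (\<And>i. i \<in> I \<Longrightarrow> Ck_on k S (f i)) \<Longrightarrow> Ck_on k S (\<lambda>x. \<Sum>i\<in>I. f i x)"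
  by (induction I rule: infinite_finite_induct) (auto intro: Ck_on_add)

lemma Ck_on_bounded_linear:
  assumes "open S" "bounded_linear f" shows "Ck_on k S f"
proof (cases k)
  case 0
  then show ?thesis
    using assms by (auto intro: linear_continuous_on)
next
  case (Suc m)
  show ?thesis unfolding Suc
    by (rule Ck_on_SucI[OF assms(1) bounded_linear_imp_has_derivative[OF assms(2)]]) auto
qed

lemma Ck_on_compose:
  fixes g :: "real \<Rightarrow> real"
  assumes "open S" "f ` S \<subseteq> T"
  shows "Ck_on k T g \<Longrightarrow> Ck_on k S f \<Longrightarrow> Ck_on k S (\<lambda>x. g (f x))"
  using assms(2)
proof (induction k arbitrary: g f)
  case 0
  then show ?case by (auto intro: continuous_on_compose2)
next
  case (Suc k)
  have d: "(g has_real_derivative frechet_derivative g (at y) 1) (at y)" if "y \<in> T" for y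
  proof -
    have g': "(g has_derivative frechet_derivative g (at y)) (at y)"
      using Ck_on_Suc_has_derivative[OF Suc.prems(1) that] .
    have "frechet_derivative g (at y) v = frechet_derivative g (at y) 1 * v" for v
      using linear_scale[OF has_derivative_linear[OF g'], of v 1] by simp
    then have "frechet_derivative g (at y) = (*) (frechet_derivative g (at y) 1)" by (rule ext)
    with g' show ?thesis by (simp add: has_field_derivative_def)
  qed
  have dd: "((\<lambda>x. g (f x)) has_derivative
      (\<lambda>v. frechet_derivative g (at (f x)) 1 * frechet_derivative f (at x) v)) (at x)" if "x \<in> S" for x
    using has_derivative_compose[OF Ck_on_Suc_has_derivative[OF Suc.prems(2) that],
        of g "(*) (frechet_derivative g (at (f x)) 1)"] d[of "f x"] that Suc.prems(3)
    by (auto simp: has_field_derivative_def)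
  have "Ck_on k S (\<lambda>x. frechet_derivative g (at (f x)) 1 * frechet_derivative f (at x) v)" for v
    using Suc.prems Ck_on_SucD[OF Suc.prems(2)]
    by (intro Ck_on_mult assms Suc.IH[of "\<lambda>y. frechet_derivative g (at y) 1"]) auto
  with Ck_on_SucI[OF assms(1) dd] show ?case by blast
qed

lemma Ck_on_real_SucI:
  fixes f :: "real \<Rightarrow> real"
  assumes "open S" "\<And>x. x \<in> S \<Longrightarrow> (f has_real_derivative f' x) (at x)" "Ck_on k S f'"
  shows "Ck_on (Suc k) S f"
  using assms
  by (intro Ck_on_SucI[of S f "\<lambda>x v. f' x * v"])
     (auto simp: has_field_derivative_def intro: Ck_on_mult)

lemma Ck_on_real_Suc_deriv:
  fixes f :: "real \<Rightarrow> real"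
  assumes "open S" "Ck_on (Suc k) S f"
  shows "\<And>x. x \<in> S \<Longrightarrow> (f has_real_derivative deriv f x) (at x)" "Ck_on k S (deriv f)"
proof -
  show d: "(f has_real_derivative deriv f x) (at x)" if "x \<in> S" for x
    using assms that DERIV_deriv_iff_real_differentiable by auto
  have "frechet_derivative f (at x) 1 = deriv f x" if "x \<in> S" for x
    using d[OF that] by (subst frechet_derivative_eqI[of f "(*) (deriv f x)"])
      (auto simp: has_field_derivative_def)
  then show "Ck_on k S (deriv f)"
    using Ck_on_cong[OF assms(1), of "\<lambda>x. frechet_derivative f (at x) 1" "deriv f" k] assms(2) by simp
qed

lemma Ck_on_inverse: "Ck_on k (- {0}) (inverse :: real \<Rightarrow> real)"
proof (induction k)
  case (Suc k)
  show ?case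
    by (rule Ck_on_real_SucI[where f' = "\<lambda>x. - (inverse x * inverse x)"])
       (use Suc in \<open>auto intro!: Ck_on_minus Ck_on_mult derivative_eq_intros simp: open_delete\<close>)
qed (auto intro!: continuous_intros)

lemma Ck_on_powr: "Ck_on k {0<..} (\<lambda>x::real. x powr s)"
proof (induction k arbitrary: s)
  case (Suc k)
  show ?case
    by (rule Ck_on_real_SucI[where f' = "\<lambda>x. s * x powr (s - 1)"])
       (use Suc in \<open>auto intro!: Ck_on_mult has_real_derivative_powr\<close>)
qed (auto intro!: continuous_intros)

section \<open>A smooth bump and a smooth step\<close>

definition bump :: "real \<Rightarrow> real"
  where "bump x = (if x > 0 then exp (- 1 / x) else 0)"

text \<open>Up to linear combinations the family \<open>b m\<close>, that is x^(-m) exp (-1/x)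
  extended by 0, is closed under differentiation, so the induction runs over all \<open>m\<close> at
  once. The behaviour at 0 comes from x^m exp (-x) tending to 0 at infinity.\<close>

lemma Ck_on_bump: "Ck_on k UNIV bump"
proof -
  define b where "b m x = (if x > 0 then (1 / x) ^ m * exp (- 1 / x) else 0)" for m :: nat and x :: real
  have lim: "(b m \<longlongrightarrow> 0) (at 0)" for m
  proof -
    have "((\<lambda>x. x ^ m / exp x) \<longlongrightarrow> 0) (at_top :: real filter)"
      by (rule tendsto_power_div_exp_0)
    then have "((\<lambda>x. (inverse x) ^ m / exp (inverse x)) \<longlongrightarrow> 0) (at_right (0::real))"
      by (rule filterlim_compose[OF _ filterlim_inverse_at_top_right])
    then have r: "(b m \<longlongrightarrow> 0) (at_right 0)"
      by (rule tendsto_cong[THEN iffD1, rotated])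
         (auto simp: b_def eventually_at_filter exp_minus field_simps)
    have l: "(b m \<longlongrightarrow> 0) (at_left 0)"
      by (rule tendsto_cong[THEN iffD1, OF _ tendsto_const])
         (auto simp: b_def eventually_at_filter)
    from l r show ?thesis by (rule filterlim_split_at)
  qed
  have der: "(b m has_real_derivative (- real m * b (m + 1) x + b (m + 2) x)) (at x)" for m x
  proof -
    consider "x > 0" | "x < 0" | "x = 0" by linarith
    then show ?thesis
    proof cases
      case 1
      have "((\<lambda>x. (1 / x) ^ m * exp (- 1 / x)) has_real_derivative
          (- real m * b (m + 1) x + b (m + 2) x)) (at x)"
      proof -
        have "((\<lambda>x. (1 / x) ^ m) has_real_derivative (- real m * (1 / x) ^ (m + 1))) (at x)"
        proof (induction m)
          case (Suc m)
          have "((\<lambda>x. 1 / x) has_real_derivative (- ((1 / x) ^ 2))) (at x)"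
            using 1 by (auto intro!: derivative_eq_intros simp: power2_eq_square)
          from DERIV_mult[OF this Suc] show ?case
            by (simp add: algebra_simps power2_eq_square add_divide_distrib diff_divide_distrib)
        qed simp
        moreover have "((\<lambda>x. exp (- 1 / x)) has_real_derivative (exp (- 1 / x) * (1 / x) ^ 2)) (at x)"
          using 1 by (auto intro!: derivative_eq_intros simp: power2_eq_square)
        ultimately show ?thesis
          using 1 by (intro DERIV_cong[OF DERIV_mult]) (auto simp: b_def field_simps power2_eq_square)
      qed
      then show ?thesis
        by (rule has_field_derivative_transform_within_open[of _ _ _ "{0<..}"]) (use 1 in \<open>auto simp: b_def\<close>)
    next
      case 2
      have "((\<lambda>x. 0) has_real_derivative (- real m * b (m + 1) x + b (m + 2) x)) (at x)"
        using 2 by (auto simp: b_def)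
      then show ?thesis
        by (rule has_field_derivative_transform_within_open[of _ _ _ "{..<0}"]) (use 2 in \<open>auto simp: b_def\<close>)
    next
      case 3
      \<comment> \<open>The difference quotient of \<open>b m\<close> at 0 is
        \<open>b (Suc m)\<close>, so its limit is again 0.\<close>
      have "((\<lambda>h. (b m (0 + h) - b m 0) / h) \<longlongrightarrow> 0) (at 0)"
        by (rule tendsto_cong[THEN iffD1, OF _ lim[of "Suc m"]])
           (auto simp: b_def eventually_at_filter)
      then show ?thesis using 3 by (auto simp: DERIV_def b_def)
    qed
  qed
  have "Ck_on k UNIV (b m)" for m
  proof (induction k arbitrary: m)
    case 0
    show ?case
      unfolding Ck_on.simps by (intro continuous_at_imp_continuous_on ballI DERIV_isCont[OF der])
  next
    case (Suc k)
    show ?case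
      by (rule Ck_on_real_SucI[OF _ der]) (intro Ck_on_add Ck_on_mult Ck_on_const Suc open_UNIV)+
  qed
  moreover have "b 0 = bump" by (auto simp: b_def bump_def)
  ultimately show ?thesis by metis
qed

text \<open>The usual transition from 0 (x <= 1) to 1 (x >= 2). The denominator is positive
  everywhere because x > 1 or x < 2.\<close>

definition smooth_step :: "real \<Rightarrow> real"
  where "smooth_step x = bump (x - 1) / (bump (x - 1) + bump (2 - x))"

lemma smooth_step_eq_0 [simp]: "x \<le> 1 \<Longrightarrow> smooth_step x = 0"
  and smooth_step_eq_1 [simp]: "x \<ge> 2 \<Longrightarrow> smooth_step x = 1"
  by (auto simp: smooth_step_def bump_def)

lemma smooth_step_bounds: "0 \<le> smooth_step x" "smooth_step x \<le> 1"
proof -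
  have "bump y \<ge> 0" for y by (simp add: bump_def)
  then show "0 \<le> smooth_step x" "smooth_step x \<le> 1"
    unfolding smooth_step_def
    using divide_right_mono[of "bump (x - 1)" "bump (x - 1) + bump (2 - x)" "bump (x - 1) + bump (2 - x)"]
    by (cases "bump (x - 1) + bump (2 - x) = 0"; simp add: add_nonneg_nonneg)+
qed

lemma Ck_on_affine: "Ck_on k UNIV (\<lambda>x::real. b * x + c)"
  by (rule Ck_on_add[OF _ Ck_on_bounded_linear[OF _ bounded_linear_mult_right] Ck_on_const]) auto

lemma Ck_on_smooth_step: "Ck_on k UNIV smooth_step"
proof -
  have b1: "Ck_on k UNIV (\<lambda>x. bump (x - 1))" and b2: "Ck_on k UNIV (\<lambda>x. bump (2 - x))"
    using Ck_on_compose[of UNIV "\<lambda>x. 1 * x + (- 1)" UNIV k bump, OF _ _ Ck_on_bump Ck_on_affine]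
      Ck_on_compose[of UNIV "\<lambda>x. (-1) * x + 2" UNIV k bump, OF _ _ Ck_on_bump Ck_on_affine]
    by auto
  have "bump (x - 1) + bump (2 - x) \<noteq> 0" for x
  proof -
    have "0 < bump (x - 1) \<or> 0 < bump (2 - x)" "0 \<le> bump (x - 1)" "0 \<le> bump (2 - x)"
      by (auto simp: bump_def)
    then show ?thesis by linarith
  qed
  then have "Ck_on k UNIV (\<lambda>x. bump (x - 1) * inverse (bump (x - 1) + bump (2 - x)))"
    by (intro Ck_on_mult b1 Ck_on_compose[of _ _ _ _ inverse, OF _ _ Ck_on_inverse] Ck_on_add b2) auto
  then show ?thesis by (simp add: smooth_step_def[abs_def] divide_inverse)
qed

section \<open>Gradients and differentiation along affine flows\<close>

lemma gradient_eqI: "GDERIV f x :> D \<Longrightarrow> gradient f x = D"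
proof -
  assume D: "GDERIV f x :> D"
  have "D' = D" if "GDERIV f x :> D'" for D'
  proof -
    have "(\<lambda>h. h \<bullet> D') = (\<lambda>h. h \<bullet> D)"
      using D that unfolding gderiv_def by (rule has_derivative_unique[rotated])
    then have "(D' - D) \<bullet> D' = (D' - D) \<bullet> D" by metis
    then have "(D' - D) \<bullet> (D' - D) = 0" by (simp add: inner_diff_right)
    then show ?thesis by simp
  qed
  with D show ?thesis unfolding gradient_def by blast
qed

lemma differentiable_GDERIV:
  fixes f :: "'a::euclidean_space \<Rightarrow> real"
  assumes "f differentiable (at x)" shows "GDERIV f x :> gradient f x"
proof -
  obtain f' where f': "(f has_derivative f') (at x)" using assms by (auto simp: differentiable_def)
  define D where "D = (\<Sum>b\<in>Basis. f' b *\<^sub>R b)"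
  have "f' h = h \<bullet> D" for h
  proof -
    have "f' h = f' (\<Sum>b\<in>Basis. (h \<bullet> b) *\<^sub>R b)" by (simp add: euclidean_representation)
    also have "\<dots> = (\<Sum>b\<in>Basis. (h \<bullet> b) * f' b)"
      using has_derivative_linear[OF f'] by (simp add: linear_sum linear_scale)
    finally show ?thesis by (simp add: D_def inner_sum_right mult.commute)
  qed
  then have "f' = (\<lambda>h. h \<bullet> D)" by (rule ext)
  with f' have "GDERIV f x :> D" unfolding gderiv_def by simp
  with gradient_eqI[OF this] show ?thesis by simp
qed

lemma C_infinity_has_derivative:
  "f \<in> C_infinity \<Longrightarrow> (f has_derivative (\<lambda>h. gradient f x \<bullet> h)) (at x)"
  using differentiable_GDERIV[of f x] C_infinity_iff[of f] Ck_on.simps(2)[of 0 UNIV f]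
  by (auto simp: gderiv_def inner_commute)

lemma C_infinity_gradient:
  assumes "f \<in> C_infinity" shows "(\<lambda>x. gradient f x \<bullet> v) \<in> C_infinity"
proof -
  have "(\<lambda>x. frechet_derivative f (at x) v) = (\<lambda>x. gradient f x \<bullet> v)"
    by (simp add: frechet_derivative_eqI[OF C_infinity_has_derivative[OF assms]])
  moreover have "Ck_on k UNIV (\<lambda>x. frechet_derivative f (at x) v)" for k
    using assms C_infinity_iff Ck_on.simps(2) by blast
  ultimately show ?thesis by (simp add: C_infinity_iff)
qed

lemma C_infinity_continuous: "f \<in> C_infinity \<Longrightarrow> continuous_on S f"
  by (metis C_infinity_iff Ck_on.simps(1) continuous_on_subset subset_UNIV)

lemma C_infinity_gradient_continuous: "f \<in> C_infinity \<Longrightarrow> continuous_on S (gradient f)"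
  by (subst continuous_on_componentwise) (auto intro: C_infinity_continuous C_infinity_gradient)

lemma C_infinity_mult: "f \<in> C_infinity \<Longrightarrow> g \<in> C_infinity \<Longrightarrow> (\<lambda>x. f x * g x) \<in> C_infinity"
  by (simp add: C_infinity_iff Ck_on_mult)

lemma gradient_mult:
  assumes "f \<in> C_infinity" "g \<in> C_infinity"
  shows "gradient (\<lambda>x. f x * g x) x = f x *\<^sub>R gradient g x + g x *\<^sub>R gradient f x"
proof -
  have "((\<lambda>x. f x * g x) has_derivative
      (\<lambda>h. h \<bullet> (f x *\<^sub>R gradient g x + g x *\<^sub>R gradient f x))) (at x)"
    by (rule has_derivative_eq_rhs[OF has_derivative_mult[OF assms[THEN C_infinity_has_derivative]]])
      (auto simp: fun_eq_iff inner_add_right inner_commute algebra_simps)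
  then show ?thesis by (intro gradient_eqI) (simp add: gderiv_def)
qed

lemma gradient_eq_0_outside:
  fixes f :: "'a::euclidean_space \<Rightarrow> real"
  assumes "\<And>x. norm x > R \<Longrightarrow> f x = 0" "norm x > R"
  shows "gradient f x = 0"
proof (rule gradient_eqI)
  have "((\<lambda>_. 0) has_derivative (\<lambda>h. 0)) (at x)" by simp
  then have "(f has_derivative (\<lambda>h. 0)) (at x)"
    by (rule has_derivative_transform_within_open[of _ _ _ _ "- cball 0 R"]) (use assms in auto)
  then show "GDERIV f x :> 0" by (simp add: gderiv_def)
qed

lemma continuous_compact_support_bounded:
  fixes f :: "'a::euclidean_space \<Rightarrow> 'b::real_normed_vector"
  assumes "continuous_on UNIV f" "\<And>x. norm x > R \<Longrightarrow> f x = 0"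
  shows "\<exists>B\<ge>0. \<forall>x. norm (f x) \<le> B"
proof -
  have "compact (f ` cball 0 R)"
    using assms(1) by (intro compact_continuous_image) (auto intro: continuous_on_subset)
  then obtain B where B: "B > 0" "\<And>x. x \<in> cball 0 R \<Longrightarrow> norm (f x) \<le> B"
    using compact_imp_bounded bounded_pos by (metis imageI)
  have "norm (f x) \<le> B" for x
    using B assms(2)[of x] by (cases "norm x > R") auto
  with B(1) show ?thesis by (meson less_imp_le)
qed

text \<open>Supplies the dominating constant for the difference quotients in
  \<open>integral_derivative_along_flow\<close>.\<close>

lemma C_infinity_compact_support_Lipschitz:
  fixes f :: "'a::euclidean_space \<Rightarrow> real"
  assumes "f \<in> C_infinity" "\<And>x. norm x > R \<Longrightarrow> f x = 0"
  shows "\<exists>L\<ge>0. \<forall>x y. \<bar>f x - f y\<bar> \<le> L * norm (x - y)"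
proof -
  have g0: "gradient f x = 0" if "norm x > R" for x
    using gradient_eq_0_outside[of R f x] assms(2) that by simp
  obtain B where B: "B \<ge> 0" "\<And>x. norm (gradient f x) \<le> B"
    using continuous_compact_support_bounded[OF C_infinity_gradient_continuous[OF assms(1)] g0] by blast
  have on: "onorm (\<lambda>h. gradient f x \<bullet> h) \<le> B" for x
  proof (rule onorm_le)
    fix h
    have "\<bar>gradient f x \<bullet> h\<bar> \<le> norm (gradient f x) * norm h" by (rule Cauchy_Schwarz_ineq2)
    also have "\<dots> \<le> B * norm h" using B by (intro mult_right_mono) auto
    finally show "norm (gradient f x \<bullet> h) \<le> B * norm h" by simp
  qed
  have "norm (f x - f y) \<le> B * norm (x - y)" for x y
    by (rule differentiable_bound[of UNIV f "\<lambda>x h. gradient f x \<bullet> h" B])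
       (use on C_infinity_has_derivative[OF assms(1)] in auto)
  with B(1) show ?thesis by auto
qed

section \<open>Locally integrable weights and derivatives along flows\<close>

definition loc_integrable :: "('a::euclidean_space \<Rightarrow> real) \<Rightarrow> bool"
  where "loc_integrable w \<longleftrightarrow> (\<forall>r. integrable lebesgue (\<lambda>z. indicator (cball 0 r) z * w z))"

lemma borel_measurable_lebesgueI: "f \<in> borel_measurable borel \<Longrightarrow> f \<in> borel_measurable lebesgue"
  by (simp add: measurable_completion)

lemma loc_integrable_measurable:
  assumes "loc_integrable w" shows "w \<in> borel_measurable lebesgue"
proof (rule borel_measurable_LIMSEQ_real)
  show "(\<lambda>n. indicator (cball 0 (real n)) z * w z) \<longlonglongrightarrow> w z" for z
  proof (rule tendsto_eventually)
    obtain N :: nat where N: "norm z \<le> real N" using real_arch_simple by blast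
    show "\<forall>\<^sub>F n in sequentially. indicator (cball 0 (real n)) z * w z = w z"
      using eventually_ge_at_top[of N] by eventually_elim (use N in auto)
  qed
  show "(\<lambda>z. indicator (cball 0 (real n)) z * w z) \<in> borel_measurable lebesgue" for n
    using assms unfolding loc_integrable_def by (intro borel_measurable_integrable) blast
qed

lemma loc_integrable_mult:
  assumes w: "loc_integrable w" and g: "g \<in> borel_measurable lebesgue"
    and B: "\<And>z. \<bar>g z\<bar> \<le> B" and R: "\<And>z. norm z > R \<Longrightarrow> g z = 0"
  shows "integrable lebesgue (\<lambda>z. w z * g z)"
proof (rule Bochner_Integration.integrable_bound)
  show "integrable lebesgue (\<lambda>z. B * (indicator (cball 0 R) z * w z))"
    using w unfolding loc_integrable_def by (intro integrable_mult_right) blast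
  show "(\<lambda>z. w z * g z) \<in> borel_measurable lebesgue"
    using loc_integrable_measurable[OF w] g by measurable
  have "norm (w z * g z) \<le> norm (B * (indicator (cball 0 R) z * w z))" for z
  proof (cases "norm z > R")
    case False
    have "\<bar>g z\<bar> \<le> \<bar>B\<bar>" using B[of z] by linarith
    then have "\<bar>w z\<bar> * \<bar>g z\<bar> \<le> \<bar>w z\<bar> * \<bar>B\<bar>" by (rule mult_left_mono) auto
    with False show ?thesis by (simp add: abs_mult mult.commute)
  qed (simp add: R)
  then show "AE z in lebesgue. norm (w z * g z) \<le> norm (B * (indicator (cball 0 R) z * w z))" by simp
qed

lemma tendsto_inverse_Suc: "(\<lambda>n. inverse (real (Suc n))) \<longlonglongrightarrow> 0"
  by (rule LIMSEQ_inverse_real_of_nat)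

lemma DERIV_LIMSEQ:
  assumes "(f has_real_derivative d) (at 0)"
  shows "(\<lambda>n. (f (inverse (real (Suc n))) - f 0) / inverse (real (Suc n))) \<longlonglongrightarrow> d"
proof -
  have "((\<lambda>h. (f (0 + h) - f 0) / h) \<longlongrightarrow> d) (at 0)"
    using assms by (simp add: DERIV_def)
  moreover have "filterlim (\<lambda>n. inverse (real (Suc n))) (at 0) sequentially"
    by (rule filterlim_atI[OF tendsto_inverse_Suc]) auto
  ultimately show ?thesis
    using filterlim_compose[of "\<lambda>h. (f (0 + h) - f 0) / h" "nhds d" "at 0"] by auto
qed

text \<open>
  Differentiate at \<open>h = 0\<close> the scaling identity for the maps \<open>z + h X z\<close>, whose Jacobian is
  \<open>(1 + h) ^ card D\<close>. Translations, the dilation in \<open>t\<close> alone and the full dilation are all of this form,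
  so no divergence theorem and no polar coordinates are needed.
\<close>
lemma integral_derivative_along_flow:
  fixes w f :: "'a::euclidean_space \<Rightarrow> real" and e :: 'a
  defines "X \<equiv> \<lambda>D z. e + (\<Sum>j\<in>D. (z \<bullet> j) *\<^sub>R j)"
  assumes D: "D \<subseteq> Basis" and w: "loc_integrable w"
    and f: "f \<in> C_infinity" "\<And>z. norm z > R \<Longrightarrow> f z = 0"
    and hom: "\<And>h. 0 < h \<Longrightarrow> h \<le> 1 \<Longrightarrow>
      AE z in lebesgue. w (z + h *\<^sub>R X D z) = (1 + h) powr q * w z"
  shows "(\<integral>z. w z * (gradient f z \<bullet> X D z) \<partial>lebesgue) =
    - (q + real (card D)) * (\<integral>z. w z * f z \<partial>lebesgue)"
proof -
  define Y where "Y = X D"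
  define h where "h n = inverse (real (Suc n))" for n
  have h: "0 < h n" "h n \<le> 1" for n by (auto simp: h_def field_simps)
  have finD: "finite D" using D finite_subset finite_Basis by blast
  obtain L where L: "L \<ge> 0" "\<And>x y. \<bar>f x - f y\<bar> \<le> L * norm (x - y)"
    using C_infinity_compact_support_Lipschitz[OF f] by blast
  obtain B where B: "B \<ge> 0" "\<And>x. norm (f x) \<le> B"
    using continuous_compact_support_bounded[OF C_infinity_continuous[OF f(1)] f(2)] by blast
  have fm [measurable]: "f \<in> borel_measurable borel"
    by (intro borel_measurable_continuous_onI C_infinity_continuous f)
  have Ycont: "continuous_on UNIV Y" unfolding Y_def X_def by (intro continuous_intros)
  then have Ym [measurable]: "Y \<in> borel_measurable borel" by (intro borel_measurable_continuous_onI)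
  have inner_D: "(\<Sum>j\<in>D. (z \<bullet> j) *\<^sub>R j) \<bullet> b = (if b \<in> D then z \<bullet> b else 0)" if "b \<in> Basis" for z b
  proof -
    have "(\<Sum>j\<in>D. (z \<bullet> j) *\<^sub>R j) \<bullet> b = (\<Sum>j\<in>D. if j = b then z \<bullet> b else 0)"
      unfolding inner_sum_left using D that by (intro sum.cong) (auto simp: inner_Basis)
    then show ?thesis using finD by (simp add: sum.delta)
  qed
  have Ynorm: "norm (Y z) \<le> norm e + norm z" for z
  proof -
    have "norm (\<Sum>j\<in>D. (z \<bullet> j) *\<^sub>R j) \<le> norm z"
      by (rule norm_le_componentwise) (auto simp: inner_D)
    with norm_triangle_ineq[of e "\<Sum>j\<in>D. (z \<bullet> j) *\<^sub>R j"] show ?thesis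
      unfolding Y_def X_def by linarith
  qed
  \<comment> \<open>The diagonal part of the map only expands, so \<open>z\<close> is controlled by
    its image. All composed functions therefore vanish outside one ball, whatever \<open>n\<close>
    is.\<close>
  have proper: "norm z \<le> norm (z + h n *\<^sub>R Y z) + norm e" for z n
  proof -
    have "norm z \<le> norm (z + h n *\<^sub>R (\<Sum>j\<in>D. (z \<bullet> j) *\<^sub>R j))"
    proof (rule norm_le_componentwise)
      fix b :: 'a assume b: "b \<in> Basis"
      have "\<bar>z \<bullet> b\<bar> \<le> \<bar>(1 + h n) * (z \<bullet> b)\<bar>"
        using h[of n] by (simp add: abs_mult mult_le_cancel_right1)
      then show "\<bar>z \<bullet> b\<bar> \<le> \<bar>(z + h n *\<^sub>R (\<Sum>j\<in>D. (z \<bullet> j) *\<^sub>R j)) \<bullet> b\<bar>"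
        using inner_D[OF b] by (auto simp: inner_add_left algebra_simps)
    qed
    also have "z + h n *\<^sub>R (\<Sum>j\<in>D. (z \<bullet> j) *\<^sub>R j) = (z + h n *\<^sub>R Y z) - h n *\<^sub>R e"
      by (simp add: Y_def X_def scaleR_add_right)
    also have "norm \<dots> \<le> norm (z + h n *\<^sub>R Y z) + norm (h n *\<^sub>R e)" by (rule norm_triangle_ineq4)
    also have "norm (h n *\<^sub>R e) \<le> norm e"
      using h[of n] by (simp add: mult_left_le_one_le)
    finally show ?thesis by simp
  qed
  have far: "f (z + h n *\<^sub>R Y z) = 0" "f z = 0" if "norm z > R + norm e" for z n
    using proper[of z n] that norm_ge_zero[of e] by (auto intro!: f(2) simp del: norm_ge_zero)
  define g where "g n z = (f (z + h n *\<^sub>R Y z) - f z) / h n" for n z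
  have gbound: "\<bar>g n z\<bar> \<le> L * (norm e + \<bar>R + norm e\<bar>)" for n z
  proof (cases "norm z > R + norm e")
    case True
    then show ?thesis using L(1) far[OF True] by (simp add: g_def)
  next
    case False
    have "\<bar>f (z + h n *\<^sub>R Y z) - f z\<bar> \<le> L * norm (h n *\<^sub>R Y z)" using L(2)[of "z + h n *\<^sub>R Y z" z] by simp
    then have "\<bar>g n z\<bar> \<le> L * norm (Y z)"
      using h[of n] by (simp add: g_def field_simps)
    also have "\<dots> \<le> L * (norm e + \<bar>R + norm e\<bar>)"
      using L(1) Ynorm[of z] False by (intro mult_left_mono) linarith+
    finally show ?thesis .
  qed
  have gfar: "g n z = 0" if "norm z > R + norm e" for z n using far[OF that] by (simp add: g_def)
  have Tm: "(\<lambda>z. f (z + h n *\<^sub>R Y z)) \<in> borel_measurable lebesgue" for n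
    by (rule borel_measurable_lebesgueI) measurable
  have gm: "g n \<in> borel_measurable lebesgue" for n
    unfolding g_def using Tm borel_measurable_lebesgueI[OF fm] by measurable
  have int_f: "integrable lebesgue (\<lambda>z. w z * f z)"
    using B f(2) by (intro loc_integrable_mult[OF w borel_measurable_lebesgueI[OF fm], where B = B and R = R]) auto
  have int_T: "integrable lebesgue (\<lambda>z. w z * f (z + h n *\<^sub>R Y z))" for n
    using B far by (intro loc_integrable_mult[OF w Tm, where B = B and R = "R + norm e"]) auto
  \<comment> \<open>Substitution z -> z + h Y z in the integral of w f: the Jacobian gives (1 +
    h)^card D and \<open>hom\<close> gives (1 + h)^q.\<close>
  have scale: "(\<integral>z. w z * f (z + h n *\<^sub>R Y z) \<partial>lebesgue) =
      (1 + h n) powr (- (q + real (card D))) * (\<integral>z. w z * f z \<partial>lebesgue)" for n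
  proof -
    define c where "c j = (if j \<in> D then 1 + h n else 1)" for j
    \<comment> \<open>The same map in diagonal affine form, as
      \<open>lebesgue_affine_euclidean\<close> expects it.\<close>
    define T where "T x = h n *\<^sub>R e + (\<Sum>j\<in>Basis. (c j * (x \<bullet> j)) *\<^sub>R j)" for x
    have c0: "c j \<noteq> 0" for j using h[of n] by (auto simp: c_def)
    have T_eq: "T z = z + h n *\<^sub>R Y z" for z
    proof (rule euclidean_eqI)
      fix b :: 'a assume b: "b \<in> Basis"
      then show "T z \<bullet> b = (z + h n *\<^sub>R Y z) \<bullet> b"
        by (simp add: T_def Y_def X_def inner_add_left inner_D c_def inner_sum_left_Basis algebra_simps)
    qed
    have leb: "lebesgue = density (distr lebesgue lebesgue T) (\<lambda>_. (\<Prod>j\<in>Basis. \<bar>c j\<bar>))"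
      and Tme: "T \<in> lebesgue \<rightarrow>\<^sub>M lebesgue"
      using lebesgue_affine_euclidean[of c "h n *\<^sub>R e"] lebesgue_affine_measurable[of c "h n *\<^sub>R e"] c0
      unfolding T_def by blast+
    have prod: "(\<Prod>j\<in>Basis. \<bar>c j\<bar>) = (1 + h n) powr (real (card D))"
    proof -
      have "(\<Prod>j\<in>Basis. \<bar>c j\<bar>) = (\<Prod>j\<in>D. 1 + h n)"
        using D h[of n] by (intro prod.mono_neutral_cong_right) (auto simp: c_def)
      then show ?thesis using h[of n] by (simp add: powr_realpow)
    qed
    have m: "(\<lambda>z. w z * f z) \<in> borel_measurable lebesgue" using int_f by simp
    have "(\<integral>z. w z * f z \<partial>lebesgue) =
        (\<integral>z. w z * f z \<partial>(density (distr lebesgue lebesgue T) (\<lambda>_. (\<Prod>j\<in>Basis. \<bar>c j\<bar>))))"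
      using leb by simp
    also have "\<dots> = (\<integral>z. (\<Prod>j\<in>Basis. \<bar>c j\<bar>) *\<^sub>R (w z * f z) \<partial>(distr lebesgue lebesgue T))"
      using m by (intro integral_density) (auto intro!: AE_I2 prod_nonneg)
    also have "\<dots> = (\<integral>z. (\<Prod>j\<in>Basis. \<bar>c j\<bar>) *\<^sub>R (w (T z) * f (T z)) \<partial>lebesgue)"
      using m Tme by (intro integral_distr) auto
    also have "\<dots> = (\<integral>z. (1 + h n) powr (real (card D)) * ((1 + h n) powr q * (w z * f (z + h n *\<^sub>R Y z))) \<partial>lebesgue)"
    proof (rule integral_cong_AE)
      show "(\<lambda>z. (\<Prod>j\<in>Basis. \<bar>c j\<bar>) *\<^sub>R (w (T z) * f (T z))) \<in> borel_measurable lebesgue"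
        using measurable_compose[OF Tme m] by (intro borel_measurable_scaleR) auto
      show "(\<lambda>z. (1 + h n) powr (real (card D)) * ((1 + h n) powr q * (w z * f (z + h n *\<^sub>R Y z)))) \<in> borel_measurable lebesgue"
        using int_T[of n] by measurable
      show "AE z in lebesgue. (\<Prod>j\<in>Basis. \<bar>c j\<bar>) *\<^sub>R (w (T z) * f (T z)) =
          (1 + h n) powr (real (card D)) * ((1 + h n) powr q * (w z * f (z + h n *\<^sub>R Y z)))"
        using hom[OF h[of n]] by eventually_elim (simp add: prod T_eq Y_def)
    qed
    also have "\<dots> = (1 + h n) powr (q + real (card D)) * (\<integral>z. w z * f (z + h n *\<^sub>R Y z) \<partial>lebesgue)"
      by (simp add: powr_add)
    finally show ?thesis
      using h[of n] by (simp only: powr_minus) simp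
  qed
  have lim1: "(\<lambda>n. \<integral>z. w z * g n z \<partial>lebesgue) \<longlonglongrightarrow> (\<integral>z. w z * (gradient f z \<bullet> Y z) \<partial>lebesgue)"
  proof (rule integral_dominated_convergence)
    define K where "K = L * (norm e + \<bar>R + norm e\<bar>)"
    show "integrable lebesgue (\<lambda>z. K * \<bar>indicator (cball 0 (R + norm e)) z * w z\<bar>)"
      using w unfolding loc_integrable_def by (intro integrable_mult_right integrable_abs) blast
    show "(\<lambda>z. w z * g n z) \<in> borel_measurable lebesgue" for n
      using loc_integrable_measurable[OF w] gm by measurable
    have "(\<lambda>z. gradient f z \<bullet> Y z) \<in> borel_measurable lebesgue"
      by (intro borel_measurable_lebesgueI borel_measurable_continuous_onI continuous_intros Ycont
          C_infinity_gradient_continuous f)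
    then show "(\<lambda>z. w z * (gradient f z \<bullet> Y z)) \<in> borel_measurable lebesgue"
      using loc_integrable_measurable[OF w] by measurable
    have "norm (w z * g n z) \<le> K * \<bar>indicator (cball 0 (R + norm e)) z * w z\<bar>" for n z
    proof (cases "norm z > R + norm e")
      case True
      then show ?thesis using gfar by simp
    next
      case False
      then show ?thesis
        using mult_left_mono[OF gbound[of n z], of "\<bar>w z\<bar>"] by (simp add: K_def abs_mult mult.commute)
    qed
    then show "AE z in lebesgue. norm (w z * g n z) \<le> K * \<bar>indicator (cball 0 (R + norm e)) z * w z\<bar>" for n
      by simp
    have "(\<lambda>n. w z * g n z) \<longlonglongrightarrow> w z * (gradient f z \<bullet> Y z)" for z
    proof -
      have "((\<lambda>s. f (z + s *\<^sub>R Y z)) has_derivative (\<lambda>s. gradient f (z + 0 *\<^sub>R Y z) \<bullet> (s *\<^sub>R Y z))) (at 0)"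
        by (rule has_derivative_compose[OF _ C_infinity_has_derivative[OF f(1)]])
           (auto intro!: derivative_eq_intros)
      then have "((\<lambda>s. f (z + s *\<^sub>R Y z)) has_real_derivative (gradient f z \<bullet> Y z)) (at 0)"
        by (simp add: has_field_derivative_def mult_commute_abs)
      from DERIV_LIMSEQ[OF this] have "(\<lambda>n. g n z) \<longlonglongrightarrow> gradient f z \<bullet> Y z"
        by (simp add: g_def h_def)
      then show ?thesis by (intro tendsto_intros)
    qed
    then show "AE z in lebesgue. (\<lambda>n. w z * g n z) \<longlonglongrightarrow> w z * (gradient f z \<bullet> Y z)" by simp
  qed
  have eq: "(\<integral>z. w z * g n z \<partial>lebesgue) =
      (((1 + h n) powr (- (q + real (card D))) - 1) / h n) * (\<integral>z. w z * f z \<partial>lebesgue)" for n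
  proof -
    have "(\<integral>z. w z * g n z \<partial>lebesgue) =
        (\<integral>z. (w z * f (z + h n *\<^sub>R Y z) - w z * f z) / h n \<partial>lebesgue)"
      by (simp add: g_def right_diff_distrib diff_divide_distrib)
    also have "\<dots> = ((\<integral>z. w z * f (z + h n *\<^sub>R Y z) \<partial>lebesgue) - (\<integral>z. w z * f z \<partial>lebesgue)) / h n"
      using int_f int_T by simp
    finally show ?thesis by (simp add: scale algebra_simps diff_divide_distrib)
  qed
  \<comment> \<open>The constant on the right is the derivative of (1 + x)^(-(q + card D)) at x =
    0.\<close>
  have lim2: "(\<lambda>n. ((1 + h n) powr (- (q + real (card D))) - 1) / h n) \<longlonglongrightarrow> - (q + real (card D))"
  proof -
    have "((\<lambda>s. (1 + s) powr (- (q + real (card D)))) has_real_derivative - (q + real (card D))) (at 0)"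
      by (auto intro!: derivative_eq_intros)
    from DERIV_LIMSEQ[OF this] show ?thesis by (simp add: h_def)
  qed
  show ?thesis
    unfolding Y_def [symmetric]
    using LIMSEQ_unique[OF lim1] tendsto_mult_right[OF lim2, of "\<integral>z. w z * f z \<partial>lebesgue"]
    unfolding eq by blast
qed

section \<open>The weighted Laplacian in the coordinates rho - y and rho + y\<close>

text \<open>The gradient field is carried as explicit data; \<open>gradient\<close> itself is a
  definite description and offers no formula to calculate with.\<close>

definition has_grad_on :: "('a::euclidean_space \<Rightarrow> real) \<Rightarrow> ('a \<Rightarrow> 'a) \<Rightarrow> 'a set \<Rightarrow> bool"
  where "has_grad_on f G S \<longleftrightarrow> (\<forall>z\<in>S. (f has_derivative (\<lambda>h. G z \<bullet> h)) (at z))"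

lemma has_grad_onD: "has_grad_on f G S \<Longrightarrow> z \<in> S \<Longrightarrow> (f has_derivative (\<lambda>h. G z \<bullet> h)) (at z)"
  by (simp add: has_grad_on_def)

lemma has_grad_on_subset: "has_grad_on f G S \<Longrightarrow> T \<subseteq> S \<Longrightarrow> has_grad_on f G T"
  by (auto simp: has_grad_on_def)

lemma has_grad_on_add:
  "has_grad_on f F S \<Longrightarrow> has_grad_on g G S \<Longrightarrow> has_grad_on (\<lambda>z. f z + g z) (\<lambda>z. F z + G z) S"
  by (auto simp: has_grad_on_def inner_add_left intro: has_derivative_add)

lemma has_grad_on_mult:
  "has_grad_on f F S \<Longrightarrow> has_grad_on g G S \<Longrightarrow>
    has_grad_on (\<lambda>z. f z * g z) (\<lambda>z. f z *\<^sub>R G z + g z *\<^sub>R F z) S"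
  unfolding has_grad_on_def
  by (auto intro!: has_derivative_eq_rhs[OF has_derivative_mult] simp: inner_add_left fun_eq_iff algebra_simps)

lemma has_grad_on_compose:
  assumes "has_grad_on f F S" "\<And>z. z \<in> S \<Longrightarrow> (g has_real_derivative g' (f z)) (at (f z))"
  shows "has_grad_on (\<lambda>z. g (f z)) (\<lambda>z. g' (f z) *\<^sub>R F z) S"
  unfolding has_grad_on_def
proof
  fix z assume "z \<in> S"
  then show "((\<lambda>z. g (f z)) has_derivative (\<lambda>h. g' (f z) *\<^sub>R F z \<bullet> h)) (at z)"
    using has_derivative_compose[OF has_grad_onD[OF assms(1)], of z g "(*) (g' (f z))"] assms(2)[of z]
    by (simp add: has_field_derivative_def)
qed

lemma has_grad_on_gradient: "has_grad_on f G S \<Longrightarrow> z \<in> S \<Longrightarrow> gradient f z = G z"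
  by (intro gradient_eqI) (simp add: gderiv_def has_grad_on_def inner_commute)

text \<open>
  On \<open>S\<close>, \<open>G\<close> is the gradient of \<open>f\<close> and \<open>l = \<Delta>f + (a/t) \<partial>\<^sub>t f = t\<^sup>-\<^sup>a div (t\<^sup>a \<nabla>f)\<close>.
\<close>
definition has_wlap ::
  "real \<Rightarrow> ('n::finite point \<Rightarrow> real) \<Rightarrow> ('n point \<Rightarrow> 'n point) \<Rightarrow> ('n point \<Rightarrow> real) \<Rightarrow> 'n point set \<Rightarrow> bool"
  where "has_wlap a f G l S \<longleftrightarrow> has_grad_on f G S \<and>
    (\<forall>z\<in>S. \<exists>G'. (G has_derivative G') (at z) \<and>
      (\<Sum>b\<in>Basis. G' b \<bullet> b) + a / t_coord z * (G z \<bullet> (0, 0, 1)) = l z)"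

lemma has_wlap_grad: "has_wlap a f G l S \<Longrightarrow> has_grad_on f G S"
  by (simp add: has_wlap_def)

lemma has_wlap_cong: "has_wlap a f G l S \<Longrightarrow> (\<And>z. z \<in> S \<Longrightarrow> l z = l' z) \<Longrightarrow> has_wlap a f G l' S"
  by (simp add: has_wlap_def)

lemma has_wlap_subset: "has_wlap a f G l S \<Longrightarrow> T \<subseteq> S \<Longrightarrow> has_wlap a f G l T"
  unfolding has_wlap_def by (blast intro: has_grad_on_subset)

lemma has_wlap_add:
  assumes "has_wlap a f F k S" "has_wlap a g G l S"
  shows "has_wlap a (\<lambda>z. f z + g z) (\<lambda>z. F z + G z) (\<lambda>z. k z + l z) S"
  unfolding has_wlap_def
proof (intro conjI ballI)
  fix z assume z: "z \<in> S"
  obtain F' where F': "(F has_derivative F') (at z)"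
      "(\<Sum>b\<in>Basis. F' b \<bullet> b) + a / t_coord z * (F z \<bullet> (0, 0, 1)) = k z"
    using assms(1) z unfolding has_wlap_def by blast
  obtain G' where G': "(G has_derivative G') (at z)"
      "(\<Sum>b\<in>Basis. G' b \<bullet> b) + a / t_coord z * (G z \<bullet> (0, 0, 1)) = l z"
    using assms(2) z unfolding has_wlap_def by blast
  show "\<exists>H'. ((\<lambda>z. F z + G z) has_derivative H') (at z) \<and>
      (\<Sum>b\<in>Basis. H' b \<bullet> b) + a / t_coord z * ((F z + G z) \<bullet> (0, 0, 1)) = k z + l z"
    by (rule exI, rule conjI, rule has_derivative_add[OF F'(1) G'(1)])
       (simp add: F'(2)[symmetric] G'(2)[symmetric] inner_add_left sum.distrib ring_distribs del: inner_Pair)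
qed (use assms in \<open>auto intro: has_grad_on_add has_wlap_grad\<close>)

lemma has_wlap_const: "has_wlap a (\<lambda>z. c) (\<lambda>z. 0) (\<lambda>z. 0) S"
  unfolding has_wlap_def has_grad_on_def
  by (auto intro!: exI[of _ "\<lambda>_. 0"] has_derivative_eq_rhs[OF has_derivative_const] simp: fun_eq_iff
      simp del: inner_Pair split_paired_All)

text \<open>The drift (a/t) d_t is a derivation, so only the Laplacian contributes a cross term,
  twice the inner product of the gradients.\<close>

lemma has_wlap_mult:
  assumes "has_wlap a f F k S" "has_wlap a g G l S"
  shows "has_wlap a (\<lambda>z. f z * g z) (\<lambda>z. f z *\<^sub>R G z + g z *\<^sub>R F z)
    (\<lambda>z. f z * l z + g z * k z + 2 * (F z \<bullet> G z)) S"
  unfolding has_wlap_def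
proof (intro conjI ballI)
  fix z assume z: "z \<in> S"
  obtain F' where F': "(F has_derivative F') (at z)"
      "(\<Sum>b\<in>Basis. F' b \<bullet> b) + a / t_coord z * (F z \<bullet> (0, 0, 1)) = k z"
    using assms(1) z unfolding has_wlap_def by blast
  obtain G' where G': "(G has_derivative G') (at z)"
      "(\<Sum>b\<in>Basis. G' b \<bullet> b) + a / t_coord z * (G z \<bullet> (0, 0, 1)) = l z"
    using assms(2) z unfolding has_wlap_def by blast
  note f' = has_grad_onD[OF has_wlap_grad[OF assms(1)] z]
  note g' = has_grad_onD[OF has_wlap_grad[OF assms(2)] z]
  have FG: "(\<Sum>b\<in>Basis. (F z \<bullet> b) * (G z \<bullet> b)) = F z \<bullet> G z" by (rule euclidean_inner[symmetric])
  have GF: "(\<Sum>b\<in>Basis. (G z \<bullet> b) * (F z \<bullet> b)) = F z \<bullet> G z" by (subst FG[symmetric]) (simp add: mult.commute)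
  have "(\<Sum>b\<in>Basis. ((f z *\<^sub>R G' b + (F z \<bullet> b) *\<^sub>R G z) + (g z *\<^sub>R F' b + (G z \<bullet> b) *\<^sub>R F z)) \<bullet> b) =
      f z * (\<Sum>b\<in>Basis. G' b \<bullet> b) + g z * (\<Sum>b\<in>Basis. F' b \<bullet> b) + 2 * (F z \<bullet> G z)"
    by (simp only: inner_add_left inner_scaleR_left sum.distrib sum_distrib_left[symmetric] FG GF)
  then have "(\<Sum>b\<in>Basis. ((f z *\<^sub>R G' b + (F z \<bullet> b) *\<^sub>R G z) + (g z *\<^sub>R F' b + (G z \<bullet> b) *\<^sub>R F z)) \<bullet> b) +
      a / t_coord z * ((f z *\<^sub>R G z + g z *\<^sub>R F z) \<bullet> (0, 0, 1)) = f z * l z + g z * k z + 2 * (F z \<bullet> G z)"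
    unfolding F'(2)[symmetric] G'(2)[symmetric] inner_add_left inner_scaleR_left by (simp add: algebra_simps)
  then show "\<exists>H'. ((\<lambda>z. f z *\<^sub>R G z + g z *\<^sub>R F z) has_derivative H') (at z) \<and>
      (\<Sum>b\<in>Basis. H' b \<bullet> b) + a / t_coord z * ((f z *\<^sub>R G z + g z *\<^sub>R F z) \<bullet> (0, 0, 1)) =
      f z * l z + g z * k z + 2 * (F z \<bullet> G z)"
    using has_derivative_add[OF has_derivative_scaleR[OF f' G'(1)] has_derivative_scaleR[OF g' F'(1)]] by blast
qed (use assms in \<open>auto intro: has_grad_on_mult has_wlap_grad\<close>)

text \<open>The drift obeys the first-order chain rule; the second derivative of \<open>g\<close>
  meets only the squared gradient coming from the Laplacian.\<close>

lemma has_wlap_compose: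
  assumes "has_wlap a f F k S"
    and "\<And>z. z \<in> S \<Longrightarrow> (g has_real_derivative g' (f z)) (at (f z))"
    and "\<And>z. z \<in> S \<Longrightarrow> (g' has_real_derivative g'' (f z)) (at (f z))"
  shows "has_wlap a (\<lambda>z. g (f z)) (\<lambda>z. g' (f z) *\<^sub>R F z)
    (\<lambda>z. g' (f z) * k z + g'' (f z) * (F z \<bullet> F z)) S"
  unfolding has_wlap_def
proof (intro conjI ballI)
  fix z assume z: "z \<in> S"
  obtain F' where F': "(F has_derivative F') (at z)"
      "(\<Sum>b\<in>Basis. F' b \<bullet> b) + a / t_coord z * (F z \<bullet> (0, 0, 1)) = k z"
    using assms(1) z unfolding has_wlap_def by blast
  have g: "((\<lambda>z. g' (f z)) has_derivative (\<lambda>h. (g'' (f z) *\<^sub>R F z) \<bullet> h)) (at z)"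
    using has_grad_on_compose[OF has_wlap_grad[OF assms(1)], of g' g''] assms(3) z
    by (auto simp: has_grad_on_def)
  have FF: "(\<Sum>b\<in>Basis. (F z \<bullet> b) * (F z \<bullet> b)) = F z \<bullet> F z" by (rule euclidean_inner[symmetric])
  have "(\<Sum>b\<in>Basis. (g' (f z) *\<^sub>R F' b + ((g'' (f z) *\<^sub>R F z) \<bullet> b) *\<^sub>R F z) \<bullet> b) =
      g' (f z) * (\<Sum>b\<in>Basis. F' b \<bullet> b) + g'' (f z) * (F z \<bullet> F z)"
    unfolding FF[symmetric] by (simp add: inner_add_left sum.distrib sum_distrib_left mult.assoc del: inner_Pair)
  then have "(\<Sum>b\<in>Basis. (g' (f z) *\<^sub>R F' b + ((g'' (f z) *\<^sub>R F z) \<bullet> b) *\<^sub>R F z) \<bullet> b) +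
      a / t_coord z * ((g' (f z) *\<^sub>R F z) \<bullet> (0, 0, 1)) = g' (f z) * k z + g'' (f z) * (F z \<bullet> F z)"
    unfolding F'(2)[symmetric] inner_scaleR_left by (simp add: algebra_simps)
  then show "\<exists>H'. ((\<lambda>z. g' (f z) *\<^sub>R F z) has_derivative H') (at z) \<and>
      (\<Sum>b\<in>Basis. H' b \<bullet> b) + a / t_coord z * ((g' (f z) *\<^sub>R F z) \<bullet> (0, 0, 1)) =
      g' (f z) * k z + g'' (f z) * (F z \<bullet> F z)"
    using has_derivative_scaleR[OF g F'(1)] by blast
qed (use assms in \<open>auto intro: has_grad_on_compose has_wlap_grad\<close>)

lemma has_wlap_inner: "v \<bullet> (0, 0, 1) = 0 \<Longrightarrow> has_wlap a (\<lambda>z. v \<bullet> z) (\<lambda>z. v) (\<lambda>z. 0) S"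
  unfolding has_wlap_def has_grad_on_def
  by (auto intro!: exI[of _ "\<lambda>_. 0"] derivative_eq_intros simp del: inner_Pair)

text \<open>\<open>CARD('n) + 2\<close> is the dimension N + 1 of the whole space, the trace of the
  identity; the drift contributes (a/t) (2t) = 2a.\<close>

lemma has_wlap_norm_sq:
  assumes "S \<subseteq> {z. t_coord z \<noteq> 0}"
  shows "has_wlap a (\<lambda>z::'n::finite point. z \<bullet> z) (\<lambda>z. 2 *\<^sub>R z) (\<lambda>z. 2 * (real CARD('n) + 2) + 2 * a) S"
  unfolding has_wlap_def has_grad_on_def
proof (intro conjI ballI)
  fix z :: "'n point" assume "z \<in> S"
  then have t: "t_coord z \<noteq> 0" using assms by auto
  show "((\<lambda>z. z \<bullet> z) has_derivative (\<bullet>) (2 *\<^sub>R z)) (at z)"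
    by (auto intro!: derivative_eq_intros simp: inner_commute)
  have "(\<Sum>b\<in>(Basis :: 'n point set). 2 *\<^sub>R b \<bullet> b) = 2 * (real CARD('n) + 2)"
    by (simp add: inner_Basis del: inner_Pair)
  moreover have "z \<bullet> (0, 0, 1) = t_coord z" by (cases z) (simp add: inner_prod_def)
  ultimately show "\<exists>G'. ((*\<^sub>R) 2 has_derivative G') (at z) \<and>
      (\<Sum>b\<in>Basis. G' b \<bullet> b) + a / t_coord z * (2 *\<^sub>R z \<bullet> (0, 0, 1)) = 2 * (real CARD('n) + 2) + 2 * a"
    using t by (intro exI[of _ "\<lambda>h. 2 *\<^sub>R h"]) (auto intro!: derivative_eq_intros simp del: inner_Pair)
qed

section \<open>The distance to the edge and the coordinates a, b\<close>

abbreviation y_last :: "'n::finite point \<Rightarrow> real"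
  where "y_last z \<equiv> fst (snd z)"

definition rho :: "'n::finite point \<Rightarrow> real"
  where "rho z = sqrt ((y_last z)\<^sup>2 + (t_coord z)\<^sup>2)"

text \<open>
  The squares of the conformal coordinates on the half-plane of \<open>(y\<^sub>N, t)\<close>: \<open>a b = t\<^sup>2\<close>. The Dirichlet part
  \<open>\<Gamma>\<^sup>+\<close> of the boundary is \<open>a = 0\<close>, the Neumann part is \<open>b = 0\<close>.
\<close>
definition coord_a :: "'n::finite point \<Rightarrow> real" where "coord_a z = rho z - y_last z"

definition coord_b :: "'n::finite point \<Rightarrow> real" where "coord_b z = rho z + y_last z"

definition grad_rho :: "'n::finite point \<Rightarrow> 'n point"
  where "grad_rho z = (0, y_last z / rho z, t_coord z / rho z)"

definition grad_a :: "'n::finite point \<Rightarrow> 'n point" where "grad_a z = grad_rho z - (0, 1, 0)"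

definition grad_b :: "'n::finite point \<Rightarrow> 'n point" where "grad_b z = grad_rho z + (0, 1, 0)"

lemma rho_pos_iff: "rho z > 0 \<longleftrightarrow> y_last z \<noteq> 0 \<or> t_coord z \<noteq> 0"
  by (simp add: rho_def sum_power2_gt_zero_iff)

lemma rho_sq: "rho z * rho z = y_last z * y_last z + t_coord z * t_coord z"
  by (simp add: rho_def power2_eq_square)

lemma rho_nonneg: "rho z \<ge> 0" by (simp add: rho_def)

lemma abs_y_le_rho: "\<bar>y_last z\<bar> \<le> rho z" and abs_t_le_rho: "\<bar>t_coord z\<bar> \<le> rho z"
  by (simp_all add: rho_def)

lemma rho_le_norm: "rho z \<le> norm z"
  by (cases z) (auto simp: rho_def norm_prod_def real_sqrt_le_iff)

lemma coord_ab: "coord_a z * coord_b z = (t_coord z)\<^sup>2"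
  using rho_sq[of z] by (simp add: coord_a_def coord_b_def algebra_simps power2_eq_square)

lemma coord_a_nonneg: "coord_a z \<ge> 0" and coord_b_nonneg: "coord_b z \<ge> 0"
  using abs_y_le_rho[of z] by (auto simp: coord_a_def coord_b_def)

lemma coord_a_le: "coord_a z \<le> 2 * rho z" and coord_b_le: "coord_b z \<le> 2 * rho z"
  using abs_y_le_rho[of z] by (auto simp: coord_a_def coord_b_def)

lemma coord_a_pos: "t_coord z \<noteq> 0 \<Longrightarrow> coord_a z > 0"
  using coord_ab[of z] coord_a_nonneg[of z] coord_b_nonneg[of z]
  by (auto simp: less_le)

text \<open>Identifies \<open>Gamma_plus\<close> as the zero set of a, so that staying away from it
  becomes a lower bound on a.\<close>

lemma coord_a_eq_0_iff: "coord_a z = 0 \<longleftrightarrow> t_coord z = 0 \<and> y_last z \<ge> 0"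
proof
  assume "coord_a z = 0"
  then show "t_coord z = 0 \<and> y_last z \<ge> 0"
    using coord_a_pos[of z] rho_nonneg[of z] by (auto simp: coord_a_def)
qed (auto simp: coord_a_def rho_def)

lemma continuous_on_rho [continuous_intros]:
  "continuous_on S f \<Longrightarrow> continuous_on S (\<lambda>x. rho (f x :: 'n::finite point))"
  unfolding rho_def by (intro continuous_intros)

lemma continuous_on_coord_a [continuous_intros]:
  "continuous_on S f \<Longrightarrow> continuous_on S (\<lambda>x. coord_a (f x :: 'n::finite point))"
  unfolding coord_a_def by (intro continuous_intros)

lemma continuous_on_coord_b [continuous_intros]:
  "continuous_on S f \<Longrightarrow> continuous_on S (\<lambda>x. coord_b (f x :: 'n::finite point))"
  unfolding coord_b_def by (intro continuous_intros)

lemma grad_rho_inner: "grad_rho z \<bullet> h = (y_last z * y_last h + t_coord z * t_coord h) / rho z"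
  by (simp add: grad_rho_def inner_prod_def add_divide_distrib)

lemma grad_rho_sq: "rho z > 0 \<Longrightarrow> grad_rho z \<bullet> grad_rho z = 1"
  unfolding grad_rho_inner
  by (simp add: grad_rho_def add_divide_distrib[symmetric] rho_sq[symmetric])

lemma grad_rho_last: "grad_rho z \<bullet> (0, 1, 0) = y_last z / rho z"
  by (simp add: grad_rho_inner)

lemma last_last: "(0, 1, 0) \<bullet> ((0, 1, 0) :: 'n::finite point) = 1"
  by (simp add: inner_prod_def)

text \<open>\<open>grad_rho\<close> and the unit vector in direction y_N have length 1 and inner
  product y_N / rho; hence 2 - 2 y_N / rho = 2 a / rho.\<close>

lemma grad_a_sq: "rho z > 0 \<Longrightarrow> grad_a z \<bullet> grad_a z = 2 * coord_a z / rho z"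
  unfolding grad_a_def inner_diff_left inner_diff_right inner_commute[of "(0, 1, 0)" "grad_rho z"]
    grad_rho_last last_last coord_a_def by (simp add: grad_rho_sq field_simps)

lemma grad_b_sq: "rho z > 0 \<Longrightarrow> grad_b z \<bullet> grad_b z = 2 * coord_b z / rho z"
  unfolding grad_b_def inner_add_left inner_add_right inner_commute[of "(0, 1, 0)" "grad_rho z"]
    grad_rho_last last_last coord_b_def by (simp add: grad_rho_sq field_simps)

text \<open>Sum and difference of two unit vectors are orthogonal. This removes the cross term for
  products of a function of a with a function of b.\<close>

lemma grad_a_b: "rho z > 0 \<Longrightarrow> grad_a z \<bullet> grad_b z = 0"
  unfolding grad_a_def grad_b_def inner_add_right inner_diff_left inner_commute[of "(0, 1, 0)" "grad_rho z"]
    grad_rho_last last_last by (simp add: grad_rho_sq)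

lemma last_inner: "(0, 1, 0) \<bullet> (z :: 'n::finite point) = y_last z"
  by (simp add: inner_prod_def)

lemma grad_rho_self: "rho z > 0 \<Longrightarrow> grad_rho z \<bullet> z = rho z"
  by (simp add: grad_rho_inner rho_sq[symmetric])

text \<open>Euler's identity in degree one.\<close>

lemma grad_a_self: "rho z > 0 \<Longrightarrow> grad_a z \<bullet> z = coord_a z"
  and grad_b_self: "rho z > 0 \<Longrightarrow> grad_b z \<bullet> z = coord_b z"
  by (simp_all only: grad_a_def grad_b_def inner_add_left inner_diff_left last_inner grad_rho_self
      coord_a_def coord_b_def)

lemma grad_a_horizontal: "grad_a z \<bullet> (\<xi>, 0, 0) = 0" and grad_b_horizontal: "grad_b z \<bullet> (\<xi>, 0, 0) = 0"
  by (simp_all add: grad_a_def grad_b_def grad_rho_def inner_prod_def)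

lemma grad_a_vertical: "grad_a z \<bullet> (0, 0, 1) = t_coord z / rho z"
  and grad_b_vertical: "grad_b z \<bullet> (0, 0, 1) = t_coord z / rho z"
  by (simp_all add: grad_a_def grad_b_def grad_rho_def inner_prod_def)

lemma has_grad_on_rho: "has_grad_on rho grad_rho {z. rho z > 0}"
  unfolding has_grad_on_def
proof (intro ballI)
  fix z :: "'n::finite point" assume "z \<in> {z. rho z > 0}"
  then have pos: "y_last z * y_last z + t_coord z * t_coord z > 0" by (simp add: rho_def power2_eq_square)
  have "((\<lambda>z. y_last z * y_last z + t_coord z * t_coord z) has_derivative
      (\<lambda>h. (y_last z * y_last h + y_last h * y_last z) + (t_coord z * t_coord h + t_coord h * t_coord z))) (at z)"
    by (intro has_derivative_add has_derivative_mult has_derivative_fst has_derivative_snd has_derivative_ident)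
  note d = has_derivative_real_sqrt[OF pos this]
  have "((y_last z * y_last h + y_last h * y_last z) + (t_coord z * t_coord h + t_coord h * t_coord z)) *
      (inverse (sqrt (y_last z * y_last z + t_coord z * t_coord z)) / 2) = grad_rho z \<bullet> h" for h
  proof -
    have "(y_last z * y_last h + y_last h * y_last z) + (t_coord z * t_coord h + t_coord h * t_coord z) =
        2 * (y_last z * y_last h + t_coord z * t_coord h)" by (simp add: mult.commute)
    note e = this
    show ?thesis unfolding e rho_sq[symmetric] grad_rho_inner
      by (simp only: real_sqrt_abs2 abs_of_nonneg[OF rho_nonneg]) (simp only: divide_inverse, simp)
  qed
  with d show "(rho has_derivative (\<bullet>) (grad_rho z)) (at z)"
    by (simp only: rho_def[abs_def] power2_eq_square)
qed

lemma has_grad_on_linear: "has_grad_on (\<lambda>z. v \<bullet> z) (\<lambda>z. v) S"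
  unfolding has_grad_on_def by (auto intro!: derivative_eq_intros)

lemma has_grad_on_a: "has_grad_on coord_a grad_a {z. rho z > 0}"
  using has_grad_on_add[OF has_grad_on_rho has_grad_on_linear, of "- (0, 1, 0)"]
  unfolding has_grad_on_def by (simp add: coord_a_def[abs_def] grad_a_def last_inner inner_minus_left del: inner_Pair uminus_Pair)

lemma has_grad_on_b: "has_grad_on coord_b grad_b {z. rho z > 0}"
  using has_grad_on_add[OF has_grad_on_rho has_grad_on_linear, of "(0, 1, 0)"]
  unfolding has_grad_on_def by (simp add: coord_b_def[abs_def] grad_b_def inner_prod_def)

text \<open>In the (y_N, t) plane the Laplacian of rho is 1 / rho. With \<open>a\<close> the weight
  exponent, the drift adds (a/t) (t/rho) = a / rho.\<close>

lemma has_wlap_rho: "has_wlap a rho grad_rho (\<lambda>z. (1 + a) / rho z) {z. t_coord z > 0}"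
  unfolding has_wlap_def
proof (intro conjI ballI)
  show "has_grad_on rho grad_rho {z. t_coord z > 0}"
    by (rule has_grad_on_subset[OF has_grad_on_rho]) (auto simp: rho_pos_iff)
  fix z :: "'n::finite point" assume "z \<in> {z. t_coord z > 0}"
  then have t: "t_coord z > 0" and r: "rho z > 0" by (auto simp: rho_pos_iff)
  define G' :: "'n point \<Rightarrow> 'n point" where
    "G' h = - ((grad_rho z \<bullet> h) / (rho z)\<^sup>2) *\<^sub>R (0, y_last z, t_coord z) + (1 / rho z) *\<^sub>R (0, y_last h, t_coord h)" for h
  have G: "(grad_rho has_derivative G') (at z)"
  proof -
    have gr: "grad_rho = (\<lambda>z. inverse (rho z) *\<^sub>R (0, y_last z, t_coord z))"
      by (rule ext) (auto simp: grad_rho_def prod_eq_iff divide_inverse)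
    have "((\<lambda>z. (0, y_last z, t_coord z)) has_derivative (\<lambda>h. (0, y_last h, t_coord h))) (at z)"
      by (intro derivative_intros)
    moreover have "((\<lambda>z. inverse (rho z)) has_derivative (\<lambda>h. - (inverse (rho z) * (grad_rho z \<bullet> h) * inverse (rho z)))) (at z)"
      using r has_grad_onD[OF has_grad_on_rho, of z] by (intro Deriv.has_derivative_inverse) auto
    ultimately show ?thesis unfolding gr
      by (rule has_derivative_eq_rhs[OF has_derivative_scaleR[rotated]])
         (auto simp: G'_def gr fun_eq_iff field_simps power2_eq_square)
  qed
  have tr: "(\<Sum>b\<in>Basis. G' b \<bullet> b) = 1 / rho z"
  proof -
    have "G' (b, 0) \<bullet> (b, 0) = 0" for b by (simp add: G'_def inner_prod_def grad_rho_def)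
    moreover have "G' (0, 1, 0) \<bullet> (0, 1, 0) + G' (0, 0, 1) \<bullet> (0, 0, 1) = 1 / rho z"
    proof -
      have "G' (0, 1, 0) \<bullet> (0, 1, 0) + G' (0, 0, 1) \<bullet> (0, 0, 1) =
          2 / rho z - (y_last z * y_last z + t_coord z * t_coord z) / (rho z * rho z * rho z)"
        by (simp add: G'_def inner_prod_def grad_rho_def power2_eq_square add_divide_distrib mult.assoc)
      then show ?thesis using r by (simp add: rho_sq[symmetric] field_simps)
    qed
    ultimately show ?thesis
      by (simp add: Basis_prod_def sum.union_disjoint sum.reindex inj_on_def image_Un image_image zero_prod_def image_iff
          flip: add.assoc)
  qed
  have "grad_rho z \<bullet> (0, 0, 1) = t_coord z / rho z" by (simp add: grad_rho_def inner_prod_def)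
  then show "\<exists>G'. (grad_rho has_derivative G') (at z) \<and>
      (\<Sum>b\<in>Basis. G' b \<bullet> b) + a / t_coord z * (grad_rho z \<bullet> (0, 0, 1)) = (1 + a) / rho z"
    using G tr t r by (intro exI[of _ G']) (auto simp: field_simps)
qed

text \<open>The coordinate differs from rho by a linear function without t-component, which the
  operator annihilates; the same holds for b.\<close>

lemma has_wlap_a: "has_wlap a coord_a grad_a (\<lambda>z. (1 + a) / rho z) {z::'n::finite point. t_coord z > 0}"
proof -
  define v :: "'n point" where "v = - (0, 1, 0)"
  have "has_wlap a (\<lambda>z. rho z + v \<bullet> z) (\<lambda>z. grad_rho z + v) (\<lambda>z. (1 + a) / rho z + 0) {z. t_coord z > 0}"
    by (rule has_wlap_add[OF has_wlap_rho has_wlap_inner]) (simp add: v_def inner_prod_def)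
  moreover have "(\<lambda>z. rho z + v \<bullet> z) = coord_a" "(\<lambda>z. grad_rho z + v) = grad_a"
    by (simp_all add: v_def fun_eq_iff coord_a_def grad_a_def last_inner inner_minus_left del: inner_Pair uminus_Pair)
  ultimately show ?thesis by simp
qed

lemma has_wlap_b: "has_wlap a coord_b grad_b (\<lambda>z. (1 + a) / rho z) {z::'n::finite point. t_coord z > 0}"
proof -
  define v :: "'n point" where "v = (0, 1, 0)"
  have "has_wlap a (\<lambda>z. rho z + v \<bullet> z) (\<lambda>z. grad_rho z + v) (\<lambda>z. (1 + a) / rho z + 0) {z. t_coord z > 0}"
    by (rule has_wlap_add[OF has_wlap_rho has_wlap_inner]) (simp add: v_def inner_prod_def)
  moreover have "(\<lambda>z. rho z + v \<bullet> z) = coord_b" "(\<lambda>z. grad_rho z + v) = grad_b"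
    by (simp_all add: v_def fun_eq_iff coord_b_def grad_b_def last_inner inner_minus_left del: inner_Pair uminus_Pair)
  ultimately show ?thesis by simp
qed

section \<open>Weighted integration by parts\<close>

lemma nn_integral_lborel_product:
  fixes f :: "'a::euclidean_space \<Rightarrow> ennreal" and g :: "'b::euclidean_space \<Rightarrow> ennreal"
  assumes [measurable]: "f \<in> borel_measurable borel" "g \<in> borel_measurable borel"
  shows "(\<integral>\<^sup>+z. f (fst z) * g (snd z) \<partial>lborel) = (\<integral>\<^sup>+x. f x \<partial>lborel) * (\<integral>\<^sup>+y. g y \<partial>lborel)"
proof -
  have "(\<integral>\<^sup>+z. f (fst z) * g (snd z) \<partial>(lborel \<Otimes>\<^sub>M lborel)) =
      (\<integral>\<^sup>+x. \<integral>\<^sup>+y. f x * g y \<partial>lborel \<partial>lborel)"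
    by (subst lborel.nn_integral_fst[symmetric]) auto
  then show ?thesis by (simp add: lborel_prod nn_integral_cmult nn_integral_multc)
qed

lemma loc_integrable_iff_nn_integral:
  fixes g :: "'a::euclidean_space \<Rightarrow> real"
  assumes [measurable]: "g \<in> borel_measurable borel" and "\<And>x. g x \<ge> 0"
  shows "loc_integrable g \<longleftrightarrow> (\<forall>r. (\<integral>\<^sup>+x. ennreal (indicator (cball 0 r) x * g x) \<partial>lborel) < \<infinity>)"
proof -
  have "integrable lebesgue (\<lambda>x. indicator (cball 0 r) x * g x) \<longleftrightarrow>
      (\<integral>\<^sup>+x. ennreal (indicator (cball 0 r) x * g x) \<partial>lborel) < \<infinity>" for r
    using assms(2) by (subst integrable_completion) (auto simp: integrable_iff_bounded indicator_def if_distrib cong: if_cong)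
  then show ?thesis by (simp add: loc_integrable_def)
qed

lemma borel_measurable_y_last [measurable]: "(y_last :: 'n::finite point \<Rightarrow> real) \<in> borel_measurable borel"
  and borel_measurable_t_coord [measurable]: "(t_coord :: 'n::finite point \<Rightarrow> real) \<in> borel_measurable borel"
  by (intro borel_measurable_continuous_onI continuous_intros)+

text \<open>A ball lies in a product of balls of the same radius, on which Tonelli separates the
  three factors. Nonnegative integrals avoid a prior integrability proof on the product.\<close>

lemma loc_integrable_product:
  fixes g h :: "real \<Rightarrow> real"
  assumes g: "loc_integrable g" "g \<in> borel_measurable borel" "\<And>x. g x \<ge> 0"
    and h: "loc_integrable h" "h \<in> borel_measurable borel" "\<And>x. h x \<ge> 0"
  shows "loc_integrable (\<lambda>z::'n::finite point. g (y_last z) * h (t_coord z))"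
proof (subst loc_integrable_iff_nn_integral)
  note [measurable] = g(2) h(2)
  show m: "(\<lambda>z::'n point. g (y_last z) * h (t_coord z)) \<in> borel_measurable borel"
    by (intro borel_measurable_times measurable_compose[OF borel_measurable_y_last]
        measurable_compose[OF borel_measurable_t_coord] g h)
  show "0 \<le> g (y_last z) * h (t_coord z)" for z :: "'n point" using g h by simp
  show "\<forall>r. (\<integral>\<^sup>+z. ennreal (indicator (cball 0 r) z * (g (y_last z) * h (t_coord z))) \<partial>(lborel :: 'n point measure)) < \<infinity>"
  proof
    fix r :: real
    define I where "I f = (\<lambda>x. ennreal (indicator (cball 0 r) x * f x))" for f :: "real \<Rightarrow> real"
    define J where "J = (\<lambda>y :: real^'n. ennreal (indicator (cball 0 r) y))"
    have [measurable]: "I g \<in> borel_measurable borel" "I h \<in> borel_measurable borel" "J \<in> borel_measurable borel"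
      unfolding I_def J_def
      by (auto intro!: measurable_compose[OF _ measurable_ennreal] borel_measurable_times
          borel_measurable_indicator g(2) h(2) simp del: ennreal_indicator)
    have fin: "(\<integral>\<^sup>+x. I g x \<partial>lborel) < \<infinity>" "(\<integral>\<^sup>+x. I h x \<partial>lborel) < \<infinity>"
      using g h loc_integrable_iff_nn_integral[of g] loc_integrable_iff_nn_integral[of h] by (auto simp: I_def)
    have finJ: "(\<integral>\<^sup>+y. J y \<partial>lborel) < \<infinity>"
      using emeasure_bounded_finite[OF bounded_cball[of "0 :: real^'n" r]] by (simp add: J_def ennreal_indicator)
    have le: "ennreal (indicator (cball 0 r) z * (g (y_last z) * h (t_coord z))) \<le>
        J (fst z) * (I g (fst (snd z)) * I h (snd (snd z)))" for z :: "'n point"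
    proof (cases "norm z \<le> r")
      case True
      then have "norm (fst z) \<le> r" "norm (snd z) \<le> r"
        using norm_fst_le[of "fst z" "snd z"] norm_snd_le[of "snd z" "fst z"] by auto
      moreover from this have "\<bar>fst (snd z)\<bar> \<le> r" "\<bar>snd (snd z)\<bar> \<le> r"
        using norm_fst_le[of "fst (snd z)" "snd (snd z)"] norm_snd_le[of "snd (snd z)" "fst (snd z)"] by auto
      ultimately show ?thesis using g(3) h(3) True by (simp add: I_def J_def ennreal_mult)
    qed simp
    have "(\<integral>\<^sup>+z. ennreal (indicator (cball 0 r) z * (g (y_last z) * h (t_coord z))) \<partial>(lborel :: 'n point measure)) \<le>
        (\<integral>\<^sup>+z. J (fst z) * (I g (fst (snd z)) * I h (snd (snd z))) \<partial>(lborel :: 'n point measure))"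
      by (intro nn_integral_mono le)
    also have "\<dots> = (\<integral>\<^sup>+y. J y \<partial>lborel) * (\<integral>\<^sup>+p. I g (fst p) * I h (snd p) \<partial>lborel)"
    proof -
      have m: "(\<lambda>p::real \<times> real. I g (fst p) * I h (snd p)) \<in> borel_measurable borel"
      proof -
        have "(\<lambda>p::real \<times> real. I g (fst p)) \<in> borel_measurable borel"
          by (rule measurable_compose[of _ _ borel]) (auto intro!: borel_measurable_continuous_onI continuous_intros)
        moreover have "(\<lambda>p::real \<times> real. I h (snd p)) \<in> borel_measurable borel"
          by (rule measurable_compose[of _ _ borel]) (auto intro!: borel_measurable_continuous_onI continuous_intros)
        ultimately show ?thesis by measurable
      qed
      show ?thesis by (rule nn_integral_lborel_product[OF _ m]) simp
    qed
    also have "(\<integral>\<^sup>+p. I g (fst p) * I h (snd p) \<partial>lborel) = (\<integral>\<^sup>+x. I g x \<partial>lborel) * (\<integral>\<^sup>+x. I h x \<partial>lborel)"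
      by (intro nn_integral_lborel_product) auto
    finally show "(\<integral>\<^sup>+z. ennreal (indicator (cball 0 r) z * (g (y_last z) * h (t_coord z))) \<partial>(lborel :: 'n point measure)) < \<infinity>"
      using fin finJ by (simp add: ennreal_mult_less_top le_less_trans)
  qed
qed

lemma loc_integrable_powr:
  assumes "p > -1"
  shows "loc_integrable (\<lambda>x::real. indicator {0<..} x * x powr p)"
  unfolding loc_integrable_def
proof
  fix r :: real
  show "integrable lebesgue (\<lambda>x. indicator (cball 0 r) x * (indicator {0<..} x * x powr p))"
  proof (cases "r \<ge> 0")
    case True
    have "(\<lambda>x. x powr p) absolutely_integrable_on {0..r}"
      by (intro nonnegative_absolutely_integrable_1 integrable_on_powr_from_0) (use assms True in auto)
    then have "integrable lebesgue (\<lambda>x. indicator {0..r} x *\<^sub>R (x powr p))"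
      by (simp add: set_integrable_def)
    moreover have "(\<lambda>x. indicator {0..r} x *\<^sub>R (x powr p)) =
        (\<lambda>x. indicator (cball 0 r) x * (indicator {0<..} x * x powr p))"
      by (auto simp: fun_eq_iff indicator_def)
    ultimately show ?thesis by simp
  qed simp
qed

lemma loc_integrable_abs_powr:
  assumes "p > -1"
  shows "loc_integrable (\<lambda>x::real. \<bar>x\<bar> powr p)"
  unfolding loc_integrable_def
proof
  fix r :: real
  define f where "f x = indicator (cball 0 r) x * (indicator {0<..} x * x powr p)" for x :: real
  have m: "f \<in> borel_measurable borel" unfolding f_def by (intro borel_measurable_times borel_measurable_indicator) auto
  have f: "integrable lborel f"
  proof -
    have "integrable lebesgue f" using loc_integrable_powr[OF assms] by (simp add: loc_integrable_def f_def[abs_def])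
    then show ?thesis using m by (simp add: integrable_completion)
  qed
  have "integrable lborel (\<lambda>x. f (- x))" using lborel_integrable_real_affine[OF f, of "-1" 0] by simp
  with f have "integrable lborel (\<lambda>x. f x + f (- x))" by simp
  \<comment> \<open>Also true at x = 0, where both sides vanish because
    \<open>0 powr p = 0\<close>.\<close>
  moreover have "(\<lambda>x. f x + f (- x)) = (\<lambda>x. indicator (cball 0 r) x * \<bar>x\<bar> powr p)"
    by (auto simp: fun_eq_iff f_def indicator_def)
  ultimately show "integrable lebesgue (\<lambda>x. indicator (cball 0 r) x * \<bar>x\<bar> powr p)"
    by (simp add: integrable_completion)
qed

text \<open>Extended by zero so that all integrals run over the whole space. The half-space is
  invariant under horizontal translations, dilations in t and full dilations, so the extension keeps
  the homogeneity demanded by \<open>integral_derivative_along_flow\<close>.\<close>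

definition weight :: "real \<Rightarrow> 'n::finite point \<Rightarrow> real"
  where "weight a z = indicator half_space z * t_coord z powr a"

lemma weight_nonneg: "weight a z \<ge> 0" by (simp add: weight_def)

lemma loc_integrable_const: "loc_integrable (\<lambda>x::real. 1)"
  using lmeasurable_cball[of "0::real"] by (auto simp: loc_integrable_def fmeasurable_def)

lemma loc_integrable_weight:
  assumes "a > -1" shows "loc_integrable (weight a :: 'n::finite point \<Rightarrow> real)"
proof -
  have "loc_integrable (\<lambda>z::'n point. 1 * (indicator {0<..} (t_coord z) * t_coord z powr a))"
    by (intro loc_integrable_product[OF loc_integrable_const _ _ loc_integrable_powr[OF assms]]) auto
  then show ?thesis by (simp add: weight_def[abs_def] half_space_def indicator_def)
qed

text \<open>
  A function even in \<open>t\<close> has \<open>\<partial>\<^sub>t\<Phi> = t \<Theta>\<close> with \<open>\<Theta>\<close> smooth; working with \<open>\<Theta>\<close> absorbs the boundary term at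
  \<open>t = 0\<close> into the dilation identity for \<open>\<phi> \<Theta>\<close>.
\<close>
lemma weighted_integration_by_parts:
  fixes \<phi> \<Phi> \<Theta> :: "'n::finite point \<Rightarrow> real"
  assumes a: "a > -1" and \<phi>: "\<phi> \<in> C_infinity" and \<Phi>: "\<Phi> \<in> C_infinity" and \<Theta>: "\<Theta> \<in> C_infinity"
    and supp: "\<And>z. norm z > R \<Longrightarrow> \<Phi> z = 0" "\<And>z. norm z > R \<Longrightarrow> \<Theta> z = 0"
    and vert: "\<And>z. gradient \<Phi> z \<bullet> (0, 0, 1) = t_coord z * \<Theta> z"
  shows "(\<integral>z. weight a z * (gradient \<phi> z \<bullet> gradient \<Phi> z) \<partial>lebesgue) =
    - (\<integral>z. weight a z * (\<phi> z * ((\<Sum>b\<in>Basis - {(0, 0, 1)}. gradient (\<lambda>z. gradient \<Phi> z \<bullet> b) z \<bullet> b) +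
        t_coord z * (gradient \<Theta> z \<bullet> (0, 0, 1)) + (1 + a) * \<Theta> z)) \<partial>lebesgue)"
proof -
  define eT :: "'n point" where "eT = (0, 0, 1)"
  have eT: "eT \<in> Basis" by (simp add: eT_def Basis_prod_def zero_prod_def)
  have t: "t_coord z = z \<bullet> eT" for z by (simp add: eT_def inner_prod_def)
  note wi = loc_integrable_weight[OF a]
  have int: "integrable lebesgue (\<lambda>z. weight a z * g z)"
    if g: "continuous_on UNIV g" "\<And>z. norm z > R \<Longrightarrow> g z = 0" for g :: "'n point \<Rightarrow> real"
  proof -
    obtain B where "\<And>z. norm (g z) \<le> B" using continuous_compact_support_bounded[OF g] by blast
    then show ?thesis
      using g by (intro loc_integrable_mult[OF wi, of g B R])
        (auto intro: borel_measurable_lebesgueI borel_measurable_continuous_onI)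
  qed
  have gs: "gradient \<Phi> z = 0" "gradient \<Theta> z = 0" if "norm z > R" for z
    using gradient_eq_0_outside[of R \<Phi> z] gradient_eq_0_outside[of R \<Theta> z] supp that by auto
  have gs2: "gradient (\<lambda>z. gradient \<Phi> z \<bullet> b) z = 0" if "norm z > R" for z b
    using gradient_eq_0_outside[of R "\<lambda>z. gradient \<Phi> z \<bullet> b" z] gs that by auto
  note cont = C_infinity_continuous[OF \<phi>] C_infinity_continuous[OF \<Phi>] C_infinity_continuous[OF \<Theta>]
    C_infinity_gradient_continuous[OF \<phi>] C_infinity_gradient_continuous[OF \<Phi>]
    C_infinity_gradient_continuous[OF \<Theta>] C_infinity_gradient_continuous[OF C_infinity_gradient[OF \<Phi>]]
  have horizontal: "(\<integral>z. weight a z * ((gradient \<phi> z \<bullet> b) * (gradient \<Phi> z \<bullet> b) +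
      \<phi> z * (gradient (\<lambda>z. gradient \<Phi> z \<bullet> b) z \<bullet> b)) \<partial>lebesgue) = 0"
    if b: "b \<in> Basis - {eT}" for b
  proof -
    have be: "t_coord b = 0" using b eT by (auto simp: t inner_Basis)
    \<comment> \<open>Flow with empty \<open>D\<close> along the horizontal vector \<open>b\<close>:
      the weight is invariant, so the exponent is 0 and the right-hand side vanishes.\<close>
    have "(\<integral>z. weight a z * (gradient (\<lambda>z. \<phi> z * (gradient \<Phi> z \<bullet> b)) z \<bullet> (b + (\<Sum>j\<in>{}. (z \<bullet> j) *\<^sub>R j))) \<partial>lebesgue) =
        - (0 + real (card ({} :: 'n point set))) * (\<integral>z. weight a z * (\<phi> z * (gradient \<Phi> z \<bullet> b)) \<partial>lebesgue)"
      by (rule integral_derivative_along_flow[OF _ wi C_infinity_mult[OF \<phi> C_infinity_gradient[OF \<Phi>]], where R = R])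
         (simp_all add: gs be weight_def half_space_def indicator_def)
    then show ?thesis
      by (simp add: gradient_mult[OF \<phi> C_infinity_gradient[OF \<Phi>]] inner_add_left algebra_simps del: inner_Pair)
  qed
  \<comment> \<open>Dilation in t alone, applied to phi Theta: the weight has degree a, which gives
    the factor a + 1, and t d_t (phi Theta) = (d_t phi) (d_t Phi) + phi t d_t Theta because t Theta
    = d_t Phi.\<close>
  have vertical: "(\<integral>z. weight a z * ((gradient \<phi> z \<bullet> eT) * (gradient \<Phi> z \<bullet> eT) +
      \<phi> z * (t_coord z * (gradient \<Theta> z \<bullet> eT) + (1 + a) * \<Theta> z)) \<partial>lebesgue) = 0"
  proof -
    have "(\<integral>z. weight a z * (gradient (\<lambda>z. \<phi> z * \<Theta> z) z \<bullet> (0 + (\<Sum>j\<in>{eT}. (z \<bullet> j) *\<^sub>R j))) \<partial>lebesgue) =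
        - (a + real (card {eT})) * (\<integral>z. weight a z * (\<phi> z * \<Theta> z) \<partial>lebesgue)"
    proof (rule integral_derivative_along_flow[OF _ wi C_infinity_mult[OF \<phi> \<Theta>], where R = R])
      fix h :: real assume h: "0 < h" "h \<le> 1"
      have "t_coord (z + h *\<^sub>R (0 + (\<Sum>j\<in>{eT}. (z \<bullet> j) *\<^sub>R j))) = (1 + h) * t_coord z" for z
        by (simp add: eT_def inner_prod_def algebra_simps)
      then show "AE z in lebesgue. weight a (z + h *\<^sub>R (0 + (\<Sum>j\<in>{eT}. (z \<bullet> j) *\<^sub>R j))) = (1 + h) powr a * weight a z"
        using h by (auto simp: weight_def half_space_def powr_mult indicator_def zero_less_mult_iff)
    qed (use eT supp in auto)
    then have "(\<integral>z. weight a z * (gradient (\<lambda>z. \<phi> z * \<Theta> z) z \<bullet> ((z \<bullet> eT) *\<^sub>R eT)) \<partial>lebesgue) +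
        (\<integral>z. weight a z * ((1 + a) * (\<phi> z * \<Theta> z)) \<partial>lebesgue) = 0"
      by (simp add: mult.left_commute[of _ "1 + a"]) argo
    then have "(\<integral>z. weight a z * (gradient (\<lambda>z. \<phi> z * \<Theta> z) z \<bullet> ((z \<bullet> eT) *\<^sub>R eT)) +
        weight a z * ((1 + a) * (\<phi> z * \<Theta> z)) \<partial>lebesgue) = 0"
      by (subst Bochner_Integration.integral_add)
         (auto intro!: int continuous_intros cont simp: gradient_mult[OF \<phi> \<Theta>] supp gs)
    then show ?thesis
      unfolding gradient_mult[OF \<phi> \<Theta>] vert[folded eT_def]
      by (simp add: t inner_add_left algebra_simps del: inner_Pair)
  qed
  have dot: "gradient \<phi> z \<bullet> gradient \<Phi> z =
      (\<Sum>b\<in>Basis - {eT}. (gradient \<phi> z \<bullet> b) * (gradient \<Phi> z \<bullet> b)) + (gradient \<phi> z \<bullet> eT) * (gradient \<Phi> z \<bullet> eT)" for z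
    using eT by (subst euclidean_inner) (simp add: sum.remove add.commute)
  have "0 = (\<Sum>b\<in>Basis - {eT}. \<integral>z. weight a z * ((gradient \<phi> z \<bullet> b) * (gradient \<Phi> z \<bullet> b) +
      \<phi> z * (gradient (\<lambda>z. gradient \<Phi> z \<bullet> b) z \<bullet> b)) \<partial>lebesgue) +
      (\<integral>z. weight a z * ((gradient \<phi> z \<bullet> eT) * (gradient \<Phi> z \<bullet> eT) +
      \<phi> z * (t_coord z * (gradient \<Theta> z \<bullet> eT) + (1 + a) * \<Theta> z)) \<partial>lebesgue)"
    unfolding vertical by (simp add: horizontal)
  also have "\<dots> = (\<integral>z. (\<Sum>b\<in>Basis - {eT}. weight a z * ((gradient \<phi> z \<bullet> b) * (gradient \<Phi> z \<bullet> b) +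
      \<phi> z * (gradient (\<lambda>z. gradient \<Phi> z \<bullet> b) z \<bullet> b))) +
      weight a z * ((gradient \<phi> z \<bullet> eT) * (gradient \<Phi> z \<bullet> eT) +
      \<phi> z * (t_coord z * (gradient \<Theta> z \<bullet> eT) + (1 + a) * \<Theta> z)) \<partial>lebesgue)"
    by (subst Bochner_Integration.integral_add, intro Bochner_Integration.integrable_sum int)
       (auto intro!: int continuous_intros cont Bochner_Integration.integral_sum[symmetric] simp: supp gs gs2)
  also have "\<dots> = (\<integral>z. weight a z * (gradient \<phi> z \<bullet> gradient \<Phi> z) +
      weight a z * (\<phi> z * ((\<Sum>b\<in>Basis - {eT}. gradient (\<lambda>z. gradient \<Phi> z \<bullet> b) z \<bullet> b) +
        t_coord z * (gradient \<Theta> z \<bullet> eT) + (1 + a) * \<Theta> z)) \<partial>lebesgue)"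
    unfolding dot
    by (intro Bochner_Integration.integral_cong refl)
       (simp add: sum_distrib_left[symmetric] sum.distrib distrib_left add.assoc)
  also have "\<dots> = (\<integral>z. weight a z * (gradient \<phi> z \<bullet> gradient \<Phi> z) \<partial>lebesgue) +
      (\<integral>z. weight a z * (\<phi> z * ((\<Sum>b\<in>Basis - {eT}. gradient (\<lambda>z. gradient \<Phi> z \<bullet> b) z \<bullet> b) +
        t_coord z * (gradient \<Theta> z \<bullet> eT) + (1 + a) * \<Theta> z)) \<partial>lebesgue)"
    by (intro Bochner_Integration.integral_add int)
       (auto intro!: continuous_intros cont simp: supp gs gs2)
  finally show ?thesis unfolding eT_def by linarith
qed

text \<open>Differentiating d_t Phi = t Theta gives d_t^2 Phi = t d_t Theta + Theta, while (a/t) d_t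
  Phi = a Theta. So the expression in Theta, which makes sense at t = 0, is the weighted Laplacian
  where t > 0.\<close>

lemma has_wlap_eq_operator:
  fixes \<Phi> \<Theta> U :: "'n::finite point \<Rightarrow> real"
  assumes U: "has_wlap a U G l S" and S: "open S" "S \<subseteq> {z. t_coord z > 0}" and z: "z \<in> S"
    and eq: "\<And>z. z \<in> S \<Longrightarrow> \<Phi> z = U z" and \<Phi>: "\<Phi> \<in> C_infinity" and \<Theta>: "\<Theta> \<in> C_infinity"
    and vert: "\<And>z. gradient \<Phi> z \<bullet> (0, 0, 1) = t_coord z * \<Theta> z"
  shows "(\<Sum>b\<in>Basis - {(0, 0, 1)}. gradient (\<lambda>z. gradient \<Phi> z \<bullet> b) z \<bullet> b) +
        t_coord z * (gradient \<Theta> z \<bullet> (0, 0, 1)) + (1 + a) * \<Theta> z = l z"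
proof -
  define eT :: "'n point" where "eT = (0, 0, 1)"
  have eT: "eT \<in> Basis" by (simp add: eT_def Basis_prod_def zero_prod_def)
  have t: "t_coord z = z \<bullet> eT" for z by (simp add: eT_def inner_prod_def)
  have tz: "t_coord z > 0" using S z by auto
  obtain G' where G': "(G has_derivative G') (at z)"
      "(\<Sum>b\<in>Basis. G' b \<bullet> b) + a / t_coord z * (G z \<bullet> (0, 0, 1)) = l z"
    using U z unfolding has_wlap_def by blast
  have gr: "gradient \<Phi> x = G x" if "x \<in> S" for x
  proof -
    have "(\<Phi> has_derivative (\<lambda>h. G x \<bullet> h)) (at x)"
      by (rule has_derivative_transform_within_open[OF has_grad_onD[OF has_wlap_grad[OF U] that] S(1) that])
         (simp add: eq)
    then show ?thesis by (intro gradient_eqI) (simp add: gderiv_def inner_commute)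
  qed
  have g2: "gradient (\<lambda>z. gradient \<Phi> z \<bullet> b) z \<bullet> h = G' h \<bullet> b" for b h
  proof -
    have "((\<lambda>x. G x \<bullet> b) has_derivative (\<lambda>h. G' h \<bullet> b)) (at z)"
      by (rule has_derivative_inner_left[OF G'(1)])
    then have "((\<lambda>x. gradient \<Phi> x \<bullet> b) has_derivative (\<lambda>h. G' h \<bullet> b)) (at z)"
      by (rule has_derivative_transform_within_open[OF _ S(1) z]) (simp add: gr)
    from has_derivative_unique[OF C_infinity_has_derivative[OF C_infinity_gradient[OF \<Phi>, of b]] this]
    show ?thesis by metis
  qed
  have "((\<lambda>x. t_coord x * \<Theta> x) has_derivative (\<lambda>h. t_coord z * (gradient \<Theta> z \<bullet> h) + t_coord h * \<Theta> z)) (at z)"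
    by (intro has_derivative_mult has_derivative_snd has_derivative_ident C_infinity_has_derivative \<Theta>)
  moreover have "((\<lambda>x. t_coord x * \<Theta> x) has_derivative (\<lambda>h. gradient (\<lambda>z. gradient \<Phi> z \<bullet> eT) z \<bullet> h)) (at z)"
    using C_infinity_has_derivative[OF C_infinity_gradient[OF \<Phi>, of eT], of z] by (simp add: vert[folded eT_def])
  ultimately have "(\<lambda>h. t_coord z * (gradient \<Theta> z \<bullet> h) + t_coord h * \<Theta> z) =
      (\<lambda>h. gradient (\<lambda>z. gradient \<Phi> z \<bullet> eT) z \<bullet> h)" by (rule has_derivative_unique)
  from fun_cong[OF this, of eT] have "t_coord z * (gradient \<Theta> z \<bullet> eT) + t_coord eT * \<Theta> z = G' eT \<bullet> eT"
    unfolding g2 .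
  then have tt: "t_coord z * (gradient \<Theta> z \<bullet> eT) + \<Theta> z = G' eT \<bullet> eT" by (simp add: eT_def)
  have "G z \<bullet> eT = t_coord z * \<Theta> z" using gr[OF z] vert[of z] by (simp add: eT_def)
  then have th: "a / t_coord z * (G z \<bullet> eT) = a * \<Theta> z" using tz by simp
  have "(\<Sum>b\<in>Basis - {eT}. gradient (\<lambda>z. gradient \<Phi> z \<bullet> b) z \<bullet> b) = (\<Sum>b\<in>Basis - {eT}. G' b \<bullet> b)"
    by (simp add: g2)
  moreover have "(\<Sum>b\<in>Basis. G' b \<bullet> b) = G' eT \<bullet> eT + (\<Sum>b\<in>Basis - {eT}. G' b \<bullet> b)"
    using eT by (simp add: sum.remove)
  ultimately show ?thesis
    using G'(2) tt th unfolding eT_def[symmetric] by (simp add: algebra_simps)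
qed

section \<open>Homogeneous solutions\<close>

lemma has_wlap_cmult: "has_wlap a f G l S \<Longrightarrow> has_wlap a (\<lambda>z. c * f z) (\<lambda>z. c *\<^sub>R G z) (\<lambda>z. c * l z) S"
  using has_wlap_mult[OF has_wlap_const, of a f G l S c] by simp

lemma has_wlap_sum:
  assumes "\<And>i. i \<in> I \<Longrightarrow> has_wlap a (f i) (G i) (l i) S"
  shows "has_wlap a (\<lambda>z. \<Sum>i\<in>I. f i z) (\<lambda>z. \<Sum>i\<in>I. G i z) (\<lambda>z. \<Sum>i\<in>I. l i z) S"
  using assms
proof (induction I rule: infinite_finite_induct)
  case (insert i I)
  then show ?case using has_wlap_add[of a "f i" "G i" "l i" S] by simp
qed (use has_wlap_const[of a 0 S] in auto)

text \<open>The chain rule yields q (2 - 2s) a^(q-1) / rho and q (q - 1) a^(q-2) 2a / rho. The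
  indicial roots are thus 0 and s.\<close>

lemma has_wlap_a_powr:
  "has_wlap (1 - 2 * s) (\<lambda>z. coord_a z powr q) (\<lambda>z. (q * coord_a z powr (q - 1)) *\<^sub>R grad_a z)
    (\<lambda>z. 2 / rho z * (q * (q - s)) * coord_a z powr (q - 1)) {z::'n::finite point. t_coord z > 0}"
proof (rule has_wlap_cong)
  show "has_wlap (1 - 2 * s) (\<lambda>z. coord_a z powr q) (\<lambda>z. (q * coord_a z powr (q - 1)) *\<^sub>R grad_a z)
    (\<lambda>z. q * coord_a z powr (q - 1) * ((1 + (1 - 2 * s)) / rho z) +
      q * ((q - 1) * coord_a z powr (q - 1 - 1)) * (grad_a z \<bullet> grad_a z)) {z::'n::finite point. t_coord z > 0}"
  proof (rule has_wlap_compose[OF has_wlap_a])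
    fix z :: "'n point" assume "z \<in> {z. t_coord z > 0}"
    then have a: "coord_a z > 0" by (auto simp: coord_a_pos)
    show "((\<lambda>x. x powr q) has_real_derivative q * coord_a z powr (q - 1)) (at (coord_a z))"
      by (rule has_real_derivative_powr[OF a])
    show "((\<lambda>x. q * x powr (q - 1)) has_real_derivative q * ((q - 1) * coord_a z powr (q - 1 - 1))) (at (coord_a z))"
      by (rule DERIV_cmult[OF has_real_derivative_powr[OF a]])
  qed
next
  fix z :: "'n point" assume "z \<in> {z. t_coord z > 0}"
  then have a: "coord_a z > 0" and r: "rho z > 0" by (auto simp: coord_a_pos rho_pos_iff)
  have "coord_a z powr (q - 1) = coord_a z * coord_a z powr (q - 1 - 1)"
    using a by (simp add: powr_mult_base)
  then show "q * coord_a z powr (q - 1) * ((1 + (1 - 2 * s)) / rho z) +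
      q * ((q - 1) * coord_a z powr (q - 1 - 1)) * (grad_a z \<bullet> grad_a z) =
      2 / rho z * (q * (q - s)) * coord_a z powr (q - 1)"
    using r by (simp add: grad_a_sq field_simps)
qed

lemma has_wlap_b_power:
  "has_wlap (1 - 2 * s) (\<lambda>z. coord_b z ^ j) (\<lambda>z. (real j * coord_b z ^ (j - 1)) *\<^sub>R grad_b z)
    (\<lambda>z. 2 / rho z * (real j * (real j - s)) * coord_b z ^ (j - 1)) {z::'n::finite point. t_coord z > 0}"
proof (rule has_wlap_cong)
  show "has_wlap (1 - 2 * s) (\<lambda>z. coord_b z ^ j) (\<lambda>z. (real j * coord_b z ^ (j - 1)) *\<^sub>R grad_b z)
    (\<lambda>z. real j * coord_b z ^ (j - 1) * ((1 + (1 - 2 * s)) / rho z) +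
      real j * (real (j - 1) * coord_b z ^ (j - 1 - 1)) * (grad_b z \<bullet> grad_b z)) {z::'n::finite point. t_coord z > 0}"
    by (rule has_wlap_compose[OF has_wlap_b]) (auto intro!: derivative_eq_intros)
next
  fix z :: "'n point" assume "z \<in> {z. t_coord z > 0}"
  then have r: "rho z > 0" by (auto simp: rho_pos_iff)
  \<comment> \<open>For \<open>j \<le> 1\<close> the exponent \<open>j - 1 - 1\<close> truncates to
    0; the factor \<open>real (j - 1)\<close> makes both sides 0.\<close>
  have p: "real (j - 1) * coord_b z ^ (j - 1) = real (j - 1) * (coord_b z * coord_b z ^ (j - 1 - 1))"
    by (cases "j - 1") auto
  have j: "real j * real (j - 1) = real j * (real j - 1)" by (cases j) auto
  have "real j * (real (j - 1) * coord_b z ^ (j - 1 - 1)) * (grad_b z \<bullet> grad_b z) =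
      2 / rho z * real j * (real (j - 1) * (coord_b z * coord_b z ^ (j - 1 - 1)))"
    using r by (simp add: grad_b_sq)
  also have "\<dots> = 2 / rho z * (real j * real (j - 1)) * coord_b z ^ (j - 1)"
    unfolding p[symmetric] by simp
  finally show "real j * coord_b z ^ (j - 1) * ((1 + (1 - 2 * s)) / rho z) +
      real j * (real (j - 1) * coord_b z ^ (j - 1 - 1)) * (grad_b z \<bullet> grad_b z) =
      2 / rho z * (real j * (real j - s)) * coord_b z ^ (j - 1)"
    unfolding j by (simp add: divide_inverse algebra_simps)
qed

definition ab_pow :: "real \<Rightarrow> nat \<Rightarrow> 'n::finite point \<Rightarrow> real"
  where "ab_pow q j z = coord_a z powr q * coord_b z ^ j"

definition grad_ab_pow :: "real \<Rightarrow> nat \<Rightarrow> 'n::finite point \<Rightarrow> 'n point"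
  where "grad_ab_pow q j z = coord_a z powr q *\<^sub>R ((real j * coord_b z ^ (j - 1)) *\<^sub>R grad_b z) +
    coord_b z ^ j *\<^sub>R ((q * coord_a z powr (q - 1)) *\<^sub>R grad_a z)"

text \<open>By orthogonality of the gradients there is no mixed term: one summand lowers the power
  of a, the other that of b. This makes a two-term recursion for the coefficients possible.\<close>

lemma has_wlap_ab_pow:
  "has_wlap (1 - 2 * s) (ab_pow q j) (grad_ab_pow q j)
    (\<lambda>z. 2 / rho z * (q * (q - s) * ab_pow (q - 1) j z + real j * (real j - s) * ab_pow q (j - 1) z))
    {z::'n::finite point. t_coord z > 0}"
  unfolding ab_pow_def[abs_def] grad_ab_pow_def[abs_def]
  by (rule has_wlap_cong[OF has_wlap_mult[OF has_wlap_a_powr has_wlap_b_power]])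
     (auto simp: grad_a_b rho_pos_iff algebra_simps)

lemma grad_ab_pow_self:
  assumes "t_coord z > 0" shows "grad_ab_pow q j z \<bullet> z = (q + real j) * ab_pow q j z"
proof -
  have a: "coord_a z > 0" and r: "rho z > 0" using assms by (auto simp: coord_a_pos rho_pos_iff)
  have aq: "coord_a z powr (q - 1) * coord_a z = coord_a z powr q"
    using powr_mult_base[of "coord_a z" "q - 1"] a by (simp add: mult.commute)
  have bj: "real j * (coord_b z ^ (j - 1) * coord_b z) = real j * coord_b z ^ j" by (cases j) auto
  have "grad_ab_pow q j z \<bullet> z = coord_a z powr q * (real j * (coord_b z ^ (j - 1) * coord_b z)) +
      coord_b z ^ j * (q * (coord_a z powr (q - 1) * coord_a z))"
    unfolding grad_ab_pow_def inner_add_left inner_scaleR_left grad_a_self[OF r] grad_b_self[OF r] by simp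
  then show ?thesis unfolding aq bj ab_pow_def by (simp add: algebra_simps)
qed

lemma grad_ab_pow_horizontal: "grad_ab_pow q j z \<bullet> (\<xi>, 0, 0) = 0"
  unfolding grad_ab_pow_def inner_add_left inner_scaleR_left grad_a_horizontal grad_b_horizontal by simp

text \<open>
  The recursion makes the series below telescope, so that \<open>a\<^sup>s\<close> times a homogeneous polynomial of degree \<open>k\<close>
  in \<open>(a, b)\<close> solves the equation. No coefficient vanishes because \<open>s\<close> is not an integer.
\<close>
primrec hom_coeff :: "real \<Rightarrow> nat \<Rightarrow> nat \<Rightarrow> real"
  where
    "hom_coeff s k 0 = 1"
  | "hom_coeff s k (Suc i) =
      - (real (k - i) * (real (k - i) - s)) / (real (Suc i) * (real (Suc i) + s)) * hom_coeff s k i"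

text \<open>On rho = 1, where a = 1 - y and b = 1 + y with y = y_N, this is (1 - y)^s times a
  constant multiple of the Jacobi polynomial P_k^(s,-s)(y), normalised to have coefficient 1 at
  b^k.\<close>

definition hom_sol :: "real \<Rightarrow> nat \<Rightarrow> 'n::finite point \<Rightarrow> real"
  where "hom_sol s k z = (\<Sum>i\<le>k. hom_coeff s k i * ab_pow (s + real i) (k - i) z)"

definition grad_hom_sol :: "real \<Rightarrow> nat \<Rightarrow> 'n::finite point \<Rightarrow> 'n point"
  where "grad_hom_sol s k z = (\<Sum>i\<le>k. hom_coeff s k i *\<^sub>R grad_ab_pow (s + real i) (k - i) z)"

lemma has_wlap_hom_sol:
  assumes "s > 0"
  shows "has_wlap (1 - 2 * s) (hom_sol s k) (grad_hom_sol s k) (\<lambda>z. 0) {z::'n::finite point. t_coord z > 0}"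
  unfolding hom_sol_def[abs_def] grad_hom_sol_def[abs_def]
proof (rule has_wlap_cong[OF has_wlap_sum[OF has_wlap_cmult[OF has_wlap_ab_pow]]])
  fix z :: "'n point" assume "z \<in> {z. t_coord z > 0}"
  \<comment> \<open>\<open>T i\<close> is what the a-derivatives make of the i-th summand; the
    recursion turns the b-derivatives into \<open>- T (Suc i)\<close>. The telescoped ends vanish:
    \<open>T 0\<close> by its factor \<open>real 0\<close>, \<open>T (Suc k)\<close> because
    \<open>hom_coeff s k (Suc k)\<close> contains \<open>real (k - k)\<close>.\<close>
  define T where "T i = hom_coeff s k i * ((s + real i) * real i * ab_pow (s + real i - 1) (k - i) z)" for i
  have T_Suc: "hom_coeff s k i * (real (k - i) * (real (k - i) - s) * ab_pow (s + real i) (k - i - 1) z) = - T (Suc i)" for i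
  proof -
    have "hom_coeff s k (Suc i) * ((s + real (Suc i)) * real (Suc i)) =
        - (real (k - i) * (real (k - i) - s)) * hom_coeff s k i"
    proof -
      define m where "m = real (Suc i)"
      define X where "X = - (real (k - i) * (real (k - i) - s))"
      have "m * (m + s) \<noteq> 0" using assms by (auto simp: m_def add_pos_pos)
      then have "X / (m * (m + s)) * hom_coeff s k i * (m * (m + s)) = X * hom_coeff s k i" by simp
      then show ?thesis
        unfolding hom_coeff.simps m_def[symmetric] X_def[symmetric] by (simp only: add.commute[of s] mult.commute[of "m + s"])
    qed
    then have "hom_coeff s k (Suc i) * ((s + real (Suc i)) * real (Suc i)) * ab_pow (s + real i) (k - i - 1) z =
        - (real (k - i) * (real (k - i) - s)) * hom_coeff s k i * ab_pow (s + real i) (k - i - 1) z" by simp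
    note H = this
    have e: "s + real (Suc i) - 1 = s + real i" "k - Suc i = k - i - 1" by auto
    have "T (Suc i) = hom_coeff s k (Suc i) * ((s + real (Suc i)) * real (Suc i)) * ab_pow (s + real i) (k - i - 1) z"
      unfolding T_def e by (simp only: mult.assoc)
    then show ?thesis unfolding H by simp
  qed
  have "(\<Sum>i\<le>k. hom_coeff s k i * (2 / rho z * ((s + real i) * (s + real i - s) * ab_pow (s + real i - 1) (k - i) z +
      real (k - i) * (real (k - i) - s) * ab_pow (s + real i) (k - i - 1) z))) =
      (\<Sum>i\<le>k. 2 / rho z * (T i + hom_coeff s k i * (real (k - i) * (real (k - i) - s) * ab_pow (s + real i) (k - i - 1) z)))"
    by (intro sum.cong refl) (simp add: T_def algebra_simps)
  also have "\<dots> = 2 / rho z * (\<Sum>i\<le>k. T i - T (Suc i))"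
    unfolding T_Suc by (simp add: sum_distrib_left)
  also have "\<dots> = 0"
    unfolding sum_telescope by (simp add: T_def)
  finally show "(\<Sum>i\<le>k. hom_coeff s k i * (2 / rho z * ((s + real i) * (s + real i - s) * ab_pow (s + real i - 1) (k - i) z +
      real (k - i) * (real (k - i) - s) * ab_pow (s + real i) (k - i - 1) z))) = 0" .
qed

lemma grad_hom_sol_self:
  assumes "t_coord z > 0" shows "grad_hom_sol s k z \<bullet> z = (s + real k) * hom_sol s k z"
proof -
  have "grad_hom_sol s k z \<bullet> z = (\<Sum>i\<le>k. hom_coeff s k i * ((s + real i + real (k - i)) * ab_pow (s + real i) (k - i) z))"
    unfolding grad_hom_sol_def inner_sum_left inner_scaleR_left grad_ab_pow_self[OF assms] ..
  also have "\<dots> = (\<Sum>i\<le>k. (s + real k) * (hom_coeff s k i * ab_pow (s + real i) (k - i) z))"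
    by (intro sum.cong refl) (auto simp: of_nat_diff)
  finally show ?thesis by (simp add: hom_sol_def sum_distrib_left)
qed

lemma grad_hom_sol_horizontal: "grad_hom_sol s k z \<bullet> (\<xi>, 0, 0) = 0"
  unfolding grad_hom_sol_def inner_sum_left inner_scaleR_left grad_ab_pow_horizontal by simp

section \<open>Horizontal and radial factors of the test functions\<close>

definition radial_term :: "real ^ 'n \<Rightarrow> nat \<Rightarrow> (real \<Rightarrow> real) \<Rightarrow> 'n::finite point \<Rightarrow> real"
  where "radial_term \<xi> p \<kappa> z = ((\<xi>, 0, 0) \<bullet> z) ^ p * \<kappa> (z \<bullet> z)"

definition grad_radial_term :: "real ^ 'n \<Rightarrow> nat \<Rightarrow> (real \<Rightarrow> real) \<Rightarrow> (real \<Rightarrow> real) \<Rightarrow> 'n::finite point \<Rightarrow> 'n point"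
  where "grad_radial_term \<xi> p \<kappa> \<kappa>' z = ((\<xi>, 0, 0) \<bullet> z) ^ p *\<^sub>R (\<kappa>' (z \<bullet> z) *\<^sub>R (2 *\<^sub>R z)) +
    \<kappa> (z \<bullet> z) *\<^sub>R ((real p * ((\<xi>, 0, 0) \<bullet> z) ^ (p - 1)) *\<^sub>R (\<xi>, 0, 0))"

lemma has_grad_on_radial_term:
  assumes "\<And>x. (\<kappa> has_real_derivative \<kappa>' x) (at x)"
  shows "has_grad_on (radial_term \<xi> p \<kappa>) (grad_radial_term \<xi> p \<kappa> \<kappa>') (S :: 'n::finite point set)"
  unfolding radial_term_def[abs_def] grad_radial_term_def[abs_def]
proof (rule has_grad_on_mult)
  show "has_grad_on (\<lambda>z. ((\<xi>, 0, 0) \<bullet> z) ^ p)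
      (\<lambda>z. (real p * ((\<xi>, 0, 0) \<bullet> z) ^ (p - 1)) *\<^sub>R (\<xi>, 0, 0)) S"
    by (rule has_grad_on_compose[OF has_grad_on_linear, where g = "\<lambda>x. x ^ p" and g' = "\<lambda>x. real p * x ^ (p - 1)"])
       (auto intro!: derivative_eq_intros)
  have "has_grad_on (\<lambda>z. z \<bullet> z) (\<lambda>z::'n point. 2 *\<^sub>R z) S"
    unfolding has_grad_on_def by (auto intro!: derivative_eq_intros simp: inner_commute)
  then show "has_grad_on (\<lambda>z. \<kappa> (z \<bullet> z)) (\<lambda>z. \<kappa>' (z \<bullet> z) *\<^sub>R (2 *\<^sub>R z)) S"
    by (rule has_grad_on_compose) (rule assms)
qed

text \<open>Origin of the coefficient of kappa': |z|^2 contributes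
  \<open>2 * CARD('n) + 6 - 4 * s\<close>, the cross term with (xi . y')^p contributes 4p, and
  Euler's identity for \<open>hom_sol\<close> contributes 4 (s + k). The terms in s cancel. The
  Laplacian of (xi . y')^p leaves the power p - 2, the reason for an induction on p.\<close>

lemma has_wlap_hom_sol_radial_term:
  fixes \<xi> :: "real ^ 'n::finite"
  assumes "s > 0" and \<kappa>: "\<And>x. (\<kappa> has_real_derivative \<kappa>' x) (at x)" "\<And>x. (\<kappa>' has_real_derivative \<kappa>'' x) (at x)"
  shows "has_wlap (1 - 2 * s) (\<lambda>z. hom_sol s k z * radial_term \<xi> p \<kappa> z)
    (\<lambda>z. hom_sol s k z *\<^sub>R grad_radial_term \<xi> p \<kappa> \<kappa>' z + radial_term \<xi> p \<kappa> z *\<^sub>R grad_hom_sol s k z)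
    (\<lambda>z. hom_sol s k z * (((\<xi>, 0, 0) \<bullet> z) ^ p *
        (4 * (z \<bullet> z) * \<kappa>'' (z \<bullet> z) + (2 * real CARD('n) + 6 + 4 * real p + 4 * real k) * \<kappa>' (z \<bullet> z)) +
      real p * real (p - 1) * (\<xi> \<bullet> \<xi>) * ((\<xi>, 0, 0) \<bullet> z) ^ (p - 2) * \<kappa> (z \<bullet> z)))
    {z::'n point. t_coord z > 0}"
proof -
  define v :: "'n point" where "v = (\<xi>, 0, 0)"
  have vv: "v \<bullet> v = \<xi> \<bullet> \<xi>" by (simp add: v_def inner_prod_def)
  have "has_wlap (1 - 2 * s) (\<lambda>z. (v \<bullet> z) ^ p) (\<lambda>z. (real p * (v \<bullet> z) ^ (p - 1)) *\<^sub>R v)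
      (\<lambda>z. real p * (v \<bullet> z) ^ (p - 1) * 0 + (real p * (real (p - 1) * (v \<bullet> z) ^ (p - 1 - 1))) * (v \<bullet> v))
      {z::'n point. t_coord z > 0}"
    by (rule has_wlap_compose[OF has_wlap_inner, where g = "\<lambda>x. x ^ p" and g' = "\<lambda>x. real p * x ^ (p - 1)"])
       (auto intro!: derivative_eq_intros simp: v_def inner_prod_def)
  moreover have "has_wlap (1 - 2 * s) (\<lambda>z. \<kappa> (z \<bullet> z)) (\<lambda>z. \<kappa>' (z \<bullet> z) *\<^sub>R (2 *\<^sub>R z))
      (\<lambda>z. \<kappa>' (z \<bullet> z) * (2 * (real CARD('n) + 2) + 2 * (1 - 2 * s)) + \<kappa>'' (z \<bullet> z) * ((2 *\<^sub>R z) \<bullet> (2 *\<^sub>R z)))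
      {z::'n point. t_coord z > 0}"
    by (rule has_wlap_compose[OF has_wlap_norm_sq]) (auto intro: \<kappa>)
  ultimately have w: "has_wlap (1 - 2 * s) (radial_term \<xi> p \<kappa>) (grad_radial_term \<xi> p \<kappa> \<kappa>')
      (\<lambda>z. (v \<bullet> z) ^ p * (\<kappa>' (z \<bullet> z) * (2 * (real CARD('n) + 2) + 2 * (1 - 2 * s)) + \<kappa>'' (z \<bullet> z) * ((2 *\<^sub>R z) \<bullet> (2 *\<^sub>R z))) +
        \<kappa> (z \<bullet> z) * (real p * (v \<bullet> z) ^ (p - 1) * 0 + (real p * (real (p - 1) * (v \<bullet> z) ^ (p - 1 - 1))) * (v \<bullet> v)) +
        2 * (((real p * (v \<bullet> z) ^ (p - 1)) *\<^sub>R v) \<bullet> (\<kappa>' (z \<bullet> z) *\<^sub>R (2 *\<^sub>R z))))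
      {z::'n point. t_coord z > 0}"
    unfolding radial_term_def[abs_def] grad_radial_term_def[abs_def] v_def[symmetric] by (rule has_wlap_mult)
  show ?thesis
  proof (rule has_wlap_cong[OF has_wlap_mult[OF has_wlap_hom_sol[OF assms(1)] w]])
    fix z :: "'n point" assume "z \<in> {z. t_coord z > 0}"
    then have t: "t_coord z > 0" by simp
    have G: "grad_hom_sol s k z \<bullet> grad_radial_term \<xi> p \<kappa> \<kappa>' z = 2 * (v \<bullet> z) ^ p * \<kappa>' (z \<bullet> z) * (s + real k) * hom_sol s k z"
      unfolding grad_radial_term_def inner_add_right inner_scaleR_right grad_hom_sol_horizontal grad_hom_sol_self[OF t] v_def
      by simp
    have up: "real p * (v \<bullet> z) ^ (p - 1) * (v \<bullet> z) = real p * (v \<bullet> z) ^ p" by (cases p) auto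
    have e: "2 * (((real p * (v \<bullet> z) ^ (p - 1)) *\<^sub>R v) \<bullet> (\<kappa>' (z \<bullet> z) *\<^sub>R (2 *\<^sub>R z))) = 4 * (real p * (v \<bullet> z) ^ p) * \<kappa>' (z \<bullet> z)"
      unfolding up[symmetric] by (simp only: inner_scaleR_left inner_scaleR_right) algebra
    have p2: "p - 1 - 1 = p - 2" by simp
    show "hom_sol s k z * ((v \<bullet> z) ^ p * (\<kappa>' (z \<bullet> z) * (2 * (real CARD('n) + 2) + 2 * (1 - 2 * s)) + \<kappa>'' (z \<bullet> z) * ((2 *\<^sub>R z) \<bullet> (2 *\<^sub>R z))) +
        \<kappa> (z \<bullet> z) * (real p * (v \<bullet> z) ^ (p - 1) * 0 + (real p * (real (p - 1) * (v \<bullet> z) ^ (p - 1 - 1))) * (v \<bullet> v)) +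
        2 * (((real p * (v \<bullet> z) ^ (p - 1)) *\<^sub>R v) \<bullet> (\<kappa>' (z \<bullet> z) *\<^sub>R (2 *\<^sub>R z)))) +
        radial_term \<xi> p \<kappa> z * 0 + 2 * (grad_hom_sol s k z \<bullet> grad_radial_term \<xi> p \<kappa> \<kappa>' z) =
      hom_sol s k z * (((\<xi>, 0, 0) \<bullet> z) ^ p *
        (4 * (z \<bullet> z) * \<kappa>'' (z \<bullet> z) + (2 * real CARD('n) + 6 + 4 * real p + 4 * real k) * \<kappa>' (z \<bullet> z)) +
      real p * real (p - 1) * (\<xi> \<bullet> \<xi>) * ((\<xi>, 0, 0) \<bullet> z) ^ (p - 2) * \<kappa> (z \<bullet> z))"
      unfolding G e vv p2 v_def[symmetric] by (simp add: algebra_simps)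
  qed
qed

section \<open>Smooth truncations\<close>

lemma has_grad_on_sum_cmult:
  assumes "\<And>i. i \<in> I \<Longrightarrow> has_grad_on (f i) (G i) S"
  shows "has_grad_on (\<lambda>z. \<Sum>i\<in>I. c i * f i z) (\<lambda>z. \<Sum>i\<in>I. c i *\<^sub>R G i z) S"
  unfolding has_grad_on_def inner_sum_left inner_scaleR_left
  using assms by (auto intro!: has_derivative_sum has_derivative_mult_right simp: has_grad_on_def)

lemma C_infinity_sum_cmult:
  "(\<And>i. i \<in> I \<Longrightarrow> f i \<in> C_infinity) \<Longrightarrow> (\<lambda>z. \<Sum>i\<in>I. c i * f i z) \<in> C_infinity"
  by (auto simp: C_infinity_iff intro!: Ck_on_sum Ck_on_mult)

lemma open_rho_pos: "open {z::'n::finite point. rho z > 0}"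
  by (intro open_Collect_less continuous_intros)

lemma Ck_on_inner_const:
  fixes v :: "'a::euclidean_space"
  shows "open S \<Longrightarrow> Ck_on k S (\<lambda>z. v \<bullet> z)"
  by (rule Ck_on_bounded_linear) (auto intro: bounded_linear_inner_right)

lemma Ck_on_y_last: "open S \<Longrightarrow> Ck_on k S (y_last :: 'n::finite point \<Rightarrow> real)"
  using Ck_on_inner_const[of S k "(0, 1, 0) :: 'n point"] by (simp add: last_inner)

lemma Ck_on_t_coord: "open S \<Longrightarrow> Ck_on k S (t_coord :: 'n::finite point \<Rightarrow> real)"
  using Ck_on_inner_const[of S k "(0, 0, 1) :: 'n point"] by (simp add: inner_prod_def)

lemma Ck_on_rho: "Ck_on k {z. rho z > 0} (rho :: 'n::finite point \<Rightarrow> real)"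
proof -
  have "Ck_on k {z. rho z > 0} (\<lambda>z::'n point. ((y_last z)\<^sup>2 + (t_coord z)\<^sup>2) powr (1 / 2))"
    by (rule Ck_on_compose[OF open_rho_pos _ Ck_on_powr],
        force simp: rho_pos_iff sum_power2_gt_zero_iff,
        intro Ck_on_add Ck_on_power Ck_on_y_last Ck_on_t_coord open_rho_pos)
  then show ?thesis by (simp add: powr_half_sqrt rho_def[abs_def])
qed

lemma Ck_on_coord_a: "Ck_on k {z. rho z > 0} (coord_a :: 'n::finite point \<Rightarrow> real)"
  unfolding coord_a_def[abs_def] by (intro Ck_on_diff Ck_on_rho Ck_on_y_last open_rho_pos)

lemma Ck_on_coord_b: "Ck_on k {z. rho z > 0} (coord_b :: 'n::finite point \<Rightarrow> real)"
  unfolding coord_b_def[abs_def] by (intro Ck_on_add Ck_on_rho Ck_on_y_last open_rho_pos)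

text \<open>The singular points of \<open>rho\<close> lie on the edge, where a = 0. Vanishing for
  small a takes care of a neighbourhood of the edge, so two open sets cover the space.\<close>

lemma C_infinityI_rho:
  fixes f :: "'n::finite point \<Rightarrow> real"
  assumes "\<And>k. Ck_on k {z. rho z > 0} f" "\<epsilon> > 0" "\<And>z. coord_a z < \<epsilon> \<Longrightarrow> f z = 0"
  shows "f \<in> C_infinity"
  unfolding C_infinity_iff
proof
  fix k
  have o: "open {z::'n point. coord_a z < \<epsilon>}" by (intro open_Collect_less continuous_intros)
  have "Ck_on k {z. coord_a z < \<epsilon>} f"
    by (rule Ck_on_cong[OF o _ Ck_on_const[of _ _ 0]]) (simp add: assms)
  then have "Ck_on k ({z. rho z > 0} \<union> {z. coord_a z < \<epsilon>}) f"
    by (intro Ck_on_Un open_rho_pos o assms)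
  moreover have "{z::'n point. rho z > 0} \<union> {z. coord_a z < \<epsilon>} = UNIV"
  proof -
    have "coord_a z < \<epsilon>" if "\<not> rho z > 0" for z :: "'n point"
      using that assms(2) coord_a_eq_0_iff[of z] by (auto simp: rho_pos_iff)
    then show ?thesis by auto
  qed
  ultimately show "Ck_on k UNIV f" by simp
qed

definition smooth_fun :: "(real \<Rightarrow> real) \<Rightarrow> bool"
  where "smooth_fun f \<longleftrightarrow> (\<forall>k. Ck_on k UNIV f)"

lemma smooth_fun_deriv: "smooth_fun f \<Longrightarrow> smooth_fun (deriv f)"
  and smooth_fun_DERIV: "smooth_fun f \<Longrightarrow> (f has_real_derivative deriv f x) (at x)"
  using Ck_on_real_Suc_deriv[of UNIV _ f] by (auto simp: smooth_fun_def)

lemma smooth_fun_continuous: "smooth_fun f \<Longrightarrow> continuous_on S f"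
  unfolding smooth_fun_def by (metis Ck_on.simps(1) continuous_on_subset subset_UNIV)

lemma smooth_fun_mult: "smooth_fun f \<Longrightarrow> smooth_fun g \<Longrightarrow> smooth_fun (\<lambda>x. f x * g x)"
  by (simp add: smooth_fun_def Ck_on_mult)

lemma deriv_eq_0_open:
  fixes f :: "real \<Rightarrow> real"
  assumes "open S" "x \<in> S" "\<And>y. y \<in> S \<Longrightarrow> f y = c" shows "deriv f x = 0"
proof -
  have "((\<lambda>_. c) has_real_derivative 0) (at x)" by simp
  then have "(f has_real_derivative 0) (at x)"
    by (rule has_field_derivative_transform_within_open[OF _ assms(1,2)]) (simp add: assms(3))
  then show ?thesis by (rule DERIV_imp_deriv)
qed

section \<open>Truncated terms and their derivatives\<close>

definition test_term :: "(real \<Rightarrow> real) \<Rightarrow> nat \<Rightarrow> real ^ 'n \<Rightarrow> nat \<Rightarrow> (real \<Rightarrow> real) \<Rightarrow> 'n::finite point \<Rightarrow> real"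
  where "test_term h j \<xi> p \<kappa> z = (h (coord_a z) * coord_b z ^ j) * radial_term \<xi> p \<kappa> z"

definition grad_test_term :: "(real \<Rightarrow> real) \<Rightarrow> nat \<Rightarrow> real ^ 'n \<Rightarrow> nat \<Rightarrow> (real \<Rightarrow> real) \<Rightarrow> 'n::finite point \<Rightarrow> 'n point"
  where "grad_test_term h j \<xi> p \<kappa> z = (h (coord_a z) * coord_b z ^ j) *\<^sub>R grad_radial_term \<xi> p \<kappa> (deriv \<kappa>) z +
    radial_term \<xi> p \<kappa> z *\<^sub>R (h (coord_a z) *\<^sub>R ((real j * coord_b z ^ (j - 1)) *\<^sub>R grad_b z) +
      coord_b z ^ j *\<^sub>R (deriv h (coord_a z) *\<^sub>R grad_a z))"

text \<open>The t-derivative of \<open>test_term\<close> divided by t: the t-derivatives of a, b and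
  |z|^2 are t / rho, t / rho and 2t, so no singularity arises at t = 0 off the edge. It is the Theta
  of \<open>weighted_integration_by_parts\<close>.\<close>

definition vert_test_term :: "(real \<Rightarrow> real) \<Rightarrow> nat \<Rightarrow> real ^ 'n \<Rightarrow> nat \<Rightarrow> (real \<Rightarrow> real) \<Rightarrow> 'n::finite point \<Rightarrow> real"
  where "vert_test_term h j \<xi> p \<kappa> z = (h (coord_a z) * coord_b z ^ j) * (2 * radial_term \<xi> p (deriv \<kappa>) z) +
    radial_term \<xi> p \<kappa> z * ((h (coord_a z) * (real j * coord_b z ^ (j - 1)) +
      coord_b z ^ j * deriv h (coord_a z)) * inverse (rho z))"

context
  fixes h :: "real \<Rightarrow> real" and \<kappa> :: "real \<Rightarrow> real" and \<epsilon> :: real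
  assumes h: "smooth_fun h" "\<epsilon> > 0" "\<And>x. x \<le> \<epsilon> \<Longrightarrow> h x = 0" and \<kappa>: "smooth_fun \<kappa>"
begin

lemma cut_deriv_eq_0: "x < \<epsilon> \<Longrightarrow> deriv h x = 0"
  by (rule deriv_eq_0_open[of "{..<\<epsilon>}" _ _ 0]) (auto simp: h)

lemma has_grad_on_test_term: "has_grad_on (test_term h j \<xi> p \<kappa>) (grad_test_term h j \<xi> p \<kappa>) (UNIV :: 'n::finite point set)"
  unfolding has_grad_on_def
proof
  fix z :: "'n point"
  show "(test_term h j \<xi> p \<kappa> has_derivative (\<bullet>) (grad_test_term h j \<xi> p \<kappa> z)) (at z)"
  proof (cases "rho z > 0")
    case True
    have "has_grad_on (test_term h j \<xi> p \<kappa>) (grad_test_term h j \<xi> p \<kappa>) {z. rho z > 0}"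
      unfolding test_term_def[abs_def] grad_test_term_def[abs_def]
      by (intro has_grad_on_mult has_grad_on_compose[OF has_grad_on_a] has_grad_on_radial_term
          has_grad_on_compose[OF has_grad_on_b, where g = "\<lambda>x. x ^ j" and g' = "\<lambda>x. real j * x ^ (j - 1)"]
          smooth_fun_DERIV h \<kappa>) (auto intro!: derivative_eq_intros)
    from has_grad_onD[OF this, of z] True show ?thesis by simp
  next
    case False
    \<comment> \<open>On the edge a is below epsilon, so the function vanishes in a whole
      neighbourhood.\<close>
    then have a: "coord_a z = 0" by (simp add: rho_pos_iff coord_a_eq_0_iff)
    have o: "open {z::'n point. coord_a z < \<epsilon>}" by (intro open_Collect_less continuous_intros)
    have "((\<lambda>_. 0) has_derivative (\<lambda>_. 0)) (at z)" by simp
    then have "(test_term h j \<xi> p \<kappa> has_derivative (\<lambda>_. 0)) (at z)"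
      by (rule has_derivative_transform_within_open[OF _ o]) (use a h in \<open>auto simp: test_term_def\<close>)
    moreover have "grad_test_term h j \<xi> p \<kappa> z = 0"
      using a h cut_deriv_eq_0[of 0] by (simp add: grad_test_term_def)
    moreover have "(\<bullet>) (0 :: 'n point) = (\<lambda>_. 0)" by (rule ext) simp
    ultimately show ?thesis by simp
  qed
qed

lemma Ck_on_radial_term:
  assumes "smooth_fun \<kappa>'" "open S" shows "Ck_on k S (radial_term \<xi> p \<kappa>' :: 'n::finite point \<Rightarrow> real)"
proof -
  have "Ck_on k S (\<lambda>z::'n point. z \<bullet> z)"
    by (subst euclidean_inner) (intro Ck_on_sum Ck_on_mult Ck_on_bounded_linear[OF _ bounded_linear_inner_left] assms)
  then have "Ck_on k S (\<lambda>z::'n point. \<kappa>' (z \<bullet> z))"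
    by (rule Ck_on_compose[OF assms(2) _ _ , where T = UNIV, rotated 2]) (use assms in \<open>auto simp: smooth_fun_def\<close>)
  then show ?thesis
    unfolding radial_term_def[abs_def] by (intro Ck_on_mult Ck_on_power Ck_on_inner_const assms)
qed

lemma Ck_on_compose_coord_a:
  assumes "smooth_fun g" shows "Ck_on k {z. rho z > 0} (\<lambda>z::'n::finite point. g (coord_a z))"
  by (rule Ck_on_compose[OF open_rho_pos _ _ Ck_on_coord_a, where T = UNIV]) (use assms in \<open>auto simp: smooth_fun_def\<close>)

lemma C_infinity_test_term: "(test_term h j \<xi> p \<kappa> :: 'n::finite point \<Rightarrow> real) \<in> C_infinity"
proof (rule C_infinityI_rho[OF _ h(2)])
  show "Ck_on k {z. rho z > 0} (test_term h j \<xi> p \<kappa> :: 'n point \<Rightarrow> real)" for k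
    unfolding test_term_def[abs_def]
    by (intro Ck_on_mult Ck_on_power Ck_on_compose_coord_a Ck_on_coord_b Ck_on_radial_term open_rho_pos h \<kappa>)
qed (simp add: test_term_def h)

lemma C_infinity_vert_test_term: "(vert_test_term h j \<xi> p \<kappa> :: 'n::finite point \<Rightarrow> real) \<in> C_infinity"
proof (rule C_infinityI_rho[OF _ h(2)])
  show "Ck_on k {z. rho z > 0} (vert_test_term h j \<xi> p \<kappa> :: 'n point \<Rightarrow> real)" for k
    unfolding vert_test_term_def[abs_def]
    by (intro Ck_on_mult Ck_on_add Ck_on_power Ck_on_compose_coord_a Ck_on_coord_b Ck_on_radial_term open_rho_pos h \<kappa>
        Ck_on_const smooth_fun_deriv Ck_on_compose[OF _ _ Ck_on_inverse Ck_on_rho]) auto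
qed (simp add: vert_test_term_def h cut_deriv_eq_0)

lemma grad_test_term_vertical: "grad_test_term h j \<xi> p \<kappa> z \<bullet> (0, 0, 1) = t_coord z * vert_test_term h j \<xi> p \<kappa> (z :: 'n::finite point)"
proof -
  have "z \<bullet> (0, 0, 1) = t_coord z" "((\<xi>, 0, 0) :: 'n point) \<bullet> (0, 0, 1) = 0" by (simp_all add: inner_prod_def)
  then have "grad_radial_term \<xi> p \<kappa> (deriv \<kappa>) z \<bullet> (0, 0, 1) = t_coord z * (2 * radial_term \<xi> p (deriv \<kappa>) z)"
    unfolding grad_radial_term_def radial_term_def inner_add_left inner_scaleR_left by simp
  then show ?thesis
    unfolding grad_test_term_def vert_test_term_def inner_add_left inner_scaleR_left grad_a_vertical grad_b_vertical
    by (simp add: divide_inverse algebra_simps)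
qed

end

text \<open>
  The cutoff \<open>smooth_step (x / \<epsilon>)\<close> does not increase the order of \<open>x\<^sup>q\<close> and \<open>x\<^sup>q\<^sup>-\<^sup>1\<close>: its derivative is of size
  \<open>1 / \<epsilon>\<close> only where \<open>x\<close> is comparable to \<open>\<epsilon>\<close>. Hence the bounds below are uniform in \<open>\<epsilon>\<close>.
\<close>
definition cut_powr :: "real \<Rightarrow> real \<Rightarrow> real \<Rightarrow> real"
  where "cut_powr \<epsilon> q x = x powr q * smooth_step (x / \<epsilon>)"

lemma smooth_step_deriv_bounded: "\<exists>B\<ge>0. \<forall>x. \<bar>deriv smooth_step x\<bar> \<le> B"
proof -
  have sm: "smooth_fun smooth_step" by (simp add: smooth_fun_def Ck_on_smooth_step)
  have "deriv smooth_step x = 0" if "norm x > 2" for x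
  proof (cases "x > 2")
    case True
    then show ?thesis by (intro deriv_eq_0_open[of "{2<..}" _ _ 1]) auto
  next
    case False
    with that show ?thesis by (intro deriv_eq_0_open[of "{..<1}" _ _ 0]) auto
  qed
  with continuous_compact_support_bounded[of "deriv smooth_step" 2] smooth_fun_continuous[OF smooth_fun_deriv[OF sm]]
  show ?thesis by simp
qed

lemma cut_powr_eq_0: "\<epsilon> > 0 \<Longrightarrow> x \<le> \<epsilon> \<Longrightarrow> cut_powr \<epsilon> q x = 0"
  by (simp add: cut_powr_def divide_le_eq_1)

lemma cut_powr_eq: "\<epsilon> > 0 \<Longrightarrow> x \<ge> 2 * \<epsilon> \<Longrightarrow> cut_powr \<epsilon> q x = x powr q"
  by (simp add: cut_powr_def le_divide_eq)

lemma smooth_fun_cut_powr: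
  assumes "\<epsilon> > 0" shows "smooth_fun (cut_powr \<epsilon> q)"
  unfolding smooth_fun_def
proof
  fix k
  have "Ck_on k UNIV (\<lambda>x. smooth_step (inverse \<epsilon> * x + 0))"
    by (rule Ck_on_compose[OF _ _ Ck_on_smooth_step Ck_on_affine]) auto
  then have "Ck_on k {0<..} (cut_powr \<epsilon> q)"
    unfolding cut_powr_def[abs_def]
    by (intro Ck_on_mult Ck_on_powr) (auto simp: divide_inverse_commute elim: Ck_on_subset)
  moreover have "Ck_on k {..<\<epsilon>} (cut_powr \<epsilon> q)"
    by (rule Ck_on_cong[OF _ _ Ck_on_const[of _ _ 0]]) (auto simp: cut_powr_eq_0 assms)
  ultimately have "Ck_on k ({0<..} \<union> {..<\<epsilon>}) (cut_powr \<epsilon> q)" by (intro Ck_on_Un) auto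
  moreover have "{0<..} \<union> {..<\<epsilon>} = UNIV" using assms by auto
  ultimately show "Ck_on k UNIV (cut_powr \<epsilon> q)" by simp
qed

lemma cut_powr_le: "\<bar>cut_powr \<epsilon> q x\<bar> \<le> x powr q"
  using smooth_step_bounds[of "x / \<epsilon>"] by (auto simp: cut_powr_def abs_mult mult_left_le)

lemma deriv_cut_powr_le:
  assumes "q > 0"
  shows "\<exists>C\<ge>0. \<forall>\<epsilon>>0. \<forall>x>0. \<bar>deriv (cut_powr \<epsilon> q) x\<bar> \<le> C * x powr (q - 1)"
proof -
  obtain B where B: "B \<ge> 0" "\<And>x. \<bar>deriv smooth_step x\<bar> \<le> B" using smooth_step_deriv_bounded by blast
  have sm: "smooth_fun smooth_step" by (simp add: smooth_fun_def Ck_on_smooth_step)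
  have "\<bar>deriv (cut_powr \<epsilon> q) x\<bar> \<le> (q + 2 * B) * x powr (q - 1)" if \<epsilon>: "\<epsilon> > 0" and x: "x > 0" for \<epsilon> x
  proof -
    have "((\<lambda>x. smooth_step (x / \<epsilon>)) has_real_derivative deriv smooth_step (x / \<epsilon>) * (1 / \<epsilon>)) (at x)"
      by (rule DERIV_chain2[of smooth_step, OF smooth_fun_DERIV[OF sm]]) (use \<epsilon> in \<open>auto intro!: derivative_eq_intros\<close>)
    from DERIV_mult[OF has_real_derivative_powr[OF x, of q] this]
    have d: "deriv (cut_powr \<epsilon> q) x = q * x powr (q - 1) * smooth_step (x / \<epsilon>) + deriv smooth_step (x / \<epsilon>) * (1 / \<epsilon>) * x powr q"
      unfolding cut_powr_def[abs_def] by (intro DERIV_imp_deriv)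
    have "\<bar>deriv smooth_step (x / \<epsilon>) * (1 / \<epsilon>) * x powr q\<bar> \<le> 2 * B * x powr (q - 1)"
    proof (cases "x / \<epsilon> > 2")
      case True
      then have "deriv smooth_step (x / \<epsilon>) = 0" by (intro deriv_eq_0_open[of "{2<..}" _ _ 1]) auto
      then show ?thesis using B by simp
    next
      case False
      \<comment> \<open>Where the derivative of the step is nonzero, x / epsilon is at most 2, so 1
        / epsilon is traded for 2 / x.\<close>
      have "\<bar>deriv smooth_step (x / \<epsilon>) * (1 / \<epsilon>) * x powr q\<bar> = \<bar>deriv smooth_step (x / \<epsilon>)\<bar> * ((x / \<epsilon>) * x powr (q - 1))"
        using \<epsilon> x powr_mult_base[of x "q - 1"] by (simp add: abs_mult)
      also have "\<dots> \<le> B * (2 * x powr (q - 1))"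
        using False \<epsilon> x B by (intro mult_mono mult_right_mono) auto
      finally show ?thesis by simp
    qed
    moreover have "\<bar>q * x powr (q - 1) * smooth_step (x / \<epsilon>)\<bar> \<le> q * x powr (q - 1)"
      using smooth_step_bounds[of "x / \<epsilon>"] assms by (auto simp: abs_mult mult_left_le)
    ultimately show ?thesis
      unfolding d distrib_right by (intro order_trans[OF abs_triangle_ineq] add_mono)
  qed
  with B(1) assms show ?thesis by (intro exI[of _ "q + 2 * B"]) simp
qed

section \<open>Energy bounds\<close>

lemma radial_term_eq_0: "(\<And>v. v > R\<^sup>2 \<Longrightarrow> \<kappa> v = 0) \<Longrightarrow> R \<ge> 0 \<Longrightarrow> norm z > R \<Longrightarrow> radial_term \<xi> p \<kappa> z = 0"
  by (simp add: radial_term_def dot_square_norm power_strict_mono)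

lemma grad_radial_term_eq_0:
  assumes "\<And>v. v > R\<^sup>2 \<Longrightarrow> \<kappa> v = 0" "R \<ge> 0" "norm z > R"
  shows "grad_radial_term \<xi> p \<kappa> (deriv \<kappa>) z = 0"
proof -
  have "z \<bullet> z > R\<^sup>2" using assms by (simp add: dot_square_norm power_strict_mono)
  moreover from this have "deriv \<kappa> (z \<bullet> z) = 0" by (intro deriv_eq_0_open[of "{R\<^sup>2<..}" _ _ 0]) (auto simp: assms)
  ultimately show ?thesis using assms by (simp add: grad_radial_term_def zero_prod_def)
qed

lemma continuous_on_radial_term: "smooth_fun \<kappa> \<Longrightarrow> continuous_on S (radial_term \<xi> p \<kappa>)"
  unfolding radial_term_def[abs_def]
  by (intro continuous_intros continuous_on_compose2[OF smooth_fun_continuous[of \<kappa> UNIV]]) auto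

lemma continuous_on_grad_radial_term: "smooth_fun \<kappa> \<Longrightarrow> continuous_on S (grad_radial_term \<xi> p \<kappa> (deriv \<kappa>))"
  unfolding grad_radial_term_def[abs_def]
  by (intro continuous_intros continuous_on_compose2[OF smooth_fun_continuous[of \<kappa> UNIV]]
      continuous_on_compose2[OF smooth_fun_continuous[of "deriv \<kappa>" UNIV]] smooth_fun_deriv) auto

text \<open>The factor a^(1/2) softens the singularity a^(s-1) of the derivative of a^s to
  a^(s-1/2), the gain that makes the energy finite.\<close>

lemma norm_grad_a:
  assumes "rho z > 0"
  shows "norm (grad_a z) = sqrt 2 * (coord_a z powr (1 / 2) * rho z powr (- (1 / 2)))"
  unfolding powr_minus powr_half_sqrt[OF coord_a_nonneg] powr_half_sqrt[OF rho_nonneg] norm_eq_sqrt_inner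
    grad_a_sq[OF assms] real_sqrt_divide real_sqrt_mult by (simp add: divide_inverse)

lemma norm_grad_b: "rho z > 0 \<Longrightarrow> norm (grad_b z) \<le> 2"
proof -
  assume r: "rho z > 0"
  have "2 * coord_b z / rho z \<le> 4" using coord_b_le[of z] r by (simp add: field_simps)
  then have "sqrt (2 * coord_b z / rho z) \<le> sqrt 4" by (rule real_sqrt_le_mono)
  then show ?thesis using r by (simp add: norm_eq_sqrt_inner grad_b_sq)
qed

text \<open>Only the derivative of the truncated power of a can be singular; all other factors are
  bounded on the ball that carries kappa. The extra powers a^i and b^j go into the constant there,
  so the exponent of a does not depend on i.\<close>

lemma grad_test_term_energy:
  fixes \<xi> :: "real ^ 'n::finite"
  assumes s: "s > 0" and \<kappa>: "smooth_fun \<kappa>" "\<And>v. v > R\<^sup>2 \<Longrightarrow> \<kappa> v = 0" and R: "R > 0"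
  shows "\<exists>C\<ge>0. \<forall>\<epsilon>>0. \<forall>z::'n point. t_coord z > 0 \<longrightarrow>
    norm (grad_test_term (cut_powr \<epsilon> (s + real i)) j \<xi> p \<kappa> z) \<le> C * (coord_a z powr (s - 1 / 2) * rho z powr (- (1 / 2)) + 1)"
proof -
  define q where "q = s + real i"
  have q: "q > 0" using s by (simp add: q_def)
  obtain C1 where C1: "C1 \<ge> 0" "\<And>\<epsilon> x. \<epsilon> > 0 \<Longrightarrow> x > 0 \<Longrightarrow> \<bar>deriv (cut_powr \<epsilon> q) x\<bar> \<le> C1 * x powr (q - 1)"
    using deriv_cut_powr_le[OF q] by blast
  have R0: "R \<ge> 0" using R by simp
  have pk0: "radial_term \<xi> p \<kappa> z = 0" "grad_radial_term \<xi> p \<kappa> (deriv \<kappa>) z = 0" if "norm z > R" for z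
    using radial_term_eq_0[of R \<kappa> z \<xi> p] grad_radial_term_eq_0[of R \<kappa> z \<xi> p] \<kappa>(2) R0 that by simp_all
  obtain K1 where K1: "K1 \<ge> 0" "\<And>z::'n point. norm (radial_term \<xi> p \<kappa> z) \<le> K1"
    using continuous_compact_support_bounded[OF continuous_on_radial_term[OF \<kappa>(1)] pk0(1)] by blast
  obtain K2 where K2: "K2 \<ge> 0" "\<And>z::'n point. norm (grad_radial_term \<xi> p \<kappa> (deriv \<kappa>) z) \<le> K2"
    using continuous_compact_support_bounded[OF continuous_on_grad_radial_term[OF \<kappa>(1)] pk0(2)] by blast
  define H where "H = (2 * R) powr q"
  define B where "B = (2 * R) ^ j"
  define B' where "B' = real j * (2 * R) ^ (j - 1)"
  define C2 where "C2 = C1 * (2 * R) ^ i * sqrt 2"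
  define C where "C = H * B * K2 + K1 * (H * (B' * 2)) + K1 * (B * C2)"
  have nn: "H \<ge> 0" "B \<ge> 0" "B' \<ge> 0" "C2 \<ge> 0" using R C1 by (auto simp: H_def B_def B'_def C2_def)
  have C: "C \<ge> 0" using nn K1 K2 by (simp add: C_def)
  have "norm (grad_test_term (cut_powr \<epsilon> q) j \<xi> p \<kappa> z) \<le> C * (coord_a z powr (s - 1 / 2) * rho z powr (- (1 / 2)) + 1)"
    if \<epsilon>: "\<epsilon> > 0" and t: "t_coord z > 0" for \<epsilon> and z :: "'n point"
  proof (cases "norm z > R")
    case True
    then have "grad_test_term (cut_powr \<epsilon> q) j \<xi> p \<kappa> z = 0"
      using pk0 by (simp add: grad_test_term_def)
    then show ?thesis using C by simp
  next
    case False
    have a: "coord_a z > 0" and r: "rho z > 0" using t by (auto simp: coord_a_pos rho_pos_iff)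
    have a2: "coord_a z \<le> 2 * R" and b2: "coord_b z \<le> 2 * R"
      using coord_a_le[of z] coord_b_le[of z] rho_le_norm[of z] False by auto
    have h: "\<bar>cut_powr \<epsilon> q (coord_a z)\<bar> \<le> H"
      using cut_powr_le[of \<epsilon> q "coord_a z"] powr_mono2[of q "coord_a z" "2 * R"] a a2 q by (simp add: H_def)
    have b: "coord_b z ^ j \<le> B" "0 \<le> coord_b z ^ j" "real j * coord_b z ^ (j - 1) \<le> B'" "0 \<le> real j * coord_b z ^ (j - 1)"
      unfolding B_def B'_def
      by (intro power_mono[OF b2 coord_b_nonneg] mult_left_mono mult_nonneg_nonneg
          zero_le_power[OF coord_b_nonneg] of_nat_0_le_iff)+
    define X where "X = coord_a z powr (s - 1 / 2) * rho z powr (- (1 / 2))"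
    have X: "X \<ge> 0" by (simp add: X_def)
    have h': "\<bar>deriv (cut_powr \<epsilon> q) (coord_a z)\<bar> * norm (grad_a z) \<le> C2 * X"
    proof -
      have "coord_a z powr (q - 1) = coord_a z powr (s - 1) * coord_a z ^ i"
        using a by (simp add: q_def powr_add[symmetric] powr_realpow[symmetric] algebra_simps)
      also have "\<dots> \<le> coord_a z powr (s - 1) * (2 * R) ^ i"
        using a a2 by (intro mult_left_mono power_mono) auto
      finally have 1: "C1 * coord_a z powr (q - 1) \<le> C1 * (coord_a z powr (s - 1) * (2 * R) ^ i)"
        using C1(1) by (rule mult_left_mono)
      have "\<bar>deriv (cut_powr \<epsilon> q) (coord_a z)\<bar> * norm (grad_a z) \<le> C1 * (coord_a z powr (s - 1) * (2 * R) ^ i) * norm (grad_a z)"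
        using C1(2)[OF \<epsilon> a] 1 by (intro mult_right_mono) auto
      also have "\<dots> = C2 * ((coord_a z powr (s - 1) * coord_a z powr (1 / 2)) * rho z powr (- (1 / 2)))"
        by (simp add: norm_grad_a[OF r] C2_def)
      also have "coord_a z powr (s - 1) * coord_a z powr (1 / 2) = coord_a z powr (s - 1 / 2)"
        by (simp add: powr_add[symmetric])
      finally show ?thesis by (simp add: X_def)
    qed
    have "norm (grad_test_term (cut_powr \<epsilon> q) j \<xi> p \<kappa> z) \<le>
        norm ((cut_powr \<epsilon> q (coord_a z) * coord_b z ^ j) *\<^sub>R grad_radial_term \<xi> p \<kappa> (deriv \<kappa>) z) +
        norm (radial_term \<xi> p \<kappa> z *\<^sub>R (cut_powr \<epsilon> q (coord_a z) *\<^sub>R ((real j * coord_b z ^ (j - 1)) *\<^sub>R grad_b z))) +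
        norm (radial_term \<xi> p \<kappa> z *\<^sub>R (coord_b z ^ j *\<^sub>R (deriv (cut_powr \<epsilon> q) (coord_a z) *\<^sub>R grad_a z)))"
      unfolding grad_test_term_def scaleR_add_right add.assoc[symmetric]
      by (intro order_trans[OF norm_triangle_ineq] add_right_mono norm_triangle_ineq)
    also have "\<dots> = \<bar>cut_powr \<epsilon> q (coord_a z)\<bar> * coord_b z ^ j * norm (grad_radial_term \<xi> p \<kappa> (deriv \<kappa>) z) +
        norm (radial_term \<xi> p \<kappa> z) * (\<bar>cut_powr \<epsilon> q (coord_a z)\<bar> * (real j * coord_b z ^ (j - 1) * norm (grad_b z))) +
        norm (radial_term \<xi> p \<kappa> z) * (coord_b z ^ j * (\<bar>deriv (cut_powr \<epsilon> q) (coord_a z)\<bar> * norm (grad_a z)))"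
      using coord_b_nonneg[of z] by (simp add: abs_mult)
    also have "\<dots> \<le> H * B * K2 + K1 * (H * (B' * 2)) + K1 * (B * (C2 * X))"
      by (intro add_mono mult_mono h b h' K1 K2 norm_grad_b[OF r] mult_nonneg_nonneg)
         (use nn K1 K2 X coord_b_nonneg[of z] in auto)
    also have "\<dots> \<le> C * (X + 1)"
    proof -
      have "0 \<le> H * B * K2 * X + K1 * (H * (B' * 2)) * X + K1 * (B * C2)" using nn K1 K2 X by simp
      then show ?thesis by (simp add: C_def algebra_simps)
    qed
    finally show ?thesis by (simp add: X_def)
  qed
  then show ?thesis using C unfolding q_def by blast
qed

section \<open>Integrability of the energy envelope\<close>

lemma loc_integrable_bound_AE:
  assumes "loc_integrable g" "f \<in> borel_measurable lebesgue" "AE z in lebesgue. \<bar>f z\<bar> \<le> \<bar>g z\<bar>"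
  shows "loc_integrable f"
  unfolding loc_integrable_def
proof
  fix r
  show "integrable lebesgue (\<lambda>z. indicator (cball 0 r) z * f z)"
  proof (rule Bochner_Integration.integrable_bound)
    show "integrable lebesgue (\<lambda>z. indicator (cball 0 r) z * g z)" using assms(1) by (simp add: loc_integrable_def)
    show "(\<lambda>z. indicator (cball 0 r) z * f z) \<in> borel_measurable lebesgue"
      by (intro borel_measurable_times assms borel_measurable_indicator) auto
    show "AE z in lebesgue. norm (indicator (cball 0 r) z * f z) \<le> norm (indicator (cball 0 r) z * g z)"
      using assms(3) by eventually_elim (auto simp: indicator_def)
  qed
qed

lemma loc_integrable_add: "loc_integrable f \<Longrightarrow> loc_integrable g \<Longrightarrow> loc_integrable (\<lambda>z. f z + g z)"
  by (simp add: loc_integrable_def distrib_left)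

lemma loc_integrable_cmult: "loc_integrable f \<Longrightarrow> loc_integrable (\<lambda>z. c * f z)"
  by (simp add: loc_integrable_def mult.left_commute)

lemma AE_y_last_neq_0: "AE z::'n::finite point in lebesgue. y_last z \<noteq> 0"
proof -
  have "negligible {z::'n point. z \<bullet> (0, 1, 0) = 0}"
    by (rule negligible_standard_hyperplane) (simp add: Basis_prod_def zero_prod_def)
  then have "AE z::'n point in lebesgue. z \<notin> {z. z \<bullet> (0, 1, 0) = 0}"
    using negligible_iff_null_sets AE_not_in by blast
  then show ?thesis by (simp add: inner_commute[of _ "(0, 1, 0)"] last_inner del: inner_Pair)
qed

lemma borel_measurable_rho: "(rho :: 'n::finite point \<Rightarrow> real) \<in> borel_measurable borel"
  and borel_measurable_coord_a: "(coord_a :: 'n::finite point \<Rightarrow> real) \<in> borel_measurable borel"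
  by (intro borel_measurable_continuous_onI continuous_intros)+

lemma borel_measurable_weight: "(weight a :: 'n::finite point \<Rightarrow> real) \<in> borel_measurable borel"
proof -
  have "open (half_space :: 'n point set)"
    unfolding half_space_def by (intro open_Collect_less continuous_intros)
  then show ?thesis unfolding weight_def[abs_def]
    by (intro borel_measurable_times borel_measurable_indicator powr_real_measurable borel_measurable_t_coord) auto
qed

text \<open>
  From \<open>a b = t\<^sup>2\<close> and \<open>b \<le> 2 \<rho>\<close> (resp. \<open>a \<le> 2 \<rho>\<close>) the left-hand side is at most a power of \<open>\<rho>\<close> times one
  of \<open>t\<close>, and \<open>\<rho> \<ge> sqrt (\<bar>y\<^sub>N\<bar> t)\<close> separates the variables.
\<close>
lemma envelope_bound:
  assumes s: "0 < s" "s < 1" and z: "t_coord z > 0" "y_last z \<noteq> 0"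
  shows "t_coord z powr (1 - 2 * s) * (coord_a z powr (2 * s - 1) / rho z) \<le>
    2 * ((if s \<le> 1 / 2 then \<bar>y_last z\<bar> powr (- s) else \<bar>y_last z\<bar> powr (s - 1)) *
      (if s \<le> 1 / 2 then t_coord z powr (s - 1) else t_coord z powr (- s)))"
proof -
  define t y r a where "t = t_coord z" and "y = \<bar>y_last z\<bar>" and "r = rho z" and "a = coord_a z"
  have pos: "t > 0" "y > 0" "r > 0" "a > 0" using z by (auto simp: t_def y_def r_def a_def rho_pos_iff coord_a_pos)
  have yr: "y \<le> r" and tr: "t \<le> r" and a2: "a \<le> 2 * r"
    using abs_y_le_rho[of z] abs_t_le_rho[of z] coord_a_le[of z] by (auto simp: t_def y_def r_def a_def)
  have abt: "t * t \<le> a * (2 * r)"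
    using coord_ab[of z] mult_left_mono[OF coord_b_le[of z] coord_a_nonneg[of z]]
    by (simp add: t_def a_def r_def power2_eq_square)
  show ?thesis
  proof (cases "s \<le> 1 / 2")
    case True
    \<comment> \<open>Here 2s - 1 <= 0, so a lower bound on a is required: a >= t^2 / (2
      rho).\<close>
    have "a powr (2 * s - 1) \<le> (t * t / (2 * r)) powr (2 * s - 1)"
      using pos abt True by (intro powr_mono2') (auto simp: field_simps)
    also have "\<dots> = (2 * r) powr (1 - 2 * s) * (t powr (2 * s - 1) * t powr (2 * s - 1))"
    proof -
      have "(2 * r) powr (1 - 2 * s) = inverse ((2 * r) powr (2 * s - 1))"
        unfolding powr_minus[symmetric] by simp
      moreover have "(t * t / (2 * r)) powr (2 * s - 1) = t powr (2 * s - 1) * t powr (2 * s - 1) / (2 * r) powr (2 * s - 1)"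
        using pos by (subst powr_divide) (auto simp: powr_mult)
      ultimately show ?thesis by (simp only: divide_inverse mult.commute)
    qed
    finally have "t powr (1 - 2 * s) * (a powr (2 * s - 1) / r) \<le>
        t powr (1 - 2 * s) * ((2 * r) powr (1 - 2 * s) * (t powr (2 * s - 1) * t powr (2 * s - 1)) / r)"
      using pos by (intro mult_left_mono divide_right_mono) auto
    also have "\<dots> = 2 powr (1 - 2 * s) * (r powr (1 - 2 * s) / r powr 1) * ((t powr (1 - 2 * s) * t powr (2 * s - 1)) * t powr (2 * s - 1))"
      using pos by (simp add: powr_mult)
    \<comment> \<open>The power rho^(-2s) is split evenly between y and t: the resulting exponents,
      -s and -s + (2s - 1) = s - 1, both exceed -1.\<close>
    also have "r powr (1 - 2 * s) / r powr 1 = r powr (- s) * r powr (- s)"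
      unfolding powr_diff[symmetric] powr_add[symmetric] by simp
    also have "t powr (1 - 2 * s) * t powr (2 * s - 1) = 1" using pos by (simp add: powr_add[symmetric])
    also have "2 powr (1 - 2 * s) * (r powr (- s) * r powr (- s)) * (1 * t powr (2 * s - 1)) \<le>
        2 powr 1 * (y powr (- s) * t powr (- s)) * (1 * t powr (2 * s - 1))"
    proof -
      have "2 powr (1 - 2 * s) \<le> 2 powr 1" using s by (intro powr_mono) auto
      moreover have "r powr (- s) \<le> y powr (- s)" "r powr (- s) \<le> t powr (- s)"
        using pos yr tr s by (auto intro!: powr_mono2')
      ultimately show ?thesis by (intro mult_mono order_refl) auto
    qed
    also have "\<dots> = 2 * (y powr (- s) * t powr (s - 1))"
      by (simp add: powr_add[symmetric])
    finally show ?thesis using True by (simp add: t_def y_def r_def a_def)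
  next
    case False
    \<comment> \<open>Here 2s - 1 is positive and the upper bound a <= 2 rho serves; the same even
      split gives the exponents s - 1 and -s.\<close>
    have "t powr (1 - 2 * s) * (a powr (2 * s - 1) / r) \<le> t powr (1 - 2 * s) * ((2 * r) powr (2 * s - 1) / r)"
      using pos a2 False by (intro mult_left_mono divide_right_mono powr_mono2) auto
    also have "\<dots> = 2 powr (2 * s - 1) * (r powr (2 * s - 1) / r powr 1) * t powr (1 - 2 * s)"
      using pos by (simp add: powr_mult)
    also have "r powr (2 * s - 1) / r powr 1 = r powr (s - 1) * r powr (s - 1)"
      unfolding powr_diff[symmetric] powr_add[symmetric] by simp
    also have "2 powr (2 * s - 1) * (r powr (s - 1) * r powr (s - 1)) * t powr (1 - 2 * s) \<le>
        2 powr 1 * (y powr (s - 1) * t powr (s - 1)) * t powr (1 - 2 * s)"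
    proof -
      have "2 powr (2 * s - 1) \<le> 2 powr 1" using s by (intro powr_mono) auto
      moreover have "r powr (s - 1) \<le> y powr (s - 1)" "r powr (s - 1) \<le> t powr (s - 1)"
        using pos yr tr s by (auto intro!: powr_mono2')
      ultimately show ?thesis by (intro mult_mono order_refl) auto
    qed
    also have "\<dots> = 2 * (y powr (s - 1) * t powr (- s))"
      by (simp add: powr_add[symmetric])
    finally show ?thesis using False by (simp add: t_def y_def r_def a_def)
  qed
qed

lemma loc_integrable_envelope:
  assumes s: "0 < s" "s < 1"
  shows "loc_integrable (\<lambda>z::'n::finite point. weight (1 - 2 * s) z * (coord_a z powr (2 * s - 1) / rho z + 1))"
proof -
  define g where "g x = (if s \<le> 1 / 2 then \<bar>x\<bar> powr (- s) else \<bar>x\<bar> powr (s - 1))" for x :: real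
  define h where "h x = (if s \<le> 1 / 2 then indicator {0<..} x * x powr (s - 1) else indicator {0<..} x * x powr (- s))" for x :: real
  have g: "loc_integrable g" "g \<in> borel_measurable borel" "\<And>x. g x \<ge> 0"
    unfolding g_def using loc_integrable_abs_powr[of "- s"] loc_integrable_abs_powr[of "s - 1"] s
    by (cases "s \<le> 1 / 2"; simp)+
  have h: "loc_integrable h" "h \<in> borel_measurable borel" "\<And>x. h x \<ge> 0"
    unfolding h_def using loc_integrable_powr[of "- s"] loc_integrable_powr[of "s - 1"] s
    by (cases "s \<le> 1 / 2"; simp)+
  have gh: "loc_integrable (\<lambda>z::'n point. 2 * (g (y_last z) * h (t_coord z)))"
    by (intro loc_integrable_cmult loc_integrable_product g h)
  have 1: "loc_integrable (\<lambda>z::'n point. weight (1 - 2 * s) z * (coord_a z powr (2 * s - 1) / rho z))"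
  proof (rule loc_integrable_bound_AE[OF gh])
    show "(\<lambda>z::'n point. weight (1 - 2 * s) z * (coord_a z powr (2 * s - 1) / rho z)) \<in> borel_measurable lebesgue"
      by (intro borel_measurable_lebesgueI borel_measurable_times borel_measurable_weight borel_measurable_divide
          powr_real_measurable borel_measurable_rho borel_measurable_coord_a) auto
    \<comment> \<open>The hyperplane y_N = 0 has to be left out: there \<open>powr\<close> returns 0
      and the product bound fails.\<close>
    show "AE z::'n point in lebesgue. \<bar>weight (1 - 2 * s) z * (coord_a z powr (2 * s - 1) / rho z)\<bar> \<le>
        \<bar>2 * (g (y_last z) * h (t_coord z))\<bar>"
      using AE_y_last_neq_0
    proof eventually_elim
      case (elim z)
      show ?case
      proof (cases "t_coord z > 0")
        case True
        from envelope_bound[OF s True elim] show ?thesis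
          using True g(3)[of "y_last z"] h(3)[of "t_coord z"] rho_nonneg[of z]
          by (simp add: weight_def half_space_def abs_mult g_def h_def split: if_splits)
      qed (simp add: weight_def half_space_def)
    qed
  qed
  show ?thesis
    using loc_integrable_add[OF 1 loc_integrable_weight[of "1 - 2 * s"]] s by (simp add: distrib_left)
qed

section \<open>Test functions\<close>

text \<open>
  The weighted Laplacian of \<open>hom_sol s k z * (\<xi> \<bullet> y')\<^sup>p * \<kappa> (\<bar>z\<bar>\<^sup>2)\<close>.
\<close>
definition test_rhs :: "real \<Rightarrow> nat \<Rightarrow> real ^ 'n \<Rightarrow> nat \<Rightarrow> (real \<Rightarrow> real) \<Rightarrow> 'n::finite point \<Rightarrow> real"
  where "test_rhs s k \<xi> p \<kappa> z = hom_sol s k z * (((\<xi>, 0, 0) \<bullet> z) ^ p *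
      (4 * (z \<bullet> z) * deriv (deriv \<kappa>) (z \<bullet> z) +
        (2 * real CARD('n) + 6 + 4 * real p + 4 * real k) * deriv \<kappa> (z \<bullet> z)) +
      real p * real (p - 1) * (\<xi> \<bullet> \<xi>) * ((\<xi>, 0, 0) \<bullet> z) ^ (p - 2) * \<kappa> (z \<bullet> z))"

text \<open>Every power of a is cut separately, so the function equals
  \<open>hom_sol s k z * radial_term \<xi> p \<kappa> z\<close> where a >= 2 epsilon and vanishes
  where a <= epsilon.\<close>

definition test_fun :: "real \<Rightarrow> real \<Rightarrow> nat \<Rightarrow> real ^ 'n \<Rightarrow> nat \<Rightarrow> (real \<Rightarrow> real) \<Rightarrow> 'n::finite point \<Rightarrow> real"
  where "test_fun \<epsilon> s k \<xi> p \<kappa> z =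
    (\<Sum>i\<le>k. hom_coeff s k i * test_term (cut_powr \<epsilon> (s + real i)) (k - i) \<xi> p \<kappa> z)"

lemma continuous_on_hom_sol: "s > 0 \<Longrightarrow> continuous_on S (hom_sol s k)"
  unfolding hom_sol_def[abs_def] ab_pow_def
  by (intro continuous_intros continuous_on_powr') (auto simp: coord_a_nonneg add_pos_nonneg)

lemma continuous_on_smooth_norm_sq:
  "smooth_fun \<kappa> \<Longrightarrow> continuous_on S (\<lambda>z::'a::euclidean_space. \<kappa> (z \<bullet> z))"
  by (rule continuous_on_compose2[OF smooth_fun_continuous[of \<kappa> UNIV]]) (auto intro!: continuous_intros)

context
  fixes s R :: real and k p :: nat and \<xi> :: "real ^ 'n::finite" and \<kappa> :: "real \<Rightarrow> real"
  assumes s: "0 < s" "s < 1" and \<kappa>: "smooth_fun \<kappa>" "\<And>v. v > R\<^sup>2 \<Longrightarrow> \<kappa> v = 0" and R: "R > 0"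
begin

lemma deriv_cutoff_eq_0: "v > R\<^sup>2 \<Longrightarrow> deriv \<kappa> v = 0"
  by (rule deriv_eq_0_open[of "{R\<^sup>2<..}" _ _ 0]) (auto simp: \<kappa>)

lemma deriv2_cutoff_eq_0: "v > R\<^sup>2 \<Longrightarrow> deriv (deriv \<kappa>) v = 0"
  by (rule deriv_eq_0_open[of "{R\<^sup>2<..}" _ _ 0]) (auto simp: deriv_cutoff_eq_0)

lemma test_rhs_eq_0: "norm z > R \<Longrightarrow> test_rhs s k \<xi> p \<kappa> z = 0"
proof -
  assume "norm z > R"
  then have "z \<bullet> z > R\<^sup>2" using R by (simp add: dot_square_norm power_strict_mono)
  then show ?thesis by (simp add: test_rhs_def \<kappa> deriv_cutoff_eq_0 deriv2_cutoff_eq_0)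
qed

lemma continuous_on_test_rhs: "continuous_on S (test_rhs s k \<xi> p \<kappa>)"
  unfolding test_rhs_def[abs_def]
  by (intro continuous_on_mult continuous_on_add continuous_on_power continuous_on_const continuous_on_inner
      continuous_on_id continuous_on_hom_sol continuous_on_smooth_norm_sq smooth_fun_deriv \<kappa> s)

lemma has_grad_on_test_fun:
  assumes "\<epsilon> > 0"
  shows "has_grad_on (test_fun \<epsilon> s k \<xi> p \<kappa>)
    (\<lambda>z. \<Sum>i\<le>k. hom_coeff s k i *\<^sub>R grad_test_term (cut_powr \<epsilon> (s + real i)) (k - i) \<xi> p \<kappa> z) UNIV"
  unfolding test_fun_def[abs_def]
  by (intro has_grad_on_sum_cmult has_grad_on_test_term[OF smooth_fun_cut_powr assms _ \<kappa>(1)] assms cut_powr_eq_0)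

lemma gradient_test_fun:
  assumes "\<epsilon> > 0"
  shows "gradient (test_fun \<epsilon> s k \<xi> p \<kappa>) z =
    (\<Sum>i\<le>k. hom_coeff s k i *\<^sub>R grad_test_term (cut_powr \<epsilon> (s + real i)) (k - i) \<xi> p \<kappa> z)"
  using has_grad_on_gradient[OF has_grad_on_test_fun[OF assms]] by simp

lemma C_infinity_test_fun: "\<epsilon> > 0 \<Longrightarrow> test_fun \<epsilon> s k \<xi> p \<kappa> \<in> C_infinity"
  unfolding test_fun_def[abs_def]
  by (intro C_infinity_sum_cmult C_infinity_test_term[OF smooth_fun_cut_powr _ cut_powr_eq_0 \<kappa>(1)])

lemma test_fun_eq_0_norm: "norm z > R \<Longrightarrow> test_fun \<epsilon> s k \<xi> p \<kappa> z = 0"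
  using radial_term_eq_0[of R \<kappa> z \<xi> p] \<kappa>(2) R by (simp add: test_fun_def test_term_def)

lemma test_fun_eq_0_a: "\<epsilon> > 0 \<Longrightarrow> coord_a z \<le> \<epsilon> \<Longrightarrow> test_fun \<epsilon> s k \<xi> p \<kappa> z = 0"
  by (simp add: test_fun_def test_term_def cut_powr_eq_0)

text \<open>The constant is chosen before epsilon, since epsilon will depend on the approximant of
  Psi. Squaring a^(s-1/2) rho^(-1/2) gives a^(2s-1) / rho, the function treated in
  \<open>loc_integrable_envelope\<close>.\<close>

lemma test_fun_energy:
  "\<exists>C\<ge>0. \<forall>\<epsilon>>0. \<forall>z. t_coord z > 0 \<longrightarrow> (norm (gradient (test_fun \<epsilon> s k \<xi> p \<kappa>) z))\<^sup>2 \<le>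
    C * (coord_a z powr (2 * s - 1) / rho z + 1)"
proof -
  have "\<forall>i. \<exists>C\<ge>0. \<forall>\<epsilon>>0. \<forall>z::'n point. t_coord z > 0 \<longrightarrow>
    norm (grad_test_term (cut_powr \<epsilon> (s + real i)) (k - i) \<xi> p \<kappa> z) \<le> C * (coord_a z powr (s - 1 / 2) * rho z powr (- (1 / 2)) + 1)"
    using grad_test_term_energy[OF s(1) \<kappa> R] by blast
  then obtain C where C: "\<And>i. C i \<ge> 0" "\<And>i \<epsilon> z. \<epsilon> > 0 \<Longrightarrow> t_coord (z::'n point) > 0 \<Longrightarrow>
    norm (grad_test_term (cut_powr \<epsilon> (s + real i)) (k - i) \<xi> p \<kappa> z) \<le> C i * (coord_a z powr (s - 1 / 2) * rho z powr (- (1 / 2)) + 1)"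
    by metis
  define D where "D = (\<Sum>i\<le>k. \<bar>hom_coeff s k i\<bar> * C i)"
  have D: "D \<ge> 0" using C(1) by (auto simp: D_def intro!: sum_nonneg)
  have "(norm (gradient (test_fun \<epsilon> s k \<xi> p \<kappa>) z))\<^sup>2 \<le> (2 * D\<^sup>2) * (coord_a z powr (2 * s - 1) / rho z + 1)"
    if \<epsilon>: "\<epsilon> > 0" and t: "t_coord z > 0" for \<epsilon> and z :: "'n point"
  proof -
    define X where "X = coord_a z powr (s - 1 / 2) * rho z powr (- (1 / 2))"
    have r: "rho z > 0" using t by (auto simp: rho_pos_iff)
    have "norm (gradient (test_fun \<epsilon> s k \<xi> p \<kappa>) z) \<le>
        (\<Sum>i\<le>k. norm (hom_coeff s k i *\<^sub>R grad_test_term (cut_powr \<epsilon> (s + real i)) (k - i) \<xi> p \<kappa> z))"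
      unfolding gradient_test_fun[OF \<epsilon>] by (rule norm_sum)
    also have "\<dots> \<le> (\<Sum>i\<le>k. \<bar>hom_coeff s k i\<bar> * (C i * (X + 1)))"
      unfolding norm_scaleR X_def by (intro sum_mono mult_left_mono C \<epsilon> t) auto
    also have "\<dots> = D * (X + 1)" by (simp add: D_def sum_distrib_right mult.assoc)
    finally have "(norm (gradient (test_fun \<epsilon> s k \<xi> p \<kappa>) z))\<^sup>2 \<le> (D * (X + 1))\<^sup>2"
      by (intro power_mono) auto
    also have "\<dots> = D\<^sup>2 * (X + 1)\<^sup>2" by (rule power_mult_distrib)
    also have "\<dots> \<le> D\<^sup>2 * (2 * (X\<^sup>2 + 1))"
    proof (intro mult_left_mono)
      have "0 \<le> (X - 1)\<^sup>2" by simp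
      then show "(X + 1)\<^sup>2 \<le> 2 * (X\<^sup>2 + 1)" by (simp add: power2_eq_square algebra_simps)
    qed simp
    also have "X\<^sup>2 = coord_a z powr (2 * s - 1) / rho z"
    proof -
      have "X\<^sup>2 = (coord_a z powr (s - 1 / 2) * coord_a z powr (s - 1 / 2)) * (rho z powr (- (1 / 2)) * rho z powr (- (1 / 2)))"
        by (simp only: X_def power2_eq_square mult_ac)
      also have "\<dots> = coord_a z powr (2 * s - 1) * rho z powr (- 1)"
        unfolding powr_add[symmetric] by simp
      finally show ?thesis using r by (simp add: powr_minus divide_inverse)
    qed
    finally show ?thesis by (simp only: mult.assoc mult.left_commute[of 2])
  qed
  then show ?thesis by (intro exI[of _ "2 * D\<^sup>2"]) auto
qed

text \<open>The truncation changes the function only where a < 2 epsilon, and phi vanishes there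
  inside the ball. So the truncated operator may be replaced by the untruncated
  \<open>test_rhs\<close> under the integral.\<close>

lemma test_fun_by_parts:
  assumes \<epsilon>: "\<epsilon> > 0" and \<phi>: "\<phi> \<in> C_infinity"
    and supp: "\<And>z. t_coord z > 0 \<Longrightarrow> norm z \<le> R \<Longrightarrow> coord_a z \<le> 2 * \<epsilon> \<Longrightarrow> \<phi> z = 0"
  shows "(\<integral>z. weight (1 - 2 * s) z * (gradient \<phi> z \<bullet> gradient (test_fun \<epsilon> s k \<xi> p \<kappa>) z) \<partial>lebesgue) =
    - (\<integral>z. weight (1 - 2 * s) z * (\<phi> z * test_rhs s k \<xi> p \<kappa> z) \<partial>lebesgue)"
proof -
  define \<Phi> where "\<Phi> = test_fun \<epsilon> s k \<xi> p \<kappa>"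
  define \<Theta> where "\<Theta> z = (\<Sum>i\<le>k. hom_coeff s k i * vert_test_term (cut_powr \<epsilon> (s + real i)) (k - i) \<xi> p \<kappa> z)" for z :: "'n point"
  have \<Phi>: "\<Phi> \<in> C_infinity" unfolding \<Phi>_def by (rule C_infinity_test_fun[OF \<epsilon>])
  have \<Theta>: "\<Theta> \<in> C_infinity"
    unfolding \<Theta>_def[abs_def]
    by (intro C_infinity_sum_cmult C_infinity_vert_test_term[OF smooth_fun_cut_powr[OF \<epsilon>] \<epsilon> cut_powr_eq_0[OF \<epsilon>] \<kappa>(1)])
  have vert: "gradient \<Phi> z \<bullet> (0, 0, 1) = t_coord z * \<Theta> z" for z
  proof -
    have "grad_test_term (cut_powr \<epsilon> (s + real i)) (k - i) \<xi> p \<kappa> z \<bullet> (0, 0, 1) =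
        t_coord z * vert_test_term (cut_powr \<epsilon> (s + real i)) (k - i) \<xi> p \<kappa> z" for i
      by (rule grad_test_term_vertical[OF smooth_fun_cut_powr[OF \<epsilon>] \<epsilon> cut_powr_eq_0[OF \<epsilon>] \<kappa>(1)])
    then show ?thesis
      unfolding \<Phi>_def gradient_test_fun[OF \<epsilon>] inner_sum_left inner_scaleR_left \<Theta>_def
      by (simp add: sum_distrib_left mult.left_commute del: inner_Pair)
  qed
  have \<Phi>0: "\<Phi> z = 0" if "norm z > R" for z using that by (simp add: \<Phi>_def test_fun_eq_0_norm)
  have \<Theta>0: "\<Theta> z = 0" if "norm z > R" for z
    using that radial_term_eq_0[of R \<kappa> z \<xi> p] radial_term_eq_0[of R "deriv \<kappa>" z \<xi> p] \<kappa>(2) R deriv_cutoff_eq_0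
    by (simp add: \<Theta>_def vert_test_term_def)
  define L where "L z = (\<Sum>b\<in>Basis - {(0, 0, 1)}. gradient (\<lambda>z. gradient \<Phi> z \<bullet> b) z \<bullet> b) +
        t_coord z * (gradient \<Theta> z \<bullet> (0, 0, 1)) + (1 + (1 - 2 * s)) * \<Theta> z" for z
  have eq: "weight (1 - 2 * s) z * (\<phi> z * L z) = weight (1 - 2 * s) z * (\<phi> z * test_rhs s k \<xi> p \<kappa> z)" for z
  proof -
    \<comment> \<open>Points outside the ball form a separate case because phi need not vanish
      there; kappa does the work instead.\<close>
    consider "\<not> t_coord z > 0" | "t_coord z > 0" "norm z > R" | "t_coord z > 0" "norm z \<le> R" "coord_a z \<le> 2 * \<epsilon>"
      | "t_coord z > 0" "coord_a z > 2 * \<epsilon>" by linarith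
    then show ?thesis
    proof cases
      case 1
      then show ?thesis by (simp add: weight_def half_space_def)
    next
      case 2
      have o: "open {z::'n point. t_coord z > 0 \<and> norm z > R}"
        by (intro open_Collect_conj open_Collect_less continuous_intros)
      have "L z = 0"
        unfolding L_def
        by (rule has_wlap_eq_operator[OF has_wlap_const[of _ 0] o _ _ _ \<Phi> \<Theta> vert]) (use 2 \<Phi>0 in auto)
      then show ?thesis using test_rhs_eq_0[OF 2(2)] by simp
    next
      case 3
      then show ?thesis using supp by simp
    next
      case 4
      have o: "open {z::'n point. t_coord z > 0 \<and> coord_a z > 2 * \<epsilon>}"
        by (intro open_Collect_conj open_Collect_less continuous_intros)
      have "L z = test_rhs s k \<xi> p \<kappa> z"
        unfolding L_def test_rhs_def
      proof (rule has_wlap_eq_operator[OF has_wlap_subset[OF has_wlap_hom_sol_radial_term[OF s(1)]] o _ _ _ \<Phi> \<Theta> vert])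
        show "(\<kappa> has_real_derivative deriv \<kappa> x) (at x)" "(deriv \<kappa> has_real_derivative deriv (deriv \<kappa>) x) (at x)" for x
          by (intro smooth_fun_DERIV smooth_fun_deriv \<kappa>)+
        fix z :: "'n point" assume "z \<in> {z. t_coord z > 0 \<and> coord_a z > 2 * \<epsilon>}"
        then show "\<Phi> z = hom_sol s k z * radial_term \<xi> p \<kappa> z"
          using \<epsilon> by (simp add: \<Phi>_def test_fun_def test_term_def hom_sol_def ab_pow_def cut_powr_eq sum_distrib_right mult.assoc)
      qed (use 4 in auto)
      then show ?thesis by simp
    qed
  qed
  have "- 1 < 1 - 2 * s" using s by simp
  from weighted_integration_by_parts[OF this \<phi> \<Phi> \<Theta> \<Phi>0 \<Theta>0 vert] show ?thesis
    unfolding L_def[symmetric] eq unfolding \<Phi>_def .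
qed

text \<open>Since a = 0 holds exactly on \<open>Gamma_plus\<close>, the compact set
  \<open>K\<close>, on which a >= epsilon, contains the support and avoids
  \<open>Gamma_plus\<close>.\<close>

lemma test_fun_Cc_infinity:
  assumes \<epsilon>: "\<epsilon> > 0"
  shows "test_fun \<epsilon> s k \<xi> p \<kappa> \<in> Cc_infinity (closure half_space - Gamma_plus)"
proof -
  define X where "X = closure (half_space :: 'n point set) - Gamma_plus"
  define K where "K = closure half_space \<inter> cball 0 R \<inter> {z :: 'n point. coord_a z \<ge> \<epsilon>}"
  have K: "compact K"
    unfolding K_def
    by (intro compact_Int_closed closed_Int_compact compact_cball closed_closure closed_Collect_le continuous_intros)
  have KX: "K \<subseteq> X"
  proof
    fix z assume z: "z \<in> K"
    have "z \<notin> Gamma_plus"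
      using z \<epsilon> coord_a_eq_0_iff[of z] by (auto simp: K_def Gamma_plus_def)
    with z show "z \<in> X" by (simp add: K_def X_def)
  qed
  have "{z \<in> X. test_fun \<epsilon> s k \<xi> p \<kappa> z \<noteq> 0} \<subseteq> K"
  proof
    fix z assume z: "z \<in> {z \<in> X. test_fun \<epsilon> s k \<xi> p \<kappa> z \<noteq> 0}"
    have "\<not> norm z > R" using test_fun_eq_0_norm[of z \<epsilon>] z by blast
    moreover have "\<not> coord_a z \<le> \<epsilon>" using test_fun_eq_0_a[OF \<epsilon>, of z] z by blast
    ultimately show "z \<in> K" using z by (simp add: K_def X_def)
  qed
  then have sub: "closure {z \<in> X. test_fun \<epsilon> s k \<xi> p \<kappa> z \<noteq> 0} \<subseteq> K"
    using K compact_imp_closed by (intro closure_minimal)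
  moreover have "compact (closure {z \<in> X. test_fun \<epsilon> s k \<xi> p \<kappa> z \<noteq> 0})"
    using compact_Int_closed[OF K closed_closure, of "{z \<in> X. test_fun \<epsilon> s k \<xi> p \<kappa> z \<noteq> 0}"] sub
    by (simp only: Int_absorb1)
  ultimately show ?thesis
    using KX C_infinity_test_fun[OF \<epsilon>] unfolding Cc_infinity_def X_def[symmetric] by blast
qed

end

text \<open>On the compact support of phi within the closed ball of radius R, a is positive and
  hence bounded below. Shrinking to R < r matters: \<open>Gamma_plus_r r\<close> omits the points of
  \<open>Gamma_plus\<close> at distance r, which the support may contain.\<close>

lemma Cc_infinity_away_from_Gamma:
  assumes \<phi>: "\<phi> \<in> Cc_infinity (closure (half_ball r) - Gamma_plus_r r)" and R: "0 < R" "R < r"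
  shows "\<exists>\<epsilon>>0. \<forall>z::'n::finite point. t_coord z > 0 \<longrightarrow> norm z \<le> R \<longrightarrow> coord_a z \<le> 2 * \<epsilon> \<longrightarrow> \<phi> z = 0"
proof -
  define X where "X = closure (half_ball r :: 'n point set) - Gamma_plus_r r"
  define S where "S = closure {z \<in> X. \<phi> z \<noteq> 0} \<inter> cball 0 R"
  have SX: "closure {z \<in> X. \<phi> z \<noteq> 0} \<subseteq> X" and "compact (closure {z \<in> X. \<phi> z \<noteq> 0})"
    using \<phi> by (auto simp: Cc_infinity_def X_def)
  then have S: "compact S" unfolding S_def by (intro compact_Int_closed) auto
  have pos: "coord_a z > 0" if z: "z \<in> S" for z
  proof (rule ccontr)
    assume "\<not> coord_a z > 0"
    then have "coord_a z = 0" using coord_a_nonneg[of z] by linarith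
    then have g: "z \<in> Gamma_plus" by (auto simp: coord_a_eq_0_iff Gamma_plus_def)
    have "norm (fst z, fst (snd z)) \<le> norm z"
      by (cases z) (auto simp: norm_prod_def real_sqrt_le_iff)
    then have "z \<in> Gamma_plus_r r"
      using z R g by (cases z) (auto simp: S_def Gamma_plus_r_def)
    with z SX show False by (auto simp: S_def X_def)
  qed
  have mem: "z \<in> S" if "t_coord z > 0" "norm z \<le> R" "\<phi> z \<noteq> 0" for z
  proof -
    have "z \<in> half_ball r" using that R by (simp add: half_ball_def half_space_def)
    then have "z \<in> X"
      using that closure_subset[of "half_ball r :: 'n point set"] by (auto simp: X_def Gamma_plus_r_def Gamma_plus_def)
    with that show ?thesis
      using closure_subset[of "{z \<in> X. \<phi> z \<noteq> 0}"] by (auto simp: S_def)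
  qed
  show ?thesis
  proof (cases "S = {}")
    case True
    have "\<phi> z = 0" if "t_coord z > 0" "norm z \<le> R" for z
      using mem[OF that] True by blast
    then show ?thesis by (intro exI[of _ 1] conjI zero_less_one) blast
  next
    case False
    obtain z0 where z0: "z0 \<in> S" "\<And>z. z \<in> S \<Longrightarrow> coord_a z0 \<le> coord_a z"
      using continuous_attains_inf[OF S False, of coord_a] continuous_on_coord_a[OF continuous_on_id] by blast
    show ?thesis
    \<comment> \<open>A quarter of the minimum: then 2 epsilon is half the minimum, strictly below
      it.\<close>
    proof (intro exI[of _ "coord_a z0 / 4"] conjI allI impI)
      show "coord_a z0 / 4 > 0" using pos[OF z0(1)] by simp
      fix z :: "'n point" assume "t_coord z > 0" "norm z \<le> R" "coord_a z \<le> 2 * (coord_a z0 / 4)"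
      note z = this
      show "\<phi> z = 0"
      proof (rule ccontr)
        assume "\<phi> z \<noteq> 0"
        from z0(2)[OF mem[OF z(1,2) this]] z(3) pos[OF z0(1)] show False by linarith
      qed
    qed
  qed
qed

section \<open>The very weak equation for the homogeneous solutions\<close>

lemma integral_bound_by_sum:
  fixes f u v :: "'a \<Rightarrow> real"
  assumes "integrable M u" "integrable M v" "f \<in> borel_measurable M" "\<And>z. \<bar>f z\<bar> \<le> u z + v z"
  shows "integrable M f" "\<bar>\<integral>z. f z \<partial>M\<bar> \<le> (\<integral>z. u z \<partial>M) + (\<integral>z. v z \<partial>M)"
proof -
  have uv: "integrable M (\<lambda>z. u z + v z)" using assms by simp
  show f: "integrable M f"
  proof (rule Bochner_Integration.integrable_bound[OF uv assms(3)])
    have "norm (f z) \<le> norm (u z + v z)" for z using assms(4)[of z] by simp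
    then show "AE z in M. norm (f z) \<le> norm (u z + v z)" by simp
  qed
  have "\<bar>\<integral>z. f z \<partial>M\<bar> \<le> (\<integral>z. \<bar>f z\<bar> \<partial>M)" by (rule integral_abs_bound)
  also have "\<dots> \<le> (\<integral>z. u z + v z \<partial>M)" using f uv assms(4) by (intro integral_mono) auto
  finally show "\<bar>\<integral>z. f z \<partial>M\<bar> \<le> (\<integral>z. u z \<partial>M) + (\<integral>z. v z \<partial>M)" using assms by simp
qed

text \<open>Young's inequality with a parameter, in place of Cauchy-Schwarz for the weighted space:
  once the approximation error has tended to 0 for fixed c, c is sent to 0.\<close>

lemma AM_GM_scaled:
  fixes x y :: real
  assumes "c > 0" shows "\<bar>x * y\<bar> \<le> y\<^sup>2 / c + c * x\<^sup>2"
proof -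
  have "0 \<le> (\<bar>y\<bar> - c * \<bar>x\<bar>)\<^sup>2" by simp
  then have "2 * c * (\<bar>x\<bar> * \<bar>y\<bar>) \<le> y\<^sup>2 + c\<^sup>2 * x\<^sup>2"
    by (simp add: power2_diff power_mult_distrib algebra_simps)
  moreover have "c * (\<bar>x\<bar> * \<bar>y\<bar>) \<ge> 0" using assms by simp
  ultimately have "c * (\<bar>x\<bar> * \<bar>y\<bar>) \<le> y\<^sup>2 + c\<^sup>2 * x\<^sup>2" by linarith
  then have "\<bar>x\<bar> * \<bar>y\<bar> \<le> (y\<^sup>2 + c\<^sup>2 * x\<^sup>2) / c" using assms by (simp add: le_divide_eq mult.commute)
  also have "\<dots> = y\<^sup>2 / c + c * x\<^sup>2" using assms by (simp add: add_divide_distrib power2_eq_square)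
  finally show ?thesis by (simp add: abs_mult)
qed

lemma half_ball_lebesgue: "(half_ball r :: 'n::finite point set) \<in> sets lebesgue"
proof -
  have "half_ball r = {z::'n point. t_coord z > 0} \<inter> {z. norm z < r}" by (auto simp: half_ball_def half_space_def)
  moreover have "open ({z::'n point. t_coord z > 0} \<inter> {z. norm z < r})"
    by (intro open_Int open_Collect_less continuous_intros)
  ultimately show ?thesis by simp
qed

definition H1_err :: "real \<Rightarrow> real \<Rightarrow> ('n::finite point \<Rightarrow> real) \<Rightarrow> ('n point \<Rightarrow> real) \<Rightarrow> ('n point \<Rightarrow> 'n point) \<Rightarrow> 'n point \<Rightarrow> real"
  where "H1_err s r \<phi> \<Psi> G z = indicator (half_ball r) z * (weight (1 - 2 * s) z *
    ((\<phi> z - \<Psi> z)\<^sup>2 + (norm (gradient \<phi> z - G z))\<^sup>2))"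

lemma H1_err_nonneg: "H1_err s r \<phi> \<Psi> G z \<ge> 0"
  by (simp add: H1_err_def weight_nonneg)

lemma H1_dist2_eq: "H1_dist2 s r \<phi> (\<Psi>, G) = (\<integral>\<^sup>+z. ennreal (H1_err s r \<phi> \<Psi> G z) \<partial>lebesgue)"
  unfolding H1_dist2_def
  by (intro nn_integral_cong) (auto simp: H1_err_def weight_def half_ball_def split: split_indicator)

context
  fixes s r R :: real and \<Psi> :: "'n::finite point \<Rightarrow> real" and G :: "'n point \<Rightarrow> 'n point"
  assumes s: "0 < s" "s < 1" and R: "0 < R" "R < r"
    and \<Psi>m: "\<Psi> \<in> borel_measurable (lebesgue_on (half_ball r))"
    and Gm: "G \<in> borel_measurable (lebesgue_on (half_ball r))"
begin

lemma indicator_\<Psi>_measurable: "(\<lambda>z. indicator (half_ball r) z * \<Psi> z) \<in> borel_measurable lebesgue"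
  using \<Psi>m half_ball_lebesgue[of r] by (subst (asm) borel_measurable_restrict_space_iff) auto

lemma indicator_G_measurable: "(\<lambda>z. indicator (half_ball r) z *\<^sub>R G z) \<in> borel_measurable lebesgue"
  using Gm half_ball_lebesgue[of r] by (subst (asm) borel_measurable_restrict_space_iff) auto

text \<open>Psi is measurable on the half-ball only. The support of \<open>g\<close> lies within
  radius R < r, so the extension by zero can be substituted.\<close>

lemma weight_\<Psi>_eq:
  assumes "\<And>z. norm z > R \<Longrightarrow> g z = 0"
  shows "weight a z * (\<Psi> z * g z) = weight a z * ((indicator (half_ball r) z * \<Psi> z) * g z)"
  using assms[of z] R by (cases "norm z > R") (auto simp: weight_def half_ball_def split: split_indicator)

lemma weight_G_eq:
  assumes "\<And>z. norm z > R \<Longrightarrow> g z = 0"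
  shows "weight a z * (G z \<bullet> g z) = weight a z * ((indicator (half_ball r) z *\<^sub>R G z) \<bullet> g z)"
  using assms[of z] R by (cases "norm z > R") (auto simp: weight_def half_ball_def split: split_indicator)

lemma weight_\<Psi>_measurable:
  assumes "\<And>z. norm z > R \<Longrightarrow> g z = 0" "g \<in> borel_measurable lebesgue"
  shows "(\<lambda>z. weight a z * (\<Psi> z * g z)) \<in> borel_measurable lebesgue"
  by (subst weight_\<Psi>_eq[OF assms(1)], assumption, rule borel_measurable_times[OF borel_measurable_lebesgueI[OF borel_measurable_weight]
      borel_measurable_times[OF indicator_\<Psi>_measurable assms(2)]])

lemma weight_G_measurable:
  assumes "\<And>z. norm z > R \<Longrightarrow> g z = 0" "g \<in> borel_measurable lebesgue"
  shows "(\<lambda>z. weight a z * (G z \<bullet> g z)) \<in> borel_measurable lebesgue"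
  by (subst weight_G_eq[OF assms(1)], assumption, rule borel_measurable_times[OF borel_measurable_lebesgueI[OF borel_measurable_weight]
      borel_measurable_inner[OF indicator_G_measurable assms(2)]])

lemma integrable_err:
  assumes "\<phi> \<in> C_infinity" "H1_dist2 s r \<phi> (\<Psi>, G) < \<infinity>"
  shows "integrable lebesgue (H1_err s r \<phi> \<Psi> G)" "ennreal (\<integral>z. H1_err s r \<phi> \<Psi> G z \<partial>lebesgue) = H1_dist2 s r \<phi> (\<Psi>, G)"
proof -
  have "H1_err s r \<phi> \<Psi> G = (\<lambda>z. indicator (half_ball r) z * (weight (1 - 2 * s) z *
      ((\<phi> z - indicator (half_ball r) z * \<Psi> z)\<^sup>2 + (norm (gradient \<phi> z - indicator (half_ball r) z *\<^sub>R G z))\<^sup>2)))"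
    by (auto simp: H1_err_def fun_eq_iff split: split_indicator)
  moreover have "\<dots> \<in> borel_measurable lebesgue"
  proof -
    have "\<phi> \<in> borel_measurable lebesgue" "gradient \<phi> \<in> borel_measurable lebesgue"
      using assms(1) by (auto intro!: borel_measurable_lebesgueI[OF borel_measurable_continuous_onI]
          C_infinity_continuous C_infinity_gradient_continuous)
    note m = borel_measurable_diff[OF this(1) indicator_\<Psi>_measurable] borel_measurable_diff[OF this(2) indicator_G_measurable]
    show ?thesis
      by (intro borel_measurable_times borel_measurable_add borel_measurable_power m(1)
          measurable_compose[OF m(2) borel_measurable_norm] borel_measurable_indicator half_ball_lebesgue borel_measurable_lebesgueI[OF borel_measurable_weight])
  qed
  ultimately have m: "H1_err s r \<phi> \<Psi> G \<in> borel_measurable lebesgue" by simp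
  show i: "integrable lebesgue (H1_err s r \<phi> \<Psi> G)"
    using assms(2) m by (intro integrableI_nonneg) (auto simp: H1_err_nonneg H1_dist2_eq)
  show "ennreal (\<integral>z. H1_err s r \<phi> \<Psi> G z \<partial>lebesgue) = H1_dist2 s r \<phi> (\<Psi>, G)"
    using nn_integral_eq_integral[OF i AE_I2[OF H1_err_nonneg]] by (simp add: H1_dist2_eq)
qed

lemma weight_difference_bounds:
  assumes \<phi>: "\<phi> \<in> C_infinity" "H1_dist2 s r \<phi> (\<Psi>, G) < \<infinity>" and c: "c > 0"
    and g: "\<And>z. norm z > R \<Longrightarrow> g z = 0" "g \<in> borel_measurable lebesgue"
      "integrable lebesgue (\<lambda>z. weight (1 - 2 * s) z * (g z)\<^sup>2)"
  shows "integrable lebesgue (\<lambda>z. weight (1 - 2 * s) z * ((\<phi> z - \<Psi> z) * g z))"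
    and "\<bar>\<integral>z. weight (1 - 2 * s) z * ((\<phi> z - \<Psi> z) * g z) \<partial>lebesgue\<bar> \<le>
      (\<integral>z. H1_err s r \<phi> \<Psi> G z \<partial>lebesgue) / c + c * (\<integral>z. weight (1 - 2 * s) z * (g z)\<^sup>2 \<partial>lebesgue)"
proof -
  let ?w = "weight (1 - 2 * s)"
  have u: "integrable lebesgue (\<lambda>z. H1_err s r \<phi> \<Psi> G z / c)" using integrable_err[OF \<phi>] by simp
  have v: "integrable lebesgue (\<lambda>z. c * (?w z * (g z)\<^sup>2))" using g(3) by simp
  have "(\<lambda>z. ?w z * (\<phi> z * g z) - ?w z * (\<Psi> z * g z)) \<in> borel_measurable lebesgue"
    by (intro borel_measurable_diff weight_\<Psi>_measurable g borel_measurable_times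
        borel_measurable_lebesgueI[OF borel_measurable_weight]
        borel_measurable_lebesgueI[OF borel_measurable_continuous_onI] C_infinity_continuous \<phi>)
  then have m: "(\<lambda>z. ?w z * ((\<phi> z - \<Psi> z) * g z)) \<in> borel_measurable lebesgue"
    by (simp add: algebra_simps)
  have b: "\<bar>?w z * ((\<phi> z - \<Psi> z) * g z)\<bar> \<le> H1_err s r \<phi> \<Psi> G z / c + c * (?w z * (g z)\<^sup>2)" for z
  proof (cases "norm z > R")
    case True
    then show ?thesis using g(1)[OF True] H1_err_nonneg[of s r \<phi> \<Psi> G z] c by simp
  next
    case False
    have "\<bar>?w z * ((\<phi> z - \<Psi> z) * g z)\<bar> = ?w z * \<bar>g z * (\<phi> z - \<Psi> z)\<bar>"
      by (simp add: abs_mult weight_nonneg mult.commute)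
    also have "\<dots> \<le> ?w z * ((\<phi> z - \<Psi> z)\<^sup>2 / c + c * (g z)\<^sup>2)"
      by (intro mult_left_mono AM_GM_scaled c weight_nonneg)
    also have "\<dots> = ?w z * (\<phi> z - \<Psi> z)\<^sup>2 / c + c * (?w z * (g z)\<^sup>2)" by (simp add: algebra_simps)
    also have "?w z * (\<phi> z - \<Psi> z)\<^sup>2 / c \<le> H1_err s r \<phi> \<Psi> G z / c"
      using False R c by (intro divide_right_mono)
        (auto simp: H1_err_def weight_def half_ball_def mult_left_mono split: split_indicator)
    finally show ?thesis by simp
  qed
  show "integrable lebesgue (\<lambda>z. ?w z * ((\<phi> z - \<Psi> z) * g z))"
    by (rule integral_bound_by_sum(1)[OF u v m b])
  show "\<bar>\<integral>z. ?w z * ((\<phi> z - \<Psi> z) * g z) \<partial>lebesgue\<bar> \<le>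
      (\<integral>z. H1_err s r \<phi> \<Psi> G z \<partial>lebesgue) / c + c * (\<integral>z. ?w z * (g z)\<^sup>2 \<partial>lebesgue)"
    using integral_bound_by_sum(2)[OF u v m b] by simp
qed

lemma weight_gradient_difference_bounds:
  assumes \<phi>: "\<phi> \<in> C_infinity" "H1_dist2 s r \<phi> (\<Psi>, G) < \<infinity>" and c: "c > 0"
    and g: "\<And>z. norm z > R \<Longrightarrow> g z = 0" "g \<in> borel_measurable lebesgue"
      "integrable lebesgue (\<lambda>z. weight (1 - 2 * s) z * (norm (g z))\<^sup>2)"
  shows "integrable lebesgue (\<lambda>z. weight (1 - 2 * s) z * ((gradient \<phi> z - G z) \<bullet> g z))"
    and "\<bar>\<integral>z. weight (1 - 2 * s) z * ((gradient \<phi> z - G z) \<bullet> g z) \<partial>lebesgue\<bar> \<le>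
      (\<integral>z. H1_err s r \<phi> \<Psi> G z \<partial>lebesgue) / c + c * (\<integral>z. weight (1 - 2 * s) z * (norm (g z))\<^sup>2 \<partial>lebesgue)"
proof -
  let ?w = "weight (1 - 2 * s)"
  have u: "integrable lebesgue (\<lambda>z. H1_err s r \<phi> \<Psi> G z / c)" using integrable_err[OF \<phi>] by simp
  have v: "integrable lebesgue (\<lambda>z. c * (?w z * (norm (g z))\<^sup>2))" using g(3) by simp
  have "(\<lambda>z. ?w z * (gradient \<phi> z \<bullet> g z) - ?w z * (G z \<bullet> g z)) \<in> borel_measurable lebesgue"
    by (intro borel_measurable_diff weight_G_measurable g borel_measurable_times borel_measurable_inner
        borel_measurable_lebesgueI[OF borel_measurable_weight]
        borel_measurable_lebesgueI[OF borel_measurable_continuous_onI] C_infinity_gradient_continuous \<phi>)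
  then have m: "(\<lambda>z. ?w z * ((gradient \<phi> z - G z) \<bullet> g z)) \<in> borel_measurable lebesgue"
    by (simp add: inner_diff_left right_diff_distrib)
  have b: "\<bar>?w z * ((gradient \<phi> z - G z) \<bullet> g z)\<bar> \<le> H1_err s r \<phi> \<Psi> G z / c + c * (?w z * (norm (g z))\<^sup>2)" for z
  proof (cases "norm z > R")
    case True
    then show ?thesis using g(1)[OF True] H1_err_nonneg[of s r \<phi> \<Psi> G z] c by simp
  next
    case False
    have "\<bar>?w z * ((gradient \<phi> z - G z) \<bullet> g z)\<bar> = ?w z * \<bar>(gradient \<phi> z - G z) \<bullet> g z\<bar>"
      by (simp add: abs_mult weight_nonneg)
    also have "\<dots> \<le> ?w z * \<bar>norm (g z) * norm (gradient \<phi> z - G z)\<bar>"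
      using Cauchy_Schwarz_ineq2[of "gradient \<phi> z - G z" "g z"]
      by (intro mult_left_mono weight_nonneg) (simp add: mult.commute)
    also have "\<dots> \<le> ?w z * ((norm (gradient \<phi> z - G z))\<^sup>2 / c + c * (norm (g z))\<^sup>2)"
      by (intro mult_left_mono AM_GM_scaled c weight_nonneg)
    also have "\<dots> = ?w z * (norm (gradient \<phi> z - G z))\<^sup>2 / c + c * (?w z * (norm (g z))\<^sup>2)" by (simp add: algebra_simps)
    also have "?w z * (norm (gradient \<phi> z - G z))\<^sup>2 / c \<le> H1_err s r \<phi> \<Psi> G z / c"
      using False R c by (intro divide_right_mono)
        (auto simp: H1_err_def weight_def half_ball_def mult_left_mono split: split_indicator)
    finally show ?thesis by simp
  qed
  show "integrable lebesgue (\<lambda>z. ?w z * ((gradient \<phi> z - G z) \<bullet> g z))"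
    by (rule integral_bound_by_sum(1)[OF u v m b])
  show "\<bar>\<integral>z. ?w z * ((gradient \<phi> z - G z) \<bullet> g z) \<partial>lebesgue\<bar> \<le>
      (\<integral>z. H1_err s r \<phi> \<Psi> G z \<partial>lebesgue) / c + c * (\<integral>z. ?w z * (norm (g z))\<^sup>2 \<partial>lebesgue)"
    using integral_bound_by_sum(2)[OF u v m b] by simp
qed

lemma weight_smooth_integrable:
  fixes g :: "'n point \<Rightarrow> real"
  assumes "continuous_on UNIV g" "\<And>z. norm z > R \<Longrightarrow> g z = 0"
  shows "integrable lebesgue (\<lambda>z. weight (1 - 2 * s) z * g z)"
proof -
  obtain B where B: "\<And>z. norm (g z) \<le> B" using continuous_compact_support_bounded[OF assms] by blast
  have "- 1 < 1 - 2 * s" using s by simp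
  then show ?thesis
    using B assms by (intro loc_integrable_mult[OF loc_integrable_weight, where B = B and R = R]
        borel_measurable_lebesgueI borel_measurable_continuous_onI) auto
qed

text \<open>Psi g is phi g minus (phi - Psi) g: the first part is continuous with bounded support,
  the second is controlled by the finite distance to phi.\<close>

lemma weight_\<Psi>_integrable:
  assumes \<phi>: "\<phi> \<in> C_infinity" "H1_dist2 s r \<phi> (\<Psi>, G) < \<infinity>"
    and g: "continuous_on UNIV g" "\<And>z. norm z > R \<Longrightarrow> g z = 0"
  shows "integrable lebesgue (\<lambda>z. weight (1 - 2 * s) z * (\<Psi> z * g z))"
proof -
  have "integrable lebesgue (\<lambda>z. weight (1 - 2 * s) z * (\<phi> z * g z))"
    using g(2) by (intro weight_smooth_integrable continuous_intros C_infinity_continuous[OF \<phi>(1)] g(1)) auto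
  moreover have "integrable lebesgue (\<lambda>z. weight (1 - 2 * s) z * ((\<phi> z - \<Psi> z) * g z))"
    using g by (intro weight_difference_bounds(1)[OF \<phi> zero_less_one] weight_smooth_integrable
        borel_measurable_lebesgueI[OF borel_measurable_continuous_onI] continuous_intros) auto
  ultimately have "integrable lebesgue (\<lambda>z. weight (1 - 2 * s) z * (\<phi> z * g z) - weight (1 - 2 * s) z * ((\<phi> z - \<Psi> z) * g z))"
    by simp
  then show ?thesis by (simp add: algebra_simps)
qed

text \<open>
  The smooth approximants of \<open>\<Psi>\<close> vanish near \<open>\<Gamma>\<^sup>+\<close>, so for each of them the truncation of the test function
  can be removed exactly. The truncation parameter depends on the approximant, but only the uniform
  energy bound of the truncated test functions enters the limit.
\<close>
lemma weak_identity:
  fixes \<xi> :: "real ^ 'n" and \<kappa> :: "real \<Rightarrow> real"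
  assumes \<phi>: "\<And>j::nat. \<phi> j \<in> Cc_infinity (closure (half_ball r) - Gamma_plus_r r)"
    and lim: "(\<lambda>j. H1_dist2 s r (\<phi> j) (\<Psi>, G)) \<longlonglongrightarrow> 0"
    and weak: "\<And>\<Phi>. \<Phi> \<in> Cc_infinity (closure half_space - Gamma_plus) \<Longrightarrow>
      (\<integral>z. weight (1 - 2 * s) z * (G z \<bullet> gradient \<Phi> z) \<partial>lebesgue) = 0"
    and \<kappa>: "smooth_fun \<kappa>" "\<And>v. v > R\<^sup>2 \<Longrightarrow> \<kappa> v = 0"
  shows "(\<integral>z. weight (1 - 2 * s) z * (\<Psi> z * test_rhs s k \<xi> p \<kappa> z) \<partial>lebesgue) = 0"
proof -
  let ?w = "weight (1 - 2 * s)"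
  define L where "L = test_rhs s k \<xi> p \<kappa>"
  define I where "I = (\<integral>z. ?w z * (\<Psi> z * L z) \<partial>lebesgue)"
  have L: "continuous_on UNIV L" "\<And>z. norm z > R \<Longrightarrow> L z = 0"
    unfolding L_def using continuous_on_test_rhs[OF s \<kappa> R(1)] test_rhs_eq_0[OF s \<kappa> R(1)] by auto
  obtain E where E: "E \<ge> 0" "\<And>\<epsilon> z. \<epsilon> > 0 \<Longrightarrow> t_coord (z::'n point) > 0 \<Longrightarrow>
      (norm (gradient (test_fun \<epsilon> s k \<xi> p \<kappa>) z))\<^sup>2 \<le> E * (coord_a z powr (2 * s - 1) / rho z + 1)"
    using test_fun_energy[OF s \<kappa> R(1), of k \<xi> p] by blast
  define V where "V z = E * (indicator (cball 0 R) z * (?w z * (coord_a z powr (2 * s - 1) / rho z + 1)))" for z :: "'n point"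
  have V: "integrable lebesgue V"
    using loc_integrable_envelope[OF s] unfolding V_def loc_integrable_def by (intro integrable_mult_right) blast
  define C where "C = (\<integral>z. ?w z * (L z)\<^sup>2 \<partial>lebesgue) + (\<integral>z. V z \<partial>lebesgue)"
  have Lsq: "integrable lebesgue (\<lambda>z. ?w z * (L z)\<^sup>2)"
    using L by (intro weight_smooth_integrable continuous_intros) auto
  have Lm: "L \<in> borel_measurable lebesgue"
    by (intro borel_measurable_lebesgueI borel_measurable_continuous_onI L)
  have \<phi>C: "\<phi> j \<in> C_infinity" for j using \<phi>[of j] by (simp add: Cc_infinity_def)
  \<comment> \<open>\<open>C\<close> depends neither on \<open>j\<close> nor on the truncation
    parameter, so j tends to infinity first and c to 0 afterwards.\<close>
  have main: "\<bar>I\<bar> \<le> 2 * (\<integral>z. H1_err s r (\<phi> j) \<Psi> G z \<partial>lebesgue) / c + c * C"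
    if fin: "H1_dist2 s r (\<phi> j) (\<Psi>, G) < \<infinity>" and c: "c > 0" for j c
  proof -
    obtain \<epsilon> where \<epsilon>: "\<epsilon> > 0" "\<And>z. t_coord z > 0 \<Longrightarrow> norm z \<le> R \<Longrightarrow> coord_a z \<le> 2 * \<epsilon> \<Longrightarrow> \<phi> j z = 0"
      using Cc_infinity_away_from_Gamma[OF \<phi> R] by blast
    define g where "g = gradient (test_fun \<epsilon> s k \<xi> p \<kappa>)"
    have \<Phi>C: "test_fun \<epsilon> s k \<xi> p \<kappa> \<in> C_infinity" by (rule C_infinity_test_fun[OF s \<kappa> R(1) \<epsilon>(1)])
    have g0: "g z = 0" if "norm z > R" for z
      unfolding g_def using test_fun_eq_0_norm[OF s \<kappa> R(1)] that by (rule gradient_eq_0_outside)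
    have gc: "continuous_on UNIV g" unfolding g_def by (rule C_infinity_gradient_continuous[OF \<Phi>C])
    have gm: "g \<in> borel_measurable lebesgue"
      by (intro borel_measurable_lebesgueI borel_measurable_continuous_onI gc)
    have gsq: "integrable lebesgue (\<lambda>z. ?w z * (norm (g z))\<^sup>2)"
      using g0 by (intro weight_smooth_integrable continuous_intros gc) auto
    have gV: "(\<integral>z. ?w z * (norm (g z))\<^sup>2 \<partial>lebesgue) \<le> (\<integral>z. V z \<partial>lebesgue)"
    proof (rule integral_mono[OF gsq V])
      fix z :: "'n point"
      show "?w z * (norm (g z))\<^sup>2 \<le> V z"
      proof (cases "norm z > R \<or> \<not> t_coord z > 0")
        case True
        then show ?thesis using g0[of z] E(1) rho_nonneg[of z]
          by (auto simp: V_def weight_def half_space_def)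
      next
        case False
        then have "?w z * (norm (g z))\<^sup>2 \<le> ?w z * (E * (coord_a z powr (2 * s - 1) / rho z + 1))"
          unfolding g_def by (intro mult_left_mono E \<epsilon> weight_nonneg) auto
        then show ?thesis using False by (simp add: V_def mult.left_commute)
      qed
    qed
    have i1: "integrable lebesgue (\<lambda>z. ?w z * (\<phi> j z * L z))"
      using L(2) by (intro weight_smooth_integrable continuous_intros C_infinity_continuous[OF \<phi>C] L(1)) auto
    have i2: "integrable lebesgue (\<lambda>z. ?w z * (gradient (\<phi> j) z \<bullet> g z))"
      using g0 by (intro weight_smooth_integrable continuous_intros C_infinity_gradient_continuous \<phi>C gc) auto
    note d1 = weight_difference_bounds[OF \<phi>C fin c L(2) Lm Lsq]
    note d2 = weight_gradient_difference_bounds[OF \<phi>C fin c g0 gm gsq]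
    \<comment> \<open>The equation annihilates the pairing of \<open>G\<close> with the truncated
      gradient, so the pairing of the gradient of \<open>\<phi> j\<close> with it is only an error
      term.\<close>
    have "(\<integral>z. ?w z * ((gradient (\<phi> j) z - G z) \<bullet> g z) \<partial>lebesgue) = (\<integral>z. ?w z * (gradient (\<phi> j) z \<bullet> g z) \<partial>lebesgue)"
    proof -
      have eq: "?w z * (G z \<bullet> g z) = ?w z * (gradient (\<phi> j) z \<bullet> g z) - ?w z * ((gradient (\<phi> j) z - G z) \<bullet> g z)" for z
        by (simp add: inner_diff_left algebra_simps)
      have "(\<integral>z. ?w z * (G z \<bullet> g z) \<partial>lebesgue) =
          (\<integral>z. ?w z * (gradient (\<phi> j) z \<bullet> g z) \<partial>lebesgue) - (\<integral>z. ?w z * ((gradient (\<phi> j) z - G z) \<bullet> g z) \<partial>lebesgue)"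
        unfolding eq by (rule Bochner_Integration.integral_diff[OF i2 d2(1)])
      moreover have "(\<integral>z. ?w z * (G z \<bullet> g z) \<partial>lebesgue) = 0"
        unfolding g_def by (rule weak[OF test_fun_Cc_infinity[OF s \<kappa> R(1) \<epsilon>(1)]])
      ultimately show ?thesis by simp
    qed
    also have "\<dots> = - (\<integral>z. ?w z * (\<phi> j z * L z) \<partial>lebesgue)"
      unfolding g_def L_def by (rule test_fun_by_parts[OF s \<kappa> R(1) \<epsilon>(1) \<phi>C \<epsilon>(2)])
    finally have e1: "(\<integral>z. ?w z * (\<phi> j z * L z) \<partial>lebesgue) = - (\<integral>z. ?w z * ((gradient (\<phi> j) z - G z) \<bullet> g z) \<partial>lebesgue)"
      by simp
    have eq: "?w z * (\<Psi> z * L z) = ?w z * (\<phi> j z * L z) - ?w z * ((\<phi> j z - \<Psi> z) * L z)" for z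
      by (simp add: algebra_simps)
    have "I = (\<integral>z. ?w z * (\<phi> j z * L z) \<partial>lebesgue) - (\<integral>z. ?w z * ((\<phi> j z - \<Psi> z) * L z) \<partial>lebesgue)"
      unfolding I_def eq by (rule Bochner_Integration.integral_diff[OF i1 d1(1)])
    then have "\<bar>I\<bar> \<le> \<bar>\<integral>z. ?w z * ((gradient (\<phi> j) z - G z) \<bullet> g z) \<partial>lebesgue\<bar> + \<bar>\<integral>z. ?w z * ((\<phi> j z - \<Psi> z) * L z) \<partial>lebesgue\<bar>"
      unfolding e1 by linarith
    also have "\<dots> \<le> ((\<integral>z. H1_err s r (\<phi> j) \<Psi> G z \<partial>lebesgue) / c + c * (\<integral>z. V z \<partial>lebesgue)) +
        ((\<integral>z. H1_err s r (\<phi> j) \<Psi> G z \<partial>lebesgue) / c + c * (\<integral>z. ?w z * (L z)\<^sup>2 \<partial>lebesgue))"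
      using d1(2) d2(2) mult_left_mono[OF gV less_imp_le[OF c]] by linarith
    finally show ?thesis by (simp add: C_def algebra_simps)
  qed
  have fin: "\<forall>\<^sub>F j in sequentially. H1_dist2 s r (\<phi> j) (\<Psi>, G) < \<infinity>"
    using order_tendstoD(2)[OF lim, of \<infinity>] by simp
  have H1_err_lim: "(\<lambda>j. \<integral>z. H1_err s r (\<phi> j) \<Psi> G z \<partial>lebesgue) \<longlonglongrightarrow> 0"
  proof -
    have "\<forall>\<^sub>F j in sequentially. ennreal (\<integral>z. H1_err s r (\<phi> j) \<Psi> G z \<partial>lebesgue) = H1_dist2 s r (\<phi> j) (\<Psi>, G)"
      using fin by eventually_elim (rule integrable_err(2)[OF \<phi>C])
    then have "(\<lambda>j. ennreal (\<integral>z. H1_err s r (\<phi> j) \<Psi> G z \<partial>lebesgue)) \<longlonglongrightarrow> ennreal 0"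
      using lim by (simp add: tendsto_cong)
    then show ?thesis
      by (subst (asm) tendsto_ennreal_iff) (auto intro!: always_eventually Bochner_Integration.integral_nonneg H1_err_nonneg)
  qed
  have "\<bar>I\<bar> \<le> c * C" if c: "c > 0" for c
  proof (rule tendsto_lowerbound)
    show "(\<lambda>j. 2 * (\<integral>z. H1_err s r (\<phi> j) \<Psi> G z \<partial>lebesgue) / c + c * C) \<longlonglongrightarrow> c * C"
      using tendsto_add[OF tendsto_divide[OF tendsto_mult[OF tendsto_const[of 2] H1_err_lim] tendsto_const[of c]] tendsto_const[of "c * C"]] c
      by simp
    show "\<forall>\<^sub>F j in sequentially. \<bar>I\<bar> \<le> 2 * (\<integral>z. H1_err s r (\<phi> j) \<Psi> G z \<partial>lebesgue) / c + c * C"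
      using fin by eventually_elim (rule main[OF _ c])
  qed simp
  then have bound: "\<bar>I\<bar> \<le> c * C" if "c > 0" for c using that by blast
  have "I = 0"
  proof (rule ccontr)
    assume "I \<noteq> 0"
    then have I: "\<bar>I\<bar> > 0" by simp
    have Cp: "C > 0" using bound[of 1] I by simp
    \<comment> \<open>The choice c = |I| / (2 C) bounds |I| by its half.\<close>
    have "\<bar>I\<bar> \<le> (\<bar>I\<bar> / (2 * C)) * C" using I Cp by (intro bound) simp
    with Cp I show False by simp
  qed
  then show ?thesis by (simp add: I_def L_def)
qed

end

section \<open>Moments and homogeneity\<close>

definition cutoff :: "(real \<Rightarrow> real) \<Rightarrow> bool"
  where "cutoff \<kappa> \<longleftrightarrow> smooth_fun \<kappa> \<and> (\<exists>R>0. \<forall>v>R\<^sup>2. \<kappa> v = 0)"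

lemma cutoff_deriv: "cutoff \<kappa> \<Longrightarrow> cutoff (deriv \<kappa>)"
  unfolding cutoff_def
proof (elim conjE exE)
  fix R assume \<kappa>: "smooth_fun \<kappa>" "R > 0" "\<forall>v>R\<^sup>2. \<kappa> v = 0"
  then have "\<forall>v>R\<^sup>2. deriv \<kappa> v = 0" by (auto intro!: deriv_eq_0_open[of "{R\<^sup>2<..}" _ _ 0])
  then show "smooth_fun (deriv \<kappa>) \<and> (\<exists>R>0. \<forall>v>R\<^sup>2. deriv \<kappa> v = 0)"
    using \<kappa> smooth_fun_deriv by blast
qed

lemma smooth_fun_power: "smooth_fun (\<lambda>v. v ^ m)"
proof -
  have "Ck_on k UNIV (\<lambda>v::real. v)" for k by (rule Ck_on_bounded_linear) auto
  then show ?thesis by (auto simp: smooth_fun_def intro: Ck_on_power)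
qed

lemma cutoff_mult: "smooth_fun f \<Longrightarrow> cutoff \<kappa> \<Longrightarrow> cutoff (\<lambda>v. f v * \<kappa> v)"
  unfolding cutoff_def using smooth_fun_mult by fastforce

lemma cutoff_bump:
  assumes "\<rho> > 0" shows "cutoff (\<lambda>v. bump (\<rho>\<^sup>2 - v))"
proof -
  have "Ck_on k UNIV (\<lambda>v. bump (- 1 * v + \<rho>\<^sup>2))" for k
    by (rule Ck_on_compose[OF _ _ Ck_on_bump Ck_on_affine]) auto
  then show ?thesis using assms by (auto simp: cutoff_def smooth_fun_def bump_def)
qed

lemma C_infinity_norm_sq:
  assumes "smooth_fun \<kappa>" shows "(\<lambda>z::'a::euclidean_space. \<kappa> (z \<bullet> z)) \<in> C_infinity"
proof -
  have "Ck_on k UNIV (\<lambda>z::'a. z \<bullet> z)" for k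
    by (subst euclidean_inner) (intro Ck_on_sum Ck_on_mult Ck_on_bounded_linear[OF _ bounded_linear_inner_left] open_UNIV)
  then have "Ck_on k UNIV (\<lambda>z::'a. \<kappa> (z \<bullet> z))" for k
    by (rule Ck_on_compose[where T = UNIV, rotated 3]) (use assms in \<open>auto simp: smooth_fun_def\<close>)
  then show ?thesis by (simp add: C_infinity_iff)
qed

lemma gradient_norm_sq:
  assumes "smooth_fun \<kappa>" shows "gradient (\<lambda>z::'a::euclidean_space. \<kappa> (z \<bullet> z)) z = (2 * deriv \<kappa> (z \<bullet> z)) *\<^sub>R z"
proof -
  have "has_grad_on (\<lambda>z::'a. z \<bullet> z) (\<lambda>z. 2 *\<^sub>R z) UNIV"
    unfolding has_grad_on_def by (auto intro!: derivative_eq_intros simp: inner_commute)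
  then have "has_grad_on (\<lambda>z::'a. \<kappa> (z \<bullet> z)) (\<lambda>z. deriv \<kappa> (z \<bullet> z) *\<^sub>R (2 *\<^sub>R z)) UNIV"
    by (rule has_grad_on_compose) (rule smooth_fun_DERIV[OF assms])
  from has_grad_on_gradient[OF this] show ?thesis by simp
qed

text \<open>Dilations preserve null sets, so an almost everywhere statement can be used at z and at
  c z simultaneously.\<close>

lemma AE_lebesgue_scale:
  assumes "AE z::'a::euclidean_space in lebesgue. P z" "c > 0"
  shows "AE z in lebesgue. P (c *\<^sub>R z)"
proof -
  define T where "T = (\<lambda>x::'a. 0 + (\<Sum>j\<in>Basis. (c * (x \<bullet> j)) *\<^sub>R j))"
  have T: "T x = c *\<^sub>R x" for x
    by (simp add: T_def scaleR_scaleR[symmetric] scaleR_sum_right[symmetric] euclidean_representation del: scaleR_scaleR)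
  have leb: "lebesgue = density (distr lebesgue lebesgue T) (\<lambda>_. (\<Prod>j\<in>(Basis :: 'a set). \<bar>c\<bar>))"
    and m: "T \<in> lebesgue \<rightarrow>\<^sub>M lebesgue"
    using lebesgue_affine_euclidean[of "\<lambda>_. c" "0 :: 'a"] lebesgue_affine_measurable[of "\<lambda>_. c" "0 :: 'a"] assms(2)
    unfolding T_def by auto
  have "AE z in density (distr lebesgue lebesgue T) (\<lambda>_. (\<Prod>j\<in>(Basis :: 'a set). \<bar>c\<bar>)). P z"
    unfolding leb[symmetric] by (rule assms(1))
  then have "AE z in distr lebesgue lebesgue T. P z"
    using assms(2) by (subst (asm) AE_density) (auto simp: prod_pos)
  from AE_distrD[OF m this] show ?thesis by (simp add: T)
qed

lemma rho_scale: "c > 0 \<Longrightarrow> rho (c *\<^sub>R z) = c * rho z"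
  by (simp add: rho_def power_mult_distrib distrib_left[symmetric] real_sqrt_mult)

lemma coord_a_scale: "c > 0 \<Longrightarrow> coord_a (c *\<^sub>R z) = c * coord_a z"
  and coord_b_scale: "c > 0 \<Longrightarrow> coord_b (c *\<^sub>R z) = c * coord_b z"
  by (simp_all add: coord_a_def coord_b_def rho_scale algebra_simps)

lemma hom_sol_scale:
  assumes "c > 0" shows "hom_sol s k (c *\<^sub>R z) = c powr (s + real k) * hom_sol s k z"
proof -
  have "ab_pow (s + real i) (k - i) (c *\<^sub>R z) = c powr (s + real k) * ab_pow (s + real i) (k - i) z" if "i \<le> k" for i
  proof -
    have "c powr (s + real i) * c ^ (k - i) = c powr (s + real k)"
      using assms that by (simp add: powr_realpow[symmetric] powr_add[symmetric] of_nat_diff)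
    then show ?thesis
      using assms coord_a_nonneg[of z]
      by (simp add: ab_pow_def coord_a_scale coord_b_scale powr_mult power_mult_distrib mult_ac)
  qed
  then show ?thesis unfolding hom_sol_def sum_distrib_left by (intro sum.cong) auto
qed

text \<open>
  By homogeneity, a moment against \<open>v \<kappa>' v\<close> is a multiple of the moment against \<open>\<kappa>\<close>. This turns the weak
  identity into \<open>2 (p + k + s - \<gamma>) moment \<kappa>' = 0\<close>, up to a lower moment in \<open>p\<close>.
\<close>
definition moment :: "real \<Rightarrow> ('n::finite point \<Rightarrow> real) \<Rightarrow> nat \<Rightarrow> real ^ 'n \<Rightarrow> nat \<Rightarrow> (real \<Rightarrow> real) \<Rightarrow> real"
  where "moment s \<Psi> k \<xi> p \<kappa> = (\<integral>z. weight (1 - 2 * s) z *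
    (\<Psi> z * (hom_sol s k z * ((\<xi>, 0, 0) \<bullet> z) ^ p * \<kappa> (z \<bullet> z))) \<partial>lebesgue)"

context
  fixes s \<gamma> :: real and \<Psi> :: "'n::finite point \<Rightarrow> real" and G :: "'n point \<Rightarrow> 'n point"
  assumes s: "0 < s" "s < 1"
    and H1: "\<And>r. r > 0 \<Longrightarrow> (\<Psi>, G) \<in> H1_Gamma s r"
    and weak: "\<And>\<Phi>. \<Phi> \<in> Cc_infinity (closure half_space - Gamma_plus) \<Longrightarrow>
      (\<integral>z. weight (1 - 2 * s) z * (G z \<bullet> gradient \<Phi> z) \<partial>lebesgue) = 0"
    and \<gamma>: "\<gamma> \<ge> 0"
    and hom: "AE z\<in>half_space in lebesgue. \<Psi> z = norm z powr \<gamma> * \<Psi> (z /\<^sub>R norm z)"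
begin

lemma approximants:
  assumes "r > 0"
  shows "\<Psi> \<in> borel_measurable (lebesgue_on (half_ball r))" "G \<in> borel_measurable (lebesgue_on (half_ball r))"
    "\<exists>\<phi>. (\<forall>j::nat. \<phi> j \<in> Cc_infinity (closure (half_ball r) - Gamma_plus_r r)) \<and>
      (\<lambda>j. H1_dist2 s r (\<phi> j) (\<Psi>, G)) \<longlonglongrightarrow> 0"
  using H1[OF assms] by (auto simp: H1_Gamma_def H1_def)

lemma weighted_integrable:
  assumes "continuous_on UNIV g" "\<And>z. norm z > R \<Longrightarrow> g z = 0"
  shows "integrable lebesgue (\<lambda>z. weight (1 - 2 * s) z * (\<Psi> z * g z))"
proof -
  define R' where "R' = \<bar>R\<bar> + 1"
  have R': "0 < R'" "R' < R' + 1" "R' + 1 > 0" by (auto simp: R'_def)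
  obtain \<phi> where \<phi>: "\<And>j::nat. \<phi> j \<in> Cc_infinity (closure (half_ball (R' + 1)) - Gamma_plus_r (R' + 1))"
    "(\<lambda>j. H1_dist2 s (R' + 1) (\<phi> j) (\<Psi>, G)) \<longlonglongrightarrow> 0"
    using approximants(3)[OF R'(3)] by blast
  have "\<forall>\<^sub>F j in sequentially. H1_dist2 s (R' + 1) (\<phi> j) (\<Psi>, G) < \<infinity>"
    using order_tendstoD(2)[OF \<phi>(2), of \<infinity>] by simp
  then obtain j where j: "H1_dist2 s (R' + 1) (\<phi> j) (\<Psi>, G) < \<infinity>"
    using eventually_happens'[OF sequentially_bot] by blast
  have "\<phi> j \<in> C_infinity" using \<phi>(1)[of j] by (simp add: Cc_infinity_def)
  from weight_\<Psi>_integrable[OF s R'(1,2) approximants(1,2)[OF R'(3)] this j assms(1)] show ?thesis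
    using assms(2) by (simp add: R'_def)
qed

text \<open>The indicator of a ball is not continuous, so \<open>weighted_integrable\<close> is
  applied with the tent \<open>bmp\<close>, which is at least 1 on the ball, and the tent is divided
  out again.\<close>

lemma loc_integrable_weighted:
  assumes g: "continuous_on UNIV g" shows "loc_integrable (\<lambda>z. weight (1 - 2 * s) z * (\<Psi> z * g z))"
  unfolding loc_integrable_def
proof
  fix r :: real
  define bmp where "bmp z = max 0 (\<bar>r\<bar> + 1 - norm z)" for z :: "'n point"
  have bmpc: "continuous_on UNIV bmp" unfolding bmp_def by (intro continuous_intros)
  have i: "integrable lebesgue (\<lambda>z. weight (1 - 2 * s) z * (\<Psi> z * (g z * bmp z)))"
    by (rule weighted_integrable[of _ "\<bar>r\<bar> + 1"]) (auto intro!: continuous_intros g bmpc simp: bmp_def)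
  have eq: "indicator (cball 0 r) z * (weight (1 - 2 * s) z * (\<Psi> z * g z)) =
      (indicator (cball 0 r) z * inverse (bmp z)) * (weight (1 - 2 * s) z * (\<Psi> z * (g z * bmp z)))" for z
    by (auto simp: bmp_def max_def split: split_indicator)
  show "integrable lebesgue (\<lambda>z. indicator (cball 0 r) z * (weight (1 - 2 * s) z * (\<Psi> z * g z)))"
  proof (rule Bochner_Integration.integrable_bound[OF i])
    have "(\<lambda>z. indicator (cball 0 r) z * inverse (bmp z) :: real) \<in> borel_measurable lebesgue"
      by (intro borel_measurable_lebesgueI borel_measurable_times borel_measurable_inverse borel_measurable_indicator
          borel_measurable_continuous_onI[OF bmpc]) auto
    then show "(\<lambda>z. indicator (cball 0 r) z * (weight (1 - 2 * s) z * (\<Psi> z * g z))) \<in> borel_measurable lebesgue"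
      unfolding eq using borel_measurable_integrable[OF i] by (rule borel_measurable_times)
    have "norm (indicator (cball 0 r) z * (weight (1 - 2 * s) z * (\<Psi> z * g z))) \<le>
        norm (weight (1 - 2 * s) z * (\<Psi> z * (g z * bmp z)))" for z
    proof (cases "norm z \<le> r")
      case True
      then have "1 \<le> bmp z" by (simp add: bmp_def)
      then have "\<bar>weight (1 - 2 * s) z * (\<Psi> z * g z)\<bar> * 1 \<le> \<bar>weight (1 - 2 * s) z * (\<Psi> z * g z)\<bar> * \<bar>bmp z\<bar>"
        by (intro mult_left_mono) auto
      then show ?thesis using True by (simp add: abs_mult mult.assoc)
    qed simp
    then show "AE z in lebesgue. norm (indicator (cball 0 r) z * (weight (1 - 2 * s) z * (\<Psi> z * g z))) \<le>
        norm (weight (1 - 2 * s) z * (\<Psi> z * (g z * bmp z)))" by simp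
  qed
qed

lemma continuous_moment_integrand: "cutoff \<kappa> \<Longrightarrow> continuous_on UNIV (\<lambda>z::'n point. hom_sol s k z * ((\<xi>, 0, 0) \<bullet> z) ^ p * \<kappa> (z \<bullet> z))"
  unfolding cutoff_def
  by (intro continuous_on_mult continuous_on_power continuous_on_const continuous_on_inner
      continuous_on_id continuous_on_hom_sol continuous_on_smooth_norm_sq s) auto

lemma moment_integrable:
  assumes "cutoff \<kappa>"
  shows "integrable lebesgue (\<lambda>z. weight (1 - 2 * s) z * (\<Psi> z * (hom_sol s k z * ((\<xi>, 0, 0) \<bullet> z) ^ p * \<kappa> (z \<bullet> z))))"
proof -
  obtain R where R: "R > 0" "\<And>v. v > R\<^sup>2 \<Longrightarrow> \<kappa> v = 0" using assms by (auto simp: cutoff_def)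
  have "\<kappa> (z \<bullet> z) = 0" if "norm z > R" for z :: "'n point"
    using that R by (simp add: dot_square_norm power_strict_mono)
  then show ?thesis by (intro weighted_integrable[OF continuous_moment_integrand[OF assms], of R]) simp
qed

text \<open>The very weak equation sorted by derivatives of kappa. For p < 2 the exponent
  \<open>p - 2\<close> truncates to 0, but then the factor p (p - 1) vanishes.\<close>

lemma moment_weak_identity:
  assumes "cutoff \<kappa>"
  shows "4 * moment s \<Psi> k \<xi> p (\<lambda>v. v * deriv (deriv \<kappa>) v) +
    (2 * real CARD('n) + 6 + 4 * real p + 4 * real k) * moment s \<Psi> k \<xi> p (deriv \<kappa>) +
    real p * real (p - 1) * (\<xi> \<bullet> \<xi>) * moment s \<Psi> k \<xi> (p - 2) \<kappa> = 0"
proof -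
  obtain R where R: "R > 0" "\<And>v. v > R\<^sup>2 \<Longrightarrow> \<kappa> v = 0" and \<kappa>: "smooth_fun \<kappa>"
    using assms by (auto simp: cutoff_def)
  have R': "R < R + 1" "R + 1 > 0" using R(1) by auto
  obtain \<phi> where \<phi>: "\<And>j::nat. \<phi> j \<in> Cc_infinity (closure (half_ball (R + 1)) - Gamma_plus_r (R + 1))"
    "(\<lambda>j. H1_dist2 s (R + 1) (\<phi> j) (\<Psi>, G)) \<longlonglongrightarrow> 0"
    using approximants(3)[OF R'(2)] by blast
  let ?c = "2 * real CARD('n) + 6 + 4 * real p + 4 * real k"
  let ?d = "real p * real (p - 1) * (\<xi> \<bullet> \<xi>)"
  have c1: "cutoff (\<lambda>v. v * deriv (deriv \<kappa>) v)"
    using cutoff_mult[OF smooth_fun_power[of 1] cutoff_deriv[OF cutoff_deriv[OF assms]]] by simp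
  note i = moment_integrable[OF c1, of k \<xi> p] moment_integrable[OF cutoff_deriv[OF assms], of k \<xi> p]
    moment_integrable[OF assms, of k \<xi> "p - 2"]
  have "0 = (\<integral>z. weight (1 - 2 * s) z * (\<Psi> z * test_rhs s k \<xi> p \<kappa> z) \<partial>lebesgue)"
    by (rule weak_identity[OF s R(1) R'(1) approximants(1,2)[OF R'(2)] \<phi> weak \<kappa> R(2), symmetric])
  also have "\<dots> = (\<integral>z. 4 * (weight (1 - 2 * s) z * (\<Psi> z * (hom_sol s k z * ((\<xi>, 0, 0) \<bullet> z) ^ p * ((z \<bullet> z) * deriv (deriv \<kappa>) (z \<bullet> z))))) +
      ?c * (weight (1 - 2 * s) z * (\<Psi> z * (hom_sol s k z * ((\<xi>, 0, 0) \<bullet> z) ^ p * deriv \<kappa> (z \<bullet> z)))) +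
      ?d * (weight (1 - 2 * s) z * (\<Psi> z * (hom_sol s k z * ((\<xi>, 0, 0) \<bullet> z) ^ (p - 2) * \<kappa> (z \<bullet> z)))) \<partial>lebesgue)"
    unfolding test_rhs_def by (intro Bochner_Integration.integral_cong refl) (simp add: algebra_simps)
  also have "\<dots> = 4 * moment s \<Psi> k \<xi> p (\<lambda>v. v * deriv (deriv \<kappa>) v) + ?c * moment s \<Psi> k \<xi> p (deriv \<kappa>) + ?d * moment s \<Psi> k \<xi> (p - 2) \<kappa>"
    unfolding moment_def using i by simp
  finally show ?thesis by simp
qed

text \<open>The hypothesis refers to values on the unit sphere, a null set. Comparing it at z and c
  z, which have the same projection to the sphere, removes these values.\<close>

lemma \<Psi>_scale:
  assumes c: "c > 0"
  shows "AE z in lebesgue. z \<in> half_space \<longrightarrow> \<Psi> (c *\<^sub>R z) = c powr \<gamma> * \<Psi> z"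
  using hom AE_lebesgue_scale[OF hom c]
proof eventually_elim
  case (elim z)
  show ?case
  proof
    assume z: "z \<in> half_space"
    then have "c *\<^sub>R z \<in> half_space" using c by (simp add: half_space_def)
    then have "\<Psi> (c *\<^sub>R z) = norm (c *\<^sub>R z) powr \<gamma> * \<Psi> ((c *\<^sub>R z) /\<^sub>R norm (c *\<^sub>R z))" using elim(2) by simp
    also have "(c *\<^sub>R z) /\<^sub>R norm (c *\<^sub>R z) = z /\<^sub>R norm z" using c by simp
    also have "norm (c *\<^sub>R z) powr \<gamma> = c powr \<gamma> * norm z powr \<gamma>" using c by (simp add: powr_mult)
    finally show "\<Psi> (c *\<^sub>R z) = c powr \<gamma> * \<Psi> z" using elim(1) z by simp
  qed
qed

text \<open>The full dilation (\<open>D = Basis\<close>) applied to kappa (|z|^2), whose derivative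
  along z is 2 |z|^2 kappa'. The degrees of the weight, Psi, \<open>hom_sol\<close> and (xi . y')^p
  add up, and the dimension is \<open>CARD('n) + 2\<close>.\<close>

lemma moment_dilation:
  assumes "cutoff \<kappa>"
  shows "2 * moment s \<Psi> k \<xi> p (\<lambda>v. v * deriv \<kappa> v) =
    - ((1 - 2 * s) + \<gamma> + (s + real k) + real p + real CARD('n) + 2) * moment s \<Psi> k \<xi> p \<kappa>"
proof -
  obtain R where R: "R > 0" "\<And>v. v > R\<^sup>2 \<Longrightarrow> \<kappa> v = 0" and \<kappa>: "smooth_fun \<kappa>"
    using assms by (auto simp: cutoff_def)
  define g where "g z = hom_sol s k z * ((\<xi>, 0, 0) \<bullet> z) ^ p" for z :: "'n point"
  define w where "w z = weight (1 - 2 * s) z * (\<Psi> z * g z)" for z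
  define q where "q = (1 - 2 * s) + \<gamma> + (s + real k) + real p"
  define X where "X D z = 0 + (\<Sum>j\<in>D. (z \<bullet> j) *\<^sub>R j)" for D :: "'n point set" and z
  have X: "X Basis z = z" for z by (simp add: X_def euclidean_representation)
  have gc: "continuous_on UNIV g"
    unfolding g_def
    by (intro continuous_on_mult continuous_on_power continuous_on_const continuous_on_inner continuous_on_id continuous_on_hom_sol s)
  have "(\<integral>z. w z * (gradient (\<lambda>z. \<kappa> (z \<bullet> z)) z \<bullet> X Basis z) \<partial>lebesgue) =
    - (q + real (card (Basis :: 'n point set))) * (\<integral>z. w z * \<kappa> (z \<bullet> z) \<partial>lebesgue)"
    unfolding X_def
  proof (rule integral_derivative_along_flow)
    show "loc_integrable w" unfolding w_def by (rule loc_integrable_weighted[OF gc])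
    show "(\<lambda>z::'n point. \<kappa> (z \<bullet> z)) \<in> C_infinity" by (rule C_infinity_norm_sq[OF \<kappa>])
    show "\<kappa> (z \<bullet> z) = 0" if "norm z > R" for z :: "'n point"
      using that R by (simp add: dot_square_norm power_strict_mono)
    fix h :: real assume h: "0 < h" "h \<le> 1"
    have c: "1 + h > 0" using h by simp
    have "AE z in lebesgue. w (z + h *\<^sub>R X Basis z) = (1 + h) powr q * w z"
      using \<Psi>_scale[OF c]
    proof eventually_elim
      case (elim z)
      have e: "z + h *\<^sub>R X Basis z = (1 + h) *\<^sub>R z" by (simp add: X algebra_simps)
      show ?case
      proof (cases "z \<in> half_space")
        case True
        have "weight (1 - 2 * s) ((1 + h) *\<^sub>R z) = (1 + h) powr (1 - 2 * s) * weight (1 - 2 * s) z"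
          using True c by (simp add: weight_def half_space_def powr_mult)
        moreover have "((\<xi>, 0, 0) \<bullet> ((1 + h) *\<^sub>R z)) ^ p = (1 + h) powr real p * ((\<xi>, 0, 0) \<bullet> z) ^ p"
          using c by (simp add: inner_scaleR_right power_mult_distrib powr_realpow del: inner_Pair)
        moreover have "(1 + h) powr q = (1 + h) powr (1 - 2 * s) * (1 + h) powr \<gamma> * (1 + h) powr (s + real k) * (1 + h) powr real p"
          by (simp only: q_def powr_add)
        ultimately show ?thesis
          unfolding e w_def g_def hom_sol_scale[OF c] using elim True by (simp only: mult_ac)
      next
        case False
        then have "(1 + h) *\<^sub>R z \<notin> half_space" using c by (simp add: half_space_def zero_less_mult_iff)
        with False show ?thesis unfolding e w_def by (simp add: weight_def)
      qed
    qed
    then show "AE z in lebesgue. w (z + h *\<^sub>R (0 + (\<Sum>j\<in>Basis. (z \<bullet> j) *\<^sub>R j))) = (1 + h) powr q * w z"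
      by (simp add: X_def)
  qed simp
  moreover have "(\<integral>z. w z * (gradient (\<lambda>z. \<kappa> (z \<bullet> z)) z \<bullet> X Basis z) \<partial>lebesgue) =
      2 * moment s \<Psi> k \<xi> p (\<lambda>v. v * deriv \<kappa> v)"
    unfolding moment_def Bochner_Integration.integral_mult_right_zero[symmetric]
    by (intro Bochner_Integration.integral_cong refl)
       (simp add: X gradient_norm_sq[OF \<kappa>] w_def g_def mult_ac del: inner_Pair)
  moreover have "(\<integral>z. w z * \<kappa> (z \<bullet> z) \<partial>lebesgue) = moment s \<Psi> k \<xi> p \<kappa>"
    unfolding moment_def by (intro Bochner_Integration.integral_cong refl) (simp add: w_def g_def mult_ac del: inner_Pair)
  moreover have "real (card (Basis :: 'n point set)) = real CARD('n) + 2" by simp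
  ultimately have "2 * moment s \<Psi> k \<xi> p (\<lambda>v. v * deriv \<kappa> v) = - (q + (real CARD('n) + 2)) * moment s \<Psi> k \<xi> p \<kappa>"
    by (simp only:)
  then show ?thesis unfolding q_def by (simp only: add.assoc)
qed

lemma moment_eq_0:
  assumes neq: "\<And>j::nat. \<gamma> \<noteq> real j + s"
  shows "cutoff \<kappa> \<Longrightarrow> moment s \<Psi> k \<xi> p \<kappa> = 0"
proof (induction p arbitrary: \<kappa> rule: less_induct)
  case (less p)
  define D where "D = (1 - 2 * s) + \<gamma> + (s + real k) + real p + real CARD('n) + 2"
  have deriv0: "moment s \<Psi> k \<xi> p (deriv \<kappa>) = 0" if \<kappa>: "cutoff \<kappa>" for \<kappa>
  proof -
    have low: "real p * real (p - 1) * (\<xi> \<bullet> \<xi>) * moment s \<Psi> k \<xi> (p - 2) \<kappa> = 0"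
    proof (cases "p < 2")
      case True
      then show ?thesis by (cases p) auto
    next
      case False
      then show ?thesis using less.IH[of "p - 2"] \<kappa> by simp
    qed
    have "2 * moment s \<Psi> k \<xi> p (\<lambda>v. v * deriv (deriv \<kappa>) v) = - D * moment s \<Psi> k \<xi> p (deriv \<kappa>)"
      unfolding D_def by (rule moment_dilation[OF cutoff_deriv[OF \<kappa>]])
    then have "4 * moment s \<Psi> k \<xi> p (\<lambda>v. v * deriv (deriv \<kappa>) v) = - (2 * D) * moment s \<Psi> k \<xi> p (deriv \<kappa>)" by simp
    with moment_weak_identity[OF \<kappa>, of k \<xi> p]
    have "(2 * real CARD('n) + 6 + 4 * real p + 4 * real k - 2 * D) * moment s \<Psi> k \<xi> p (deriv \<kappa>) = 0"
      unfolding low left_diff_distrib by (simp only:)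
    \<comment> \<open>As D equals \<open>CARD('n)\<close> + 3 + gamma - s + k + p, the dimension
      cancels and twice p + k + s - gamma is left, nonzero by \<open>neq\<close>.\<close>
    moreover have "2 * real CARD('n) + 6 + 4 * real p + 4 * real k - 2 * D = 2 * (real (p + k) + s - \<gamma>)"
      by (simp add: D_def algebra_simps)
    ultimately show ?thesis using neq[of "p + k"] by auto
  qed
  \<comment> \<open>From kappa' back to kappa: \<open>deriv0\<close> is applied to v kappa (v),
    whose derivative is kappa + v kappa', and the dilation identity expresses the moment of v kappa'
    by that of kappa.\<close>
  have c: "cutoff (\<lambda>v. v * \<kappa> v)" using cutoff_mult[OF smooth_fun_power[of 1] less.prems] by simp
  have "deriv (\<lambda>v. v * \<kappa> v) = (\<lambda>v. \<kappa> v + v * deriv \<kappa> v)"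
  proof
    fix v
    have "smooth_fun \<kappa>" using less.prems by (simp add: cutoff_def)
    from DERIV_mult[OF DERIV_ident smooth_fun_DERIV[OF this], of v]
    show "deriv (\<lambda>v. v * \<kappa> v) v = \<kappa> v + v * deriv \<kappa> v" by (intro DERIV_imp_deriv) (simp add: add.commute mult.commute)
  qed
  with deriv0[OF c] have "moment s \<Psi> k \<xi> p (\<lambda>v. \<kappa> v + v * deriv \<kappa> v) = 0" by simp
  moreover have "moment s \<Psi> k \<xi> p (\<lambda>v. \<kappa> v + v * deriv \<kappa> v) = moment s \<Psi> k \<xi> p \<kappa> + moment s \<Psi> k \<xi> p (\<lambda>v. v * deriv \<kappa> v)"
  proof -
    have "cutoff (\<lambda>v. v * deriv \<kappa> v)" using cutoff_mult[OF smooth_fun_power[of 1] cutoff_deriv[OF less.prems]] by simp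
    from Bochner_Integration.integral_add[OF moment_integrable[OF less.prems] moment_integrable[OF this], of k \<xi> p k \<xi> p]
    show ?thesis unfolding moment_def by (simp add: distrib_left del: inner_Pair)
  qed
  moreover have "2 * moment s \<Psi> k \<xi> p (\<lambda>v. v * deriv \<kappa> v) = - D * moment s \<Psi> k \<xi> p \<kappa>"
    unfolding D_def by (rule moment_dilation[OF less.prems])
  ultimately have "(2 - D) * moment s \<Psi> k \<xi> p \<kappa> = 0" unfolding left_diff_distrib by linarith
  \<comment> \<open>So the factor 2 - D is nonzero; this uses 1 - s > 0 and gamma >= 0.\<close>
  moreover have "D > 2"
  proof -
    have "real CARD('n) \<ge> 1" by (simp add: Suc_le_eq)
    then show ?thesis using s \<gamma> unfolding D_def by linarith
  qed
  ultimately show ?case by simp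
qed

end

section \<open>Density of the test family\<close>

text \<open>Finite sums are enough: the families used are closed under products and contain the
  constants, so the result is the subalgebra that Stone-Weierstrass asks for.\<close>

inductive_set fun_span :: "('a \<Rightarrow> real) set \<Rightarrow> ('a \<Rightarrow> real) set" for S
  where
    base: "f \<in> S \<Longrightarrow> f \<in> fun_span S"
  | add: "f \<in> fun_span S \<Longrightarrow> g \<in> fun_span S \<Longrightarrow> (\<lambda>x. f x + g x) \<in> fun_span S"

lemma fun_span_mult:
  assumes S: "\<And>f g. f \<in> S \<Longrightarrow> g \<in> S \<Longrightarrow> (\<lambda>x. f x * g x) \<in> S"
    and "f \<in> fun_span S" "g \<in> fun_span S"
  shows "(\<lambda>x. f x * g x) \<in> fun_span S"
  using assms(2)
proof induction
  case (base f)
  from assms(3) show ?case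
  proof induction
    case (base g)
    then show ?case using S \<open>f \<in> S\<close> by (intro fun_span.base)
  next
    case (add g h)
    then show ?case using fun_span.add[OF add.IH] by (simp add: distrib_left)
  qed
next
  case (add f h)
  then show ?case using fun_span.add[OF add.IH] by (simp add: distrib_right)
qed

lemma fun_span_continuous:
  assumes "\<And>f. f \<in> S \<Longrightarrow> continuous_on K f" "f \<in> fun_span S"
  shows "continuous_on K f"
  using assms(2) by induction (auto intro: assms(1) continuous_on_add)

lemma integrable_mult_continuous_compact:
  fixes \<tau> :: "'a::euclidean_space \<Rightarrow> 'b::euclidean_space"
  assumes \<omega>: "integrable lebesgue \<omega>" and K: "compact K" "\<And>z. \<omega> z \<noteq> 0 \<Longrightarrow> \<tau> z \<in> K"
    and \<tau>: "continuous_on UNIV \<tau>" and g: "continuous_on UNIV g"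
  shows "integrable lebesgue (\<lambda>z. \<omega> z * g (\<tau> z) :: real)"
proof -
  have "compact (g ` K)" using K g by (intro compact_continuous_image) (auto intro: continuous_on_subset)
  then obtain B where B: "\<And>x. x \<in> K \<Longrightarrow> norm (g x) \<le> B"
    using compact_imp_bounded bounded_iff by (metis imageI)
  show ?thesis
  proof (rule Bochner_Integration.integrable_bound)
    show "integrable lebesgue (\<lambda>z. B * \<omega> z)" using \<omega> by simp
    have "(\<lambda>z. g (\<tau> z)) \<in> borel_measurable lebesgue"
      by (intro borel_measurable_lebesgueI borel_measurable_continuous_onI continuous_on_compose2[OF g \<tau>]) auto
    then show "(\<lambda>z. \<omega> z * g (\<tau> z)) \<in> borel_measurable lebesgue"
      using borel_measurable_integrable[OF \<omega>] by (intro borel_measurable_times)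
    have "norm (\<omega> z * g (\<tau> z)) \<le> norm (B * \<omega> z)" for z
    proof (cases "\<omega> z = 0")
      case False
      then have "\<bar>g (\<tau> z)\<bar> \<le> \<bar>B\<bar>" using B[OF K(2)] by fastforce
      then show ?thesis 
        using mult_left_mono[of "\<bar>g (\<tau> z)\<bar>" "\<bar>B\<bar>" "\<bar>\<omega> z\<bar>"] by (simp add: abs_mult mult.commute)
    qed simp
    then show "AE z in lebesgue. norm (\<omega> z * g (\<tau> z)) \<le> norm (B * \<omega> z)" by simp
  qed
qed

text \<open>The map tau lets test functions depend on fewer variables than the integrand: in effect
  the measure omega dz is transported to \<open>K\<close>, and uniform approximation there within e
  costs at most e times the total mass of |omega|.\<close>

lemma annihilates_continuous:
  fixes \<tau> :: "'a::euclidean_space \<Rightarrow> 'b::euclidean_space"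
  assumes \<omega>: "integrable lebesgue \<omega>" and K: "compact K" "\<And>z. \<omega> z \<noteq> 0 \<Longrightarrow> \<tau> z \<in> K"
    and \<tau>: "continuous_on UNIV \<tau>" and g: "continuous_on UNIV g"
    and S: "\<And>f. f \<in> S \<Longrightarrow> continuous_on UNIV f" "\<And>f g. f \<in> S \<Longrightarrow> g \<in> S \<Longrightarrow> (\<lambda>x. f x * g x) \<in> S"
      "\<And>c. (\<lambda>x. c) \<in> S" "\<And>x y. x \<in> K \<Longrightarrow> y \<in> K \<Longrightarrow> x \<noteq> y \<Longrightarrow> \<exists>f\<in>S. f x \<noteq> f y"
    and zero: "\<And>f. f \<in> S \<Longrightarrow> (\<integral>z. \<omega> z * f (\<tau> z) \<partial>lebesgue) = 0"
  shows "(\<integral>z. \<omega> z * g (\<tau> z) \<partial>lebesgue) = (0 :: real)"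
proof -
  interpret function_ring_on "fun_span S" K
  proof
    show "compact K" by (rule K)
    show "continuous_on K f" if "f \<in> fun_span S" for f
      using fun_span_continuous[OF _ that, of K] S(1) continuous_on_subset by blast
    show "(\<lambda>x. f x + g x) \<in> fun_span S" if "f \<in> fun_span S" "g \<in> fun_span S" for f g
      using that by (rule fun_span.add)
    show "(\<lambda>x. f x * g x) \<in> fun_span S" if "f \<in> fun_span S" "g \<in> fun_span S" for f g
      using S(2) that by (rule fun_span_mult)
    show "(\<lambda>_. c) \<in> fun_span S" for c by (intro fun_span.base S)
    show "\<exists>f\<in>fun_span S. f x \<noteq> f y" if "x \<in> K" "y \<in> K" "x \<noteq> y" for x y
      using S(4)[OF that] fun_span.base by blast
  qed
  have int: "integrable lebesgue (\<lambda>z. \<omega> z * f (\<tau> z))" if "continuous_on UNIV f" for f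
    by (rule integrable_mult_continuous_compact[OF \<omega> K(1) _ \<tau> that]) (rule K(2))
  have zero': "(\<integral>z. \<omega> z * f (\<tau> z) \<partial>lebesgue) = 0" if "f \<in> fun_span S" for f
    using that
  proof induction
    case (add f h)
    have "integrable lebesgue (\<lambda>z. \<omega> z * f (\<tau> z))" "integrable lebesgue (\<lambda>z. \<omega> z * h (\<tau> z))"
      using add.hyps fun_span_continuous[OF S(1)] by (auto intro!: int)
    then show ?case using add.IH by (simp add: distrib_left)
  qed (rule zero)
  define I where "I = (\<integral>z. \<omega> z * g (\<tau> z) \<partial>lebesgue)"
  define N where "N = (\<integral>z. \<bar>\<omega> z\<bar> \<partial>lebesgue)"
  have bound: "\<bar>I\<bar> \<le> e * N" if e: "e > 0" for e
  proof -
    obtain f where f: "f \<in> fun_span S" "\<And>x. x \<in> K \<Longrightarrow> \<bar>g x - f x\<bar> < e"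
      using Stone_Weierstrass_basic[OF continuous_on_subset[OF g subset_UNIV] e] by blast
    have fc: "continuous_on UNIV f" using f(1) fun_span_continuous[OF S(1)] by blast
    have "I = (\<integral>z. \<omega> z * g (\<tau> z) \<partial>lebesgue) - (\<integral>z. \<omega> z * f (\<tau> z) \<partial>lebesgue)"
      by (simp add: I_def zero'[OF f(1)])
    also have "\<dots> = (\<integral>z. \<omega> z * g (\<tau> z) - \<omega> z * f (\<tau> z) \<partial>lebesgue)"
      by (rule Bochner_Integration.integral_diff[OF int[OF g] int[OF fc], symmetric])
    finally have "\<bar>I\<bar> \<le> (\<integral>z. \<bar>\<omega> z * g (\<tau> z) - \<omega> z * f (\<tau> z)\<bar> \<partial>lebesgue)"
      using integral_abs_bound by metis
    also have "\<dots> \<le> (\<integral>z. e * \<bar>\<omega> z\<bar> \<partial>lebesgue)"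
    proof (rule integral_mono)
      show "integrable lebesgue (\<lambda>z. \<bar>\<omega> z * g (\<tau> z) - \<omega> z * f (\<tau> z)\<bar>)"
        by (rule integrable_abs[OF Bochner_Integration.integrable_diff[OF int[OF g] int[OF fc]]])
      show "integrable lebesgue (\<lambda>z. e * \<bar>\<omega> z\<bar>)" using \<omega> by simp
      fix z
      show "\<bar>\<omega> z * g (\<tau> z) - \<omega> z * f (\<tau> z)\<bar> \<le> e * \<bar>\<omega> z\<bar>"
      proof (cases "\<omega> z = 0")
        case False
        have "\<bar>\<omega> z\<bar> * \<bar>g (\<tau> z) - f (\<tau> z)\<bar> \<le> \<bar>\<omega> z\<bar> * e"
          using f(2)[OF K(2)[OF False]] by (intro mult_left_mono) auto
        then show ?thesis by (simp add: abs_mult right_diff_distrib[symmetric] mult.commute)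
      qed simp
    qed
    finally show ?thesis by (simp add: N_def)
  qed
  have N: "N \<ge> 0" by (simp add: N_def)
  have "I = 0"
  proof (rule ccontr)
    assume "I \<noteq> 0"
    then have I: "\<bar>I\<bar> > 0" by simp
    have Np: "N > 0" using bound[of 1] I by simp
    have "\<bar>I\<bar> \<le> (\<bar>I\<bar> / (2 * N)) * N" using I Np by (intro bound) simp
    with Np I show False by simp
  qed
  then show ?thesis by (simp add: I_def)
qed

text \<open>
  Approximate \<open>sgn \<omega>\<close> almost everywhere by continuous functions with values in \<open>[-1, 1]\<close>.
\<close>
lemma AE_eq_0_if_annihilates_continuous:
  fixes \<omega> :: "'a::euclidean_space \<Rightarrow> real"
  assumes \<omega>: "integrable lebesgue \<omega>"
    and zero: "\<And>g. continuous_on UNIV g \<Longrightarrow> (\<integral>z. \<omega> z * g z \<partial>lebesgue) = 0"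
  shows "AE z in lebesgue. \<omega> z = 0"
proof -
  have "(\<lambda>z. sgn (\<omega> z)) \<in> borel_measurable lebesgue"
    using borel_measurable_integrable[OF \<omega>] by measurable
  then have "(\<lambda>z. sgn (\<omega> z)) measurable_on UNIV"
    using lebesgue_measurable_imp_measurable_on[of "\<lambda>z. sgn (\<omega> z)" UNIV] by simp
  then obtain N g where N: "negligible N" and g: "\<And>n. continuous_on UNIV (g n)"
    and lim: "\<And>x. x \<notin> N \<Longrightarrow> (\<lambda>n. g n x) \<longlonglongrightarrow> sgn (\<omega> x)"
    by (auto simp: measurable_on_def)
  define h where "h n x = max (-1) (min 1 (g n x))" for n :: nat and x
  have hc: "continuous_on UNIV (h n)" for n unfolding h_def by (intro continuous_intros g)
  have hl: "(\<lambda>n. h n x) \<longlonglongrightarrow> sgn (\<omega> x)" if "x \<notin> N" for x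
  proof -
    have "(\<lambda>n. h n x) \<longlonglongrightarrow> max (-1) (min 1 (sgn (\<omega> x)))"
      unfolding h_def by (intro tendsto_max tendsto_min tendsto_const lim that)
    then show ?thesis by (simp add: sgn_if split: if_splits)
  qed
  have AE: "AE x in lebesgue. x \<notin> N" using N negligible_iff_null_sets AE_not_in by blast
  have "(\<lambda>n. \<integral>z. \<omega> z * h n z \<partial>lebesgue) \<longlonglongrightarrow> (\<integral>z. \<bar>\<omega> z\<bar> \<partial>lebesgue)"
  proof (rule integral_dominated_convergence)
    show "integrable lebesgue (\<lambda>z. \<bar>\<omega> z\<bar>)" using \<omega> by simp
    show "(\<lambda>z. \<bar>\<omega> z\<bar>) \<in> borel_measurable lebesgue" using borel_measurable_integrable[OF \<omega>] by measurable
    show "(\<lambda>z. \<omega> z * h n z) \<in> borel_measurable lebesgue" for n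
      by (intro borel_measurable_times borel_measurable_integrable[OF \<omega>] borel_measurable_lebesgueI
          borel_measurable_continuous_onI hc)
    have "\<bar>h n z\<bar> \<le> 1" for n z by (auto simp: h_def max_def min_def)
    then have "norm (\<omega> z * h n z) \<le> \<bar>\<omega> z\<bar>" for n z by (simp add: abs_mult mult_left_le)
    then show "AE z in lebesgue. norm (\<omega> z * h n z) \<le> \<bar>\<omega> z\<bar>" for n by simp
    show "AE z in lebesgue. (\<lambda>n. \<omega> z * h n z) \<longlonglongrightarrow> \<bar>\<omega> z\<bar>"
      using AE
    proof eventually_elim
      case (elim z)
      have "(\<lambda>n. \<omega> z * h n z) \<longlonglongrightarrow> \<omega> z * sgn (\<omega> z)" by (intro tendsto_intros hl elim)
      then show ?case by (simp add: abs_sgn)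
    qed
  qed
  then have "(\<integral>z. \<bar>\<omega> z\<bar> \<partial>lebesgue) = 0"
    using zero[OF hc] by (simp add: LIMSEQ_const_iff)
  then show ?thesis
    using \<omega> by (subst (asm) integral_nonneg_eq_0_iff_AE) auto
qed

text \<open>Each step of the recursion multiplies by a negative number while i < k, because k - i >=
  1 > s. This makes the alternating sum in \<open>dens_power_a\<close> strictly positive.\<close>

lemma hom_coeff_sign:
  assumes "0 < s" "s < 1"
  shows "i \<le> k \<Longrightarrow> (- 1) ^ i * hom_coeff s k i > 0"
proof (induction i)
  case (Suc i)
  then have ki: "real (k - i) \<ge> 1" and IH: "(- 1) ^ i * hom_coeff s k i > 0" by auto
  define c where "c = real (k - i) * (real (k - i) - s) / (real (Suc i) * (real (Suc i) + s))"
  have "c > 0" using ki assms by (auto simp: c_def intro!: divide_pos_pos mult_pos_pos add_pos_pos)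
  moreover have "(- 1) ^ Suc i * hom_coeff s k (Suc i) = c * ((- 1) ^ i * hom_coeff s k i)"
    by (simp add: c_def)
  ultimately show ?case using IH by simp
qed simp

section \<open>Conclusion\<close>

text \<open>Exponentials instead of powers (xi . y')^p: products of the latter for different xi are
  in general not of the same form, whereas exponentials multiply by adding their xi. They are
  reached from the powers through the exponential series.\<close>

definition exp_monomials :: "((real ^ 'n::finite) \<times> real \<Rightarrow> real) set"
  where "exp_monomials = {f. \<exists>c \<xi> m. f = (\<lambda>y. c * (exp (\<xi> \<bullet> fst y) * snd y ^ m))}"

lemma exp_monomialsI: "(\<lambda>y. c * (exp (\<xi> \<bullet> fst y) * snd y ^ m)) \<in> exp_monomials"
  by (auto simp: exp_monomials_def)

lemma exp_monomials_continuous: "f \<in> exp_monomials \<Longrightarrow> continuous_on S f"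
  by (auto simp: exp_monomials_def intro!: continuous_intros)

lemma exp_monomials_mult:
  assumes "f \<in> exp_monomials" "g \<in> exp_monomials" shows "(\<lambda>y. f y * g y) \<in> exp_monomials"
proof -
  obtain c \<xi> m d \<eta> l where f: "f = (\<lambda>y. c * (exp (\<xi> \<bullet> fst y) * snd y ^ m))"
    and g: "g = (\<lambda>y. d * (exp (\<eta> \<bullet> fst y) * snd y ^ l))"
    using assms by (auto simp: exp_monomials_def)
  have "(\<lambda>y. f y * g y) = (\<lambda>y. (c * d) * (exp ((\<xi> + \<eta>) \<bullet> fst y) * snd y ^ (m + l)))"
    by (simp only: f g inner_add_left exp_add power_add mult_ac)
  then show ?thesis using exp_monomialsI by simp
qed

lemma exp_monomials_const: "(\<lambda>y. c) \<in> exp_monomials"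
  using exp_monomialsI[of c 0 0] by simp

lemma exp_monomials_separate:
  fixes x y :: "(real ^ 'n::finite) \<times> real"
  assumes "x \<noteq> y" shows "\<exists>f\<in>exp_monomials. f x \<noteq> f y"
proof (cases "fst x = fst y")
  case True
  then have "snd x \<noteq> snd y" using assms by (auto simp: prod_eq_iff)
  then show ?thesis by (intro bexI[OF _ exp_monomialsI[of 1 0 1]]) simp
next
  case False
  then have "(fst x - fst y) \<bullet> (fst x - fst y) \<noteq> 0" by simp
  then have "(fst x - fst y) \<bullet> fst x \<noteq> (fst x - fst y) \<bullet> fst y" by (simp add: inner_diff_right)
  then show ?thesis by (intro bexI[OF _ exp_monomialsI[of 1 "fst x - fst y" 0]]) simp
qed

text \<open>Dominating function for the passage from powers to exponentials in
  \<open>dens_exp\<close>.\<close>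

lemma exp_partial_sum_le: "\<bar>\<Sum>p<N. x ^ p / fact p\<bar> \<le> exp \<bar>x :: real\<bar>"
proof -
  have s: "(\<lambda>p. \<bar>x\<bar> ^ p / fact p) sums exp \<bar>x\<bar>"
    using exp_converges[of "\<bar>x\<bar>"] by (simp add: divide_inverse_commute)
  have "\<bar>\<Sum>p<N. x ^ p / fact p\<bar> \<le> (\<Sum>p<N. \<bar>x\<bar> ^ p / fact p)"
    by (rule order_trans[OF sum_abs]) (simp add: power_abs)
  also have "\<dots> \<le> (\<Sum>p. \<bar>x\<bar> ^ p / fact p)" by (rule sum_le_suminf[OF sums_summable[OF s]]) auto
  also have "\<dots> = exp \<bar>x\<bar>" by (rule sums_unique[OF s, symmetric])
  finally show ?thesis .
qed

definition hom_poly :: "real \<Rightarrow> nat \<Rightarrow> 'n::finite point \<Rightarrow> real"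
  where "hom_poly s k z = (\<Sum>i\<le>k. hom_coeff s k i * (coord_a z ^ i * coord_b z ^ (k - i)))"

lemma continuous_on_hom_poly: "continuous_on S (hom_poly s k)"
  unfolding hom_poly_def by (intro continuous_intros)

lemma hom_sol_eq_hom_poly: "t_coord z > 0 \<Longrightarrow> hom_sol s k z = coord_a z powr s * hom_poly s k z"
  unfolding hom_sol_def hom_poly_def sum_distrib_left
  by (intro sum.cong refl) (simp add: ab_pow_def powr_add powr_realpow coord_a_pos)

text \<open>The binomial theorem for b = 2 rho - a, a useful form because rho is a function of (y',
  |z|^2) whereas b is not.\<close>

lemma hom_poly_expand:
  "hom_poly s k z = (\<Sum>i\<le>k. \<Sum>l\<le>k - i. (hom_coeff s k i * real ((k - i) choose l) * (- 1) ^ l * 2 ^ (k - i - l)) *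
    (coord_a z ^ (i + l) * rho z ^ (k - i - l)))"
proof -
  have "coord_b z ^ m = (\<Sum>l\<le>m. real (m choose l) * (- 1) ^ l * 2 ^ (m - l) * (coord_a z ^ l * rho z ^ (m - l)))" for m
  proof -
    have "coord_b z ^ m = (- coord_a z + 2 * rho z) ^ m" by (simp add: coord_a_def coord_b_def)
    also have "\<dots> = (\<Sum>l\<le>m. real (m choose l) * (- coord_a z) ^ l * (2 * rho z) ^ (m - l))" by (rule binomial_ring)
    also have "\<dots> = (\<Sum>l\<le>m. real (m choose l) * (- 1) ^ l * 2 ^ (m - l) * (coord_a z ^ l * rho z ^ (m - l)))"
      by (intro sum.cong refl) (simp add: power_mult_distrib power_minus[of "coord_a z"] mult_ac)
    finally show ?thesis .
  qed
  then show ?thesis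
    unfolding hom_poly_def by (intro sum.cong refl) (simp add: sum_distrib_left power_add mult_ac)
qed

lemma horizontal_inner: "((\<xi>, 0, 0) :: 'n::finite point) \<bullet> z = \<xi> \<bullet> fst z"
  by (simp add: inner_prod_def)

context
  fixes s \<gamma> :: real and \<Psi> :: "'n::finite point \<Rightarrow> real" and G :: "'n point \<Rightarrow> 'n point"
  assumes s: "0 < s" "s < 1"
    and H1: "\<And>r. r > 0 \<Longrightarrow> (\<Psi>, G) \<in> H1_Gamma s r"
    and weak: "\<And>\<Phi>. \<Phi> \<in> Cc_infinity (closure half_space - Gamma_plus) \<Longrightarrow>
      (\<integral>z. weight (1 - 2 * s) z * (G z \<bullet> gradient \<Phi> z) \<partial>lebesgue) = 0"
    and \<gamma>: "\<gamma> \<ge> 0"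
    and hom: "AE z\<in>half_space in lebesgue. \<Psi> z = norm z powr \<gamma> * \<Psi> (z /\<^sub>R norm z)"
    and neq: "\<And>j::nat. \<gamma> \<noteq> real j + s"
begin

context
  fixes d :: real
  assumes d: "d > 0"
begin

text \<open>The bump is positive exactly on |z| < d and a^s is positive for t > 0, so a vanishing
  density forces Psi = 0 on the half-ball. The factor a^s is the one split off from
  \<open>hom_sol\<close>.\<close>

definition dens :: "'n point \<Rightarrow> real"
  where "dens z = weight (1 - 2 * s) z * (\<Psi> z * (coord_a z powr s * bump (d\<^sup>2 - z \<bullet> z)))"

lemma smooth_fun_bump: "smooth_fun (\<lambda>v. bump (d\<^sup>2 - v))"
  using cutoff_bump[OF d] by (simp add: cutoff_def)

lemma bump_eq_0: "norm (z :: 'n point) > d \<Longrightarrow> bump (d\<^sup>2 - z \<bullet> z) = 0"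
  using d power_strict_mono[of d "norm z" 2] by (simp add: bump_def dot_square_norm)

lemma dens_integrable: "integrable lebesgue dens"
proof -
  have "continuous_on UNIV (\<lambda>z::'n point. coord_a z powr s)"
    by (rule continuous_on_powr') (use s in \<open>auto intro!: continuous_intros simp: coord_a_nonneg\<close>)
  then have "continuous_on UNIV (\<lambda>z::'n point. coord_a z powr s * bump (d\<^sup>2 - z \<bullet> z))"
    by (intro continuous_on_mult continuous_on_smooth_norm_sq smooth_fun_bump)
  from weighted_integrable[OF s H1 weak \<gamma> hom this, of d] show ?thesis
    unfolding dens_def[abs_def] using bump_eq_0 by simp
qed

lemma dens_nonzero: "dens z \<noteq> 0 \<Longrightarrow> t_coord z > 0 \<and> norm z \<le> d"
  using bump_eq_0[of z] by (auto simp: dens_def weight_def half_space_def not_le[symmetric] split: split_indicator_asm)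

lemma dens_mult_integrable:
  assumes "continuous_on UNIV g" shows "integrable lebesgue (\<lambda>z. dens z * g z)"
  using integrable_mult_continuous_compact[OF dens_integrable compact_cball[of 0 d], of "\<lambda>z. z" g] dens_nonzero assms
  by auto

lemma dens_monomial: "(\<integral>z. dens z * (hom_poly s k z * (\<xi> \<bullet> fst z) ^ p * (z \<bullet> z) ^ m) \<partial>lebesgue) = 0"
proof -
  \<comment> \<open>Polynomial factors in |z|^2 come from the free choice of kappa.\<close>
  have "cutoff (\<lambda>v. v ^ m * bump (d\<^sup>2 - v))" by (rule cutoff_mult[OF smooth_fun_power cutoff_bump[OF d]])
  from moment_eq_0[OF s H1 weak \<gamma> hom neq this, of k \<xi> p]
  have "moment s \<Psi> k \<xi> p (\<lambda>v. v ^ m * bump (d\<^sup>2 - v)) = 0" by simp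
  then have "(\<integral>z. weight (1 - 2 * s) z * (\<Psi> z * (hom_sol s k z * ((\<xi>, 0, 0) \<bullet> z) ^ p * ((z \<bullet> z) ^ m * bump (d\<^sup>2 - z \<bullet> z)))) \<partial>lebesgue) = 0"
    unfolding moment_def .
  moreover have "weight (1 - 2 * s) z * (\<Psi> z * (hom_sol s k z * ((\<xi>, 0, 0) \<bullet> z) ^ p * ((z \<bullet> z) ^ m * bump (d\<^sup>2 - z \<bullet> z)))) =
      dens z * (hom_poly s k z * (\<xi> \<bullet> fst z) ^ p * (z \<bullet> z) ^ m)" for z
    by (cases "t_coord z > 0")
       (simp_all add: dens_def hom_sol_eq_hom_poly horizontal_inner weight_def half_space_def)
  ultimately show ?thesis by simp
qed

lemma dens_exp: "(\<integral>z. dens z * (hom_poly s k z * (exp (\<xi> \<bullet> fst z) * (z \<bullet> z) ^ m)) \<partial>lebesgue) = 0"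
proof -
  define P where "P z = hom_poly s k z * (z \<bullet> z) ^ m" for z :: "'n point"
  have Pc: "continuous_on UNIV P" unfolding P_def by (intro continuous_intros continuous_on_hom_poly)
  define E where "E N z = (\<Sum>p<N. (\<xi> \<bullet> fst z) ^ p / fact p)" for N :: nat and z :: "'n point"
  have Ec: "continuous_on UNIV (E N)" for N unfolding E_def by (intro continuous_intros) auto
  have "(\<lambda>N. \<integral>z. dens z * (P z * E N z) \<partial>lebesgue) \<longlonglongrightarrow> (\<integral>z. dens z * (P z * exp (\<xi> \<bullet> fst z)) \<partial>lebesgue)"
  proof (rule integral_dominated_convergence)
    show "integrable lebesgue (\<lambda>z. \<bar>dens z * (P z * exp \<bar>\<xi> \<bullet> fst z\<bar>)\<bar>)"
      by (intro integrable_abs dens_mult_integrable continuous_intros Pc)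
    show "(\<lambda>z. dens z * (P z * exp (\<xi> \<bullet> fst z))) \<in> borel_measurable lebesgue"
      by (intro borel_measurable_integrable dens_mult_integrable continuous_intros Pc)
    show "(\<lambda>z. dens z * (P z * E N z)) \<in> borel_measurable lebesgue" for N
      by (intro borel_measurable_integrable dens_mult_integrable continuous_on_mult Ec Pc)
    have "norm (dens z * (P z * E N z)) \<le> \<bar>dens z * (P z * exp \<bar>\<xi> \<bullet> fst z\<bar>)\<bar>" for N z
      using mult_left_mono[OF exp_partial_sum_le[of "\<xi> \<bullet> fst z" N], of "\<bar>dens z\<bar> * \<bar>P z\<bar>"]
      by (simp add: E_def abs_mult mult.assoc)
    then show "AE z in lebesgue. norm (dens z * (P z * E N z)) \<le> \<bar>dens z * (P z * exp \<bar>\<xi> \<bullet> fst z\<bar>)\<bar>" for N by simp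
    have "(\<lambda>N. E N z) \<longlonglongrightarrow> exp (\<xi> \<bullet> fst z)" for z
      using exp_converges[of "\<xi> \<bullet> fst z"] by (simp add: sums_def E_def divide_inverse_commute)
    then show "AE z in lebesgue. (\<lambda>N. dens z * (P z * E N z)) \<longlonglongrightarrow> dens z * (P z * exp (\<xi> \<bullet> fst z))"
      by (intro always_eventually allI tendsto_mult tendsto_const)
  qed
  moreover have "(\<integral>z. dens z * (P z * E N z) \<partial>lebesgue) = 0" for N
  proof -
    have "dens z * (P z * E N z) = (\<Sum>p<N. (1 / fact p) * (dens z * (hom_poly s k z * (\<xi> \<bullet> fst z) ^ p * (z \<bullet> z) ^ m)))" for z
      unfolding E_def P_def sum_distrib_left by (intro sum.cong refl) simp
    moreover have "integrable lebesgue (\<lambda>z. (1 / fact p) * (dens z * (hom_poly s k z * (\<xi> \<bullet> fst z) ^ p * (z \<bullet> z) ^ m)))" for p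
      by (intro integrable_mult_right dens_mult_integrable continuous_intros continuous_on_hom_poly)
    ultimately show ?thesis using dens_monomial by (simp add: Bochner_Integration.integral_sum)
  qed
  ultimately have "(\<integral>z. dens z * (P z * exp (\<xi> \<bullet> fst z)) \<partial>lebesgue) = 0" by (simp add: LIMSEQ_const_iff)
  then show ?thesis by (simp add: P_def mult_ac)
qed

text \<open>Stone-Weierstrass in the variables (y', |z|^2) against
  \<open>dens z * hom_poly s k z\<close>; these variables stay in a compact set because the density
  is supported in |z| <= d.\<close>

lemma dens_hom_poly:
  fixes f :: "(real ^ 'n) \<times> real \<Rightarrow> real"
  assumes f: "continuous_on UNIV f"
  shows "(\<integral>z. dens z * (hom_poly s k z * f (fst z, z \<bullet> z)) \<partial>lebesgue) = 0"
proof -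
  have int: "integrable lebesgue (\<lambda>z. dens z * hom_poly s k z)"
    by (rule dens_mult_integrable[OF continuous_on_hom_poly])
  have K: "compact (cball (0 :: real ^ 'n) d \<times> {0..d\<^sup>2})" by (intro compact_Times) auto
  have "(\<integral>z. (dens z * hom_poly s k z) * f (fst z, z \<bullet> z) \<partial>lebesgue) = 0"
  proof (rule annihilates_continuous[OF int K _ _ f exp_monomials_continuous exp_monomials_mult exp_monomials_const exp_monomials_separate])
    fix z assume "dens z * hom_poly s k z \<noteq> 0"
    then have n: "norm z \<le> d" using dens_nonzero by auto
    then have "norm (fst z) \<le> d" using norm_fst_le[of "fst z" "snd z"] by simp
    with n show "(fst z, z \<bullet> z) \<in> cball 0 d \<times> {0..d\<^sup>2}"
      by (auto simp: dot_square_norm intro!: power_mono)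
  next
    fix g :: "(real ^ 'n) \<times> real \<Rightarrow> real" assume "g \<in> exp_monomials"
    then obtain c \<xi> m where g: "g = (\<lambda>y. c * (exp (\<xi> \<bullet> fst y) * snd y ^ m))" by (auto simp: exp_monomials_def)
    have "(\<integral>z. dens z * hom_poly s k z * g (fst z, z \<bullet> z) \<partial>lebesgue) =
        (\<integral>z. c * (dens z * (hom_poly s k z * (exp (\<xi> \<bullet> fst z) * (z \<bullet> z) ^ m))) \<partial>lebesgue)"
      by (simp add: g mult_ac)
    then show "(\<integral>z. dens z * hom_poly s k z * g (fst z, z \<bullet> z) \<partial>lebesgue) = 0" using dens_exp by simp
  qed (auto intro!: continuous_intros)
  then show ?thesis by (simp add: mult.assoc)
qed

text \<open>
  Substituting \<open>b = 2 \<rho> - a\<close>, the coefficient of \<open>a\<^sup>k\<close> in \<open>hom_poly s k\<close> is nonzero because the coefficients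
  alternate in sign; \<open>\<rho>\<close> is a continuous function of \<open>y'\<close> and \<open>\<bar>z\<bar>\<^sup>2\<close>.
\<close>
lemma dens_power_a:
  fixes f :: "(real ^ 'n) \<times> real \<Rightarrow> real"
  shows "continuous_on UNIV f \<Longrightarrow> (\<integral>z. dens z * (coord_a z ^ k * f (fst z, z \<bullet> z)) \<partial>lebesgue) = 0"
proof (induction k arbitrary: f rule: less_induct)
  case (less k)
  \<comment> \<open>Based on rho^2 = |z|^2 - |y'|^2; the maximum with 0 makes sense of the root
    beyond the range of (y', |z|^2).\<close>
  define r where "r y = sqrt (max 0 (snd y - fst y \<bullet> fst y))" for y :: "(real ^ 'n) \<times> real"
  have rc: "continuous_on UNIV r" unfolding r_def by (intro continuous_intros)
  have rho: "rho z = r (fst z, z \<bullet> z)" for z :: "'n point"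
    by (simp add: rho_def r_def inner_prod_def power2_eq_square)
  define J where "J i l = (\<integral>z. dens z * (coord_a z ^ (i + l) * (rho z ^ (k - i - l) * f (fst z, z \<bullet> z))) \<partial>lebesgue)" for i l
  define c where "c i l = hom_coeff s k i * real ((k - i) choose l) * (- 1) ^ l * 2 ^ (k - i - l)" for i l
  define I where "I = (\<integral>z. dens z * (coord_a z ^ k * f (fst z, z \<bullet> z)) \<partial>lebesgue)"
  have fz: "continuous_on UNIV (\<lambda>z::'n point. f (fst z, z \<bullet> z))"
    by (rule continuous_on_compose2[OF less.prems]) (auto intro!: continuous_intros)
  have J0: "J i l = 0" if "i + l < k" for i l
  proof -
    have "continuous_on UNIV (\<lambda>y. r y ^ (k - i - l) * f y)" by (intro continuous_intros rc less.prems)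
    from less.IH[OF that this] show ?thesis by (simp add: J_def rho)
  qed
  have Jk: "J i l = I" if "i + l = k" for i l
    using that by (auto simp: J_def I_def)
  have int: "integrable lebesgue (\<lambda>z. c i l * (dens z * (coord_a z ^ (i + l) * (rho z ^ (k - i - l) * f (fst z, z \<bullet> z)))))" for i l
    by (intro integrable_mult_right dens_mult_integrable continuous_intros fz)
  have "0 = (\<integral>z. dens z * (hom_poly s k z * f (fst z, z \<bullet> z)) \<partial>lebesgue)"
    using dens_hom_poly[OF less.prems] by simp
  also have "\<dots> = (\<integral>z. (\<Sum>i\<le>k. \<Sum>l\<le>k - i. c i l * (dens z * (coord_a z ^ (i + l) * (rho z ^ (k - i - l) * f (fst z, z \<bullet> z))))) \<partial>lebesgue)"
    unfolding hom_poly_expand c_def sum_distrib_left sum_distrib_right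
    by (intro Bochner_Integration.integral_cong refl sum.cong) (simp add: mult_ac)
  also have "\<dots> = (\<Sum>i\<le>k. \<Sum>l\<le>k - i. c i l * J i l)"
    unfolding J_def using int by (simp add: Bochner_Integration.integral_sum)
  also have "\<dots> = (\<Sum>i\<le>k. (- 1) ^ k * ((- 1) ^ i * hom_coeff s k i) * I)"
  proof (intro sum.cong refl)
    fix i assume i: "i \<in> {..k}"
    \<comment> \<open>The induction hypothesis kills all total degrees i + l < k, so only l = k - i
      survives.\<close>
    have "(\<Sum>l\<le>k - i. c i l * J i l) = (\<Sum>l\<in>{k - i}. c i l * J i l)"
      using i J0 by (intro sum.mono_neutral_right) auto
    also have "\<dots> = hom_coeff s k i * (- 1) ^ (k - i) * I" using i Jk[of i "k - i"] by (simp add: c_def)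
    also have "(- 1 :: real) ^ (k - i) = (- 1) ^ k * (- 1) ^ i"
      using i by (simp add: minus_one_power_iff)
    finally show "(\<Sum>l\<le>k - i. c i l * J i l) = (- 1) ^ k * ((- 1) ^ i * hom_coeff s k i) * I" by (simp only: mult_ac)
  qed
  also have "\<dots> = (- 1) ^ k * (\<Sum>i\<le>k. (- 1) ^ i * hom_coeff s k i) * I"
    by (simp only: sum_distrib_left sum_distrib_right)
  finally have "(- 1) ^ k * (\<Sum>i\<le>k. (- 1) ^ i * hom_coeff s k i) * I = 0" by simp
  moreover have "(\<Sum>i\<le>k. (- 1) ^ i * hom_coeff s k i) > 0"
    using hom_coeff_sign[OF s] by (intro sum_pos) auto
  ultimately show ?case by (simp add: I_def)
qed

text \<open>On t >= 0 the functions y', |z|^2 and a separate points: the first two determine rho,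
  then y_N = rho - a, and finally t as a nonnegative root.\<close>

lemma dens_eq_0: "AE z in lebesgue. dens z = 0"
proof (rule AE_eq_0_if_annihilates_continuous[OF dens_integrable])
  fix g :: "'n point \<Rightarrow> real" assume g: "continuous_on UNIV g"
  \<comment> \<open>The restriction to t >= 0 is essential: all functions in \<open>S\<close> are
    even in t.\<close>
  define K where "K = {z::'n point. t_coord z \<ge> 0} \<inter> cball 0 d"
  have K: "compact K"
    unfolding K_def by (intro closed_Int_compact closed_Collect_le continuous_intros compact_cball)
  define S where "S = {f. \<exists>k h. f = (\<lambda>z::'n point. coord_a z ^ k * h (fst z, z \<bullet> z)) \<and> h \<in> exp_monomials}"
  have SI: "(\<lambda>z::'n point. coord_a z ^ k * h (fst z, z \<bullet> z)) \<in> S" if "h \<in> exp_monomials" for k h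
    using that by (auto simp: S_def)
  show "(\<integral>z. dens z * g z \<partial>lebesgue) = 0"
  proof (rule annihilates_continuous[OF dens_integrable K _ _ g, where \<tau> = "\<lambda>z. z" and S = S])
    show "z \<in> K" if "dens z \<noteq> 0" for z using dens_nonzero[OF that] by (auto simp: K_def)
    show "continuous_on UNIV f" if f: "f \<in> S" for f
    proof -
      obtain k h where h: "f = (\<lambda>z. coord_a z ^ k * h (fst z, z \<bullet> z))" "h \<in> exp_monomials" using f by (auto simp: S_def)
      have "continuous_on UNIV (\<lambda>z::'n point. h (fst z, z \<bullet> z))"
        by (rule continuous_on_compose2[OF exp_monomials_continuous[OF h(2), of UNIV]]) (auto intro!: continuous_intros)
      then show ?thesis unfolding h(1) by (intro continuous_intros)
    qed
    show "(\<lambda>x. f x * f' x) \<in> S" if f: "f \<in> S" "f' \<in> S" for f f'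
    proof -
      obtain k h where h: "f = (\<lambda>z. coord_a z ^ k * h (fst z, z \<bullet> z))" "h \<in> exp_monomials" using f(1) by (auto simp: S_def)
      obtain k' h' where h': "f' = (\<lambda>z. coord_a z ^ k' * h' (fst z, z \<bullet> z))" "h' \<in> exp_monomials" using f(2) by (auto simp: S_def)
      have "(\<lambda>x. f x * f' x) = (\<lambda>z. coord_a z ^ (k + k') * (\<lambda>y. h y * h' y) (fst z, z \<bullet> z))"
        by (simp add: h h' power_add mult_ac)
      then show ?thesis using SI[OF exp_monomials_mult[OF h(2) h'(2)], of "k + k'"] by simp
    qed
    show "(\<lambda>x. c) \<in> S" for c using SI[OF exp_monomials_const[of c], of 0] by simp
    show "\<exists>f\<in>S. f x \<noteq> f y" if xy: "x \<in> K" "y \<in> K" "x \<noteq> y" for x y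
    proof (cases "(fst x, x \<bullet> x) = (fst y, y \<bullet> y)")
      case False
      then obtain h where "h \<in> exp_monomials" "h (fst x, x \<bullet> x) \<noteq> h (fst y, y \<bullet> y)" using exp_monomials_separate by blast
      then show ?thesis by (intro bexI[OF _ SI[of h 0]]) auto
    next
      case True
      have "coord_a x \<noteq> coord_a y"
      proof
        assume a: "coord_a x = coord_a y"
        have sq: "y_last x * y_last x + t_coord x * t_coord x = y_last y * y_last y + t_coord y * t_coord y"
        proof -
          have "fst x = fst y" "x \<bullet> x = y \<bullet> y" using True by auto
          then show ?thesis by (simp add: inner_prod_def)
        qed
        then have "rho x = rho y" by (simp add: rho_def power2_eq_square)
        with a have yl: "y_last x = y_last y" by (simp add: coord_a_def)
        with sq have "(t_coord x)\<^sup>2 = (t_coord y)\<^sup>2" by (simp add: power2_eq_square)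
        then have "t_coord x = t_coord y" using xy by (simp add: K_def power2_eq_iff_nonneg)
        with yl True xy(3) show False by (simp add: prod_eq_iff)
      qed
      then show ?thesis by (intro bexI[OF _ SI[OF exp_monomials_const[of 1], of 1]]) simp
    qed
    show "(\<integral>z. dens z * f z \<partial>lebesgue) = 0" if f: "f \<in> S" for f
      using f dens_power_a[OF exp_monomials_continuous] by (auto simp: S_def)
  qed (auto intro!: continuous_intros)
qed

lemma \<Psi>_eq_0_ball: "AE z in lebesgue. z \<in> half_space \<longrightarrow> norm z < d \<longrightarrow> \<Psi> z = 0"
  using dens_eq_0
proof eventually_elim
  case (elim z)
  show ?case
  proof (intro impI)
    assume z: "z \<in> half_space" "norm z < d"
    then have "d\<^sup>2 - z \<bullet> z > 0" by (simp add: dot_square_norm power_strict_mono)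
    then have "bump (d\<^sup>2 - z \<bullet> z) > 0" by (simp add: bump_def)
    moreover have "weight (1 - 2 * s) z > 0" "coord_a z powr s > 0"
      using z coord_a_pos[of z] by (auto simp: weight_def half_space_def)
    ultimately show "\<Psi> z = 0" using elim by (simp add: dens_def)
  qed
qed

end

text \<open>Countably many half-balls exhaust the half-space, each with its own null set.\<close>

lemma \<Psi>_eq_0: "AE z\<in>half_space in lebesgue. \<Psi> z = 0"
proof -
  have "AE z in lebesgue. \<forall>n::nat. z \<in> half_space \<longrightarrow> norm z < real (Suc n) \<longrightarrow> \<Psi> z = 0"
    by (subst AE_all_countable) (intro allI \<Psi>_eq_0_ball, simp)
  then show ?thesis
  proof eventually_elim
    case (elim z)
    obtain n where "norm z < real n" using reals_Archimedean2 by blast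
    then have "norm z < real (Suc n)" by simp
    with elim show ?case by blast
  qed
qed

end

theorem propositionB1:
  fixes s \<gamma> :: real
    and \<Psi> :: "'n::finite point \<Rightarrow> real"
    and grad_\<Psi> :: "'n point \<Rightarrow> 'n point"
  assumes "0 < s" and "s < 1"
    and "(\<Psi>, grad_\<Psi>) \<in> (\<Inter>r\<in>{0<..}. H1_Gamma s r)"
    and "\<not> (AE z\<in>half_space in lebesgue. \<Psi> z = 0)"
    and "\<And>\<Phi>. \<Phi> \<in> Cc_infinity (closure half_space - Gamma_plus) \<Longrightarrow>
      (LINT z:half_space|lebesgue.
         t_coord z powr (1 - 2 * s) * (grad_\<Psi> z \<bullet> gradient \<Phi> z)) = 0"
    and "\<gamma> \<ge> 0"
    and "AE z\<in>half_space in lebesgue.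
      \<Psi> z = norm z powr \<gamma> * \<Psi> (z /\<^sub>R norm z)"
  shows "\<exists>j::nat. \<gamma> = real j + s"
proof (rule ccontr)
  assume "\<not> (\<exists>j::nat. \<gamma> = real j + s)"
  then have neq: "\<gamma> \<noteq> real j + s" for j :: nat by blast
  have H1: "(\<Psi>, grad_\<Psi>) \<in> H1_Gamma s r" if "r > 0" for r using assms(3) that by blast
  have weak: "(\<integral>z. weight (1 - 2 * s) z * (grad_\<Psi> z \<bullet> gradient \<Phi> z) \<partial>lebesgue) = 0"
    if "\<Phi> \<in> Cc_infinity (closure half_space - Gamma_plus)" for \<Phi>
    using assms(5)[OF that] by (simp add: set_lebesgue_integral_def weight_def mult.assoc)
  from \<Psi>_eq_0[OF assms(1,2) H1 weak assms(6,7) neq] assms(4) show False by blast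
qed

end
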